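(* Let $\mathcal N$ be a vertex-weighted simple-crossing oriented network on a compact connected oriented surface $S$, with vertex weights regarded as indeterminates. Then: (i) for every path $p$ in $\mathcal N$ from a boundary vertex $u$ to a boundary vertex $v$, the boundary measurement $M^{[p]}$ is a homogeneous polynomial in the vertex weights; (ii) for every cycle $p$ in $\mathcal N$ with $[p]\neq 0$ in $H_1(S,\mathbb Z)$, the cycle measurement $M^{[p]}$ is a homogeneous polynomial in the vertex weights.
   Context: Let $S$ be a compact connected oriented surface, possibly with boundary. An oriented network on $S$ consists of a finite set of vertices in $S$ (possibly on $\partial S$) and a finite set of directed edges (continuous paths) whose endpoints are vertices and whose interiors meet neither the boundary nor any other edge; edges that are closed oriented loops without endpoints are allowed. Each boundary vertex has degree at most one (source, sink or isolated). The network is simple-crossing if each non-boundary vertex has in-degree 2 and out-degree 2 and its two incoming edges (hence its two outgoing edges) are adjacent in the cyclic order. Each interior vertex $v$ carries a weight $x_v$. At an interior vertex, list the incident edges in counterclockwise order as $e_1,e_2,f_1,f_2$ with $e_1,e_2$ incoming and $f_1,f_2$ outgoing; $e_1,f_1$ are called the highway and $e_2,f_2$ the underway. A highway path is a directed walk in $\mathcal N$ which never enters a vertex via $e_2$ and leaves it via $f_2$ (the other three combinations are allowed). Its weight $\mathrm{wt}$ is the product, with multiplicity, of the weights $x_v$ over all passages through interior vertices $v$ that enter via $e_1$ and leave via $f_1$. Highway cycles (closed directed walks, no distinguished starting vertex) and their weights are defined in the same way. The multiplicity $\mathrm{mult}(q)$ of a cycle $q$ is the largest $k$ such that $q$ is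 obtained by repeating $k$ times some cycle. Two paths $p,q$ with the same endpoints are homologous ($p\sim q$) if the cycle obtained by following $p$ and then the reverse of $q$ has trivial class in $H_1(S,\mathbb Z)$. For a path $p$ from boundary vertex $u$ to boundary vertex $v$, the boundary measurement is $M^{[p]}=\sum_{q\sim p}\mathrm{wt}(q)$, summed over highway paths $q$ from $u$ to $v$ homologous to $p$. For a cycle $p$, the cycle measurement is $M^{[p]}=\sum_{[q]=[p]}\frac{1}{\mathrm{mult}(q)}\mathrm{wt}(q)$, summed over highway cycles $q$ with the same class in $H_1(S,\mathbb Z)$ as $p$. A priori these are formal infinite sums. *)

theory Defs
  imports "HOL-Homology.Homology" "HOL-Complex_Analysis.Complex_Analysis"
begin

section \<open>Oriented surfaces with boundary\<close>

text \<open>A chart is a pair of an open domain and a homeomorphism from it onto a relatively open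
  subset of the closed upper half-plane.\<close>

type_synonym 'a chart = "'a set \<times> ('a \<Rightarrow> complex)"

definition surface_chart :: "'a topology \<Rightarrow> 'a chart \<Rightarrow> bool" where
  "surface_chart S c \<longleftrightarrow> (case c of (U, \<phi>) \<Rightarrow>
     openin S U \<and>
     openin (top_of_set {z. 0 \<le> Im z}) (\<phi> ` U) \<and>
     homeomorphic_map (subtopology S U) (top_of_set (\<phi> ` U)) \<phi>)"

text \<open>A homeomorphism of plane domains preserves the orientation at a point iff it maps small
  counterclockwise circles around the point to loops of winding number 1 around its image.
  No condition is needed at boundary points of the half-plane: every neighbourhood of
  such a point contains interior points.\<close>

definition coherent_charts :: "'a chart \<Rightarrow> 'a chart \<Rightarrow> bool" where
  "coherent_charts c d \<longleftrightarrow> (case c of (U, \<phi>) \<Rightarrow> case d of (V, \<psi>) \<Rightarrow>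
     \<forall>x \<in> U \<inter> V. 0 < Im (\<phi> x) \<longrightarrow>
       (\<forall>\<^sub>F r in at_right 0.
          winding_number ((\<psi> \<circ> inv_into U \<phi>) \<circ> circlepath (\<phi> x) r) (\<psi> x) = 1))"

definition oriented_atlas :: "'a topology \<Rightarrow> 'a chart set \<Rightarrow> bool" where
  "oriented_atlas S A \<longleftrightarrow>
     (\<forall>c \<in> A. surface_chart S c) \<and>
     \<Union> (fst ` A) = topspace S \<and>
     (\<forall>c \<in> A. \<forall>d \<in> A. coherent_charts c d)"

text \<open>Second countability follows from compactness and the existence of charts.\<close>

definition compact_connected_oriented_surface :: "'a topology \<Rightarrow> 'a chart set \<Rightarrow> bool" where
  "compact_connected_oriented_surface S A \<longleftrightarrow>
     topspace S \<noteq> {} \<and> Hausdorff_space S \<and> compact_space S \<and> connected_space S \<and>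
     oriented_atlas S A"

definition surface_boundary :: "'a topology \<Rightarrow> 'a chart set \<Rightarrow> 'a set" where
  "surface_boundary S A = {x \<in> topspace S. \<exists>(U, \<phi>) \<in> A. x \<in> U \<and> Im (\<phi> x) = 0}"

definition positive_chart :: "'a topology \<Rightarrow> 'a chart set \<Rightarrow> 'a chart \<Rightarrow> bool" where
  "positive_chart S A c \<longleftrightarrow> surface_chart S c \<and> (\<forall>d \<in> A. coherent_charts c d \<and> coherent_charts d c)"


section \<open>Oriented networks\<close>

text \<open>Vertices are points of the surface. An edge \<open>e\<close> is traced by \<open>curve N e\<close> on the unit
  interval, from its tail \<open>curve N e 0\<close> to its head \<open>curve N e 1\<close>. A closed loop without endpoints
  is an edge whose curve is closed and contains no vertex, so its "tail" and "head" are only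
  a choice of base point on it. The last four fields label
  the edges \<open>e\<^sub>1, e\<^sub>2, f\<^sub>1, f\<^sub>2\<close> at each interior vertex; their values elsewhere are irrelevant.\<close>

record ('a, 'e) network =
  verts :: "'a set"
  edges :: "'e set"
  curve :: "'e \<Rightarrow> real \<Rightarrow> 'a"
  highway_in :: "'a \<Rightarrow> 'e"
  underway_in :: "'a \<Rightarrow> 'e"
  highway_out :: "'a \<Rightarrow> 'e"
  underway_out :: "'a \<Rightarrow> 'e"

abbreviation tail :: "('a, 'e) network \<Rightarrow> 'e \<Rightarrow> 'a" where
  "tail N e \<equiv> curve N e 0"

abbreviation head :: "('a, 'e) network \<Rightarrow> 'e \<Rightarrow> 'a" where
  "head N e \<equiv> curve N e 1"

definition in_edges :: "('a, 'e) network \<Rightarrow> 'a \<Rightarrow> 'e set" where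
  "in_edges N v = {e \<in> edges N. head N e = v}"

definition out_edges :: "('a, 'e) network \<Rightarrow> 'a \<Rightarrow> 'e set" where
  "out_edges N v = {e \<in> edges N. tail N e = v}"

definition boundary_verts :: "'a topology \<Rightarrow> 'a chart set \<Rightarrow> ('a, 'e) network \<Rightarrow> 'a set" where
  "boundary_verts S A N = verts N \<inter> surface_boundary S A"

definition interior_verts :: "'a topology \<Rightarrow> 'a chart set \<Rightarrow> ('a, 'e) network \<Rightarrow> 'a set" where
  "interior_verts S A N = verts N - surface_boundary S A"

definition arc_edge :: "'a topology \<Rightarrow> 'a chart set \<Rightarrow> ('a, 'e) network \<Rightarrow> 'e \<Rightarrow> bool" where
  "arc_edge S A N e \<longleftrightarrow>
     pathin S (curve N e) \<and>
     tail N e \<in> verts N \<and> head N e \<in> verts N \<and>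
     inj_on (curve N e) {0<..<1} \<and>
     curve N e ` {0<..<1} \<inter> (verts N \<union> surface_boundary S A) = {} \<and>
     (\<forall>e' \<in> edges N - {e}. curve N e ` {0<..<1} \<inter> curve N e' ` {0..1} = {})"

definition loop_edge :: "'a topology \<Rightarrow> 'a chart set \<Rightarrow> ('a, 'e) network \<Rightarrow> 'e \<Rightarrow> bool" where
  "loop_edge S A N e \<longleftrightarrow>
     pathin S (curve N e) \<and>
     tail N e = head N e \<and>
     inj_on (curve N e) {0..<1} \<and>
     curve N e ` {0..1} \<inter> (verts N \<union> surface_boundary S A) = {} \<and>
     (\<forall>e' \<in> edges N - {e}. curve N e ` {0..1} \<inter> curve N e' ` {0..1} = {})"

definition oriented_network :: "'a topology \<Rightarrow> 'a chart set \<Rightarrow> ('a, 'e) network \<Rightarrow> bool" where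
  "oriented_network S A N \<longleftrightarrow>
     finite (verts N) \<and> verts N \<subseteq> topspace S \<and> finite (edges N) \<and>
     (\<forall>e \<in> edges N. arc_edge S A N e \<or> loop_edge S A N e) \<and>
     (\<forall>v \<in> boundary_verts S A N. card (in_edges N v) + card (out_edges N v) \<le> 1)"

text \<open>The ends of edges at a vertex are topological arcs, so their cyclic order is
  read off in a positively oriented chart in which these ends become straight rays. Such a chart
  exists for any finite family of arcs that meet only in the vertex (Schoenflies), so that this
  is no tameness restriction. Counterclockwise, the rays in directions
  \<open>-1, -\<i>, 1, \<i>\<close> follow each other in this order.\<close>

definition enters_along :: "('a \<Rightarrow> complex) \<Rightarrow> (real \<Rightarrow> 'a) \<Rightarrow> complex \<Rightarrow> bool" where
  "enters_along \<phi> g d \<longleftrightarrow>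
     (\<forall>\<^sub>F t in at_left 1. \<exists>s>0. \<phi> (g t) = \<phi> (g 1) + complex_of_real s * d)"

definition leaves_along :: "('a \<Rightarrow> complex) \<Rightarrow> (real \<Rightarrow> 'a) \<Rightarrow> complex \<Rightarrow> bool" where
  "leaves_along \<phi> g d \<longleftrightarrow>
     (\<forall>\<^sub>F t in at_right 0. \<exists>s>0. \<phi> (g t) = \<phi> (g 0) + complex_of_real s * d)"

definition counterclockwise_at ::
    "'a topology \<Rightarrow> 'a chart set \<Rightarrow> ('a, 'e) network \<Rightarrow> 'a \<Rightarrow> 'e \<Rightarrow> 'e \<Rightarrow> 'e \<Rightarrow> 'e \<Rightarrow> bool" where
  "counterclockwise_at S A N v e1 e2 f1 f2 \<longleftrightarrow>
     (\<exists>U \<phi>. positive_chart S A (U, \<phi>) \<and> v \<in> U \<and> 0 < Im (\<phi> v) \<and>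
        enters_along \<phi> (curve N e1) (-1) \<and>
        enters_along \<phi> (curve N e2) (-\<i>) \<and>
        leaves_along \<phi> (curve N f1) 1 \<and>
        leaves_along \<phi> (curve N f2) \<i>)"

text \<open>Since the incoming edges are adjacent in the cyclic order, the labels
  are determined by the network, so fixing them in the record is no extra structure.\<close>

definition simple_crossing_network ::
    "'a topology \<Rightarrow> 'a chart set \<Rightarrow> ('a, 'e) network \<Rightarrow> bool" where
  "simple_crossing_network S A N \<longleftrightarrow>
     oriented_network S A N \<and>
     (\<forall>v \<in> interior_verts S A N.
        highway_in N v \<noteq> underway_in N v \<and> in_edges N v = {highway_in N v, underway_in N v} \<and>
        highway_out N v \<noteq> underway_out N v \<and> out_edges N v = {highway_out N v, underway_out N v} \<and>
        counterclockwise_at S A N v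
          (highway_in N v) (underway_in N v) (highway_out N v) (underway_out N v))"


section \<open>Directed walks, highway walks and weights\<close>

fun walk :: "('a, 'e) network \<Rightarrow> 'a \<Rightarrow> 'e list \<Rightarrow> 'a \<Rightarrow> bool" where
  "walk N u [] v \<longleftrightarrow> u \<in> verts N \<and> u = v"
| "walk N u (e # es) v \<longleftrightarrow> e \<in> edges N \<and> tail N e = u \<and> walk N (head N e) es v"

definition path_passages :: "'e list \<Rightarrow> ('e \<times> 'e) list" where
  "path_passages es = zip es (tl es)"

definition cyclic_passages :: "'e list \<Rightarrow> ('e \<times> 'e) list" where
  "cyclic_passages es = zip es (rotate1 es)"

text \<open>Since closed loops are disjoint from all other edges, the closed walks through a loop
  are exactly its repetitions.\<close>

definition closed_walk :: "('a, 'e) network \<Rightarrow> 'e list \<Rightarrow> bool" where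
  "closed_walk N es \<longleftrightarrow> es \<noteq> [] \<and> set es \<subseteq> edges N \<and>
     (\<forall>(e, f) \<in> set (cyclic_passages es). head N e = tail N f)"

text \<open>The condition \<open>head N e \<in> verts N\<close> excludes the base points of closed loops.
  Boundary vertices have degree at most one and hence no passages.\<close>

definition forbidden_passage :: "('a, 'e) network \<Rightarrow> 'e \<times> 'e \<Rightarrow> bool" where
  "forbidden_passage N = (\<lambda>(e, f). head N e \<in> verts N \<and>
     e = underway_in N (head N e) \<and> f = underway_out N (head N e))"

definition highway_passage :: "('a, 'e) network \<Rightarrow> 'e \<times> 'e \<Rightarrow> bool" where
  "highway_passage N = (\<lambda>(e, f). head N e \<in> verts N \<and>
     e = highway_in N (head N e) \<and> f = highway_out N (head N e))"

definition highway_path :: "('a, 'e) network \<Rightarrow> 'a \<Rightarrow> 'e list \<Rightarrow> 'a \<Rightarrow> bool" where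
  "highway_path N u es v \<longleftrightarrow>
     walk N u es v \<and> (\<forall>a \<in> set (path_passages es). \<not> forbidden_passage N a)"

definition highway_closed_walk :: "('a, 'e) network \<Rightarrow> 'e list \<Rightarrow> bool" where
  "highway_closed_walk N es \<longleftrightarrow>
     closed_walk N es \<and> (\<forall>a \<in> set (cyclic_passages es). \<not> forbidden_passage N a)"

text \<open>Monomials in indeterminates \<open>x\<^sub>v\<close> are finitely supported exponent functions, and
  polynomials are finitely supported functions from monomials to coefficients.\<close>

type_synonym 'v monomial = "'v \<Rightarrow>\<^sub>0 nat"
type_synonym 'v mpoly = "'v monomial \<Rightarrow>\<^sub>0 rat"

definition passages_weight :: "('a, 'e) network \<Rightarrow> ('e \<times> 'e) list \<Rightarrow> 'a monomial" where
  "passages_weight N as =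
     (\<Sum>(e, f) \<leftarrow> as. if highway_passage N (e, f) then Poly_Mapping.single (head N e) 1 else 0)"

definition path_weight :: "('a, 'e) network \<Rightarrow> 'e list \<Rightarrow> 'a monomial" where
  "path_weight N es = passages_weight N (path_passages es)"

definition closed_walk_weight :: "('a, 'e) network \<Rightarrow> 'e list \<Rightarrow> 'a monomial" where
  "closed_walk_weight N es = passages_weight N (cyclic_passages es)"


section \<open>Homology classes\<close>

definition edge_simplex :: "('a, 'e) network \<Rightarrow> 'e \<Rightarrow> (nat \<Rightarrow> real) \<Rightarrow> 'a" where
  "edge_simplex N e = restrict (\<lambda>x. curve N e (x 1)) (standard_simplex 1)"

definition walk_chain :: "('a, 'e) network \<Rightarrow> 'e list \<Rightarrow> 'a chain" where
  "walk_chain N es = (\<Sum>e \<leftarrow> es. frag_of (edge_simplex N e))"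

definition H1_class :: "'a topology \<Rightarrow> 'a chain \<Rightarrow> 'a chain set" where
  "H1_class S c = homologous_rel_set 1 S {} c"

text \<open>Following \<open>p\<close> and then the reverse of \<open>q\<close> gives a cycle represented by
  \<open>walk_chain N p - walk_chain N q\<close>.\<close>

definition homologous_paths :: "'a topology \<Rightarrow> ('a, 'e) network \<Rightarrow> 'e list \<Rightarrow> 'e list \<Rightarrow> bool" where
  "homologous_paths S N p q \<longleftrightarrow>
     H1_class S (walk_chain N p - walk_chain N q) = \<one>\<^bsub>homology_group 1 S\<^esub>"


section \<open>Cycles: closed walks without distinguished starting vertex\<close>

definition cycle_of :: "'e list \<Rightarrow> 'e list set" where
  "cycle_of es = range (\<lambda>n. rotate n es)"

definition cycles :: "('a, 'e) network \<Rightarrow> 'e list set set" where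
  "cycles N = cycle_of ` {es. closed_walk N es}"

definition highway_cycles :: "('a, 'e) network \<Rightarrow> 'e list set set" where
  "highway_cycles N = cycle_of ` {es. highway_closed_walk N es}"

text \<open>Class and weight do not depend on the chosen representative, see
  \<open>cycle_class_cycle_of\<close> and \<open>cycle_weight_cycle_of\<close> below.\<close>

definition cycle_class :: "'a topology \<Rightarrow> ('a, 'e) network \<Rightarrow> 'e list set \<Rightarrow> 'a chain set" where
  "cycle_class S N q = H1_class S (walk_chain N (SOME es. es \<in> q))"

definition cycle_weight :: "('a, 'e) network \<Rightarrow> 'e list set \<Rightarrow> 'a monomial" where
  "cycle_weight N q = closed_walk_weight N (SOME es. es \<in> q)"

definition cycle_mult :: "('a, 'e) network \<Rightarrow> 'e list set \<Rightarrow> nat" where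
  "cycle_mult N q =
     Max {k. \<exists>r. closed_walk N r \<and> q = cycle_of (concat (replicate k r))}"


lemma in_cycle_of_iff: "fs \<in> cycle_of es \<longleftrightarrow> (\<exists>n. fs = rotate n es)"
  by (auto simp: cycle_of_def)

lemma some_cycle_of: "\<exists>n. (SOME fs. fs \<in> cycle_of es) = rotate n es"
proof -
  have "rotate 0 es \<in> cycle_of es" unfolding cycle_of_def by blast
  then have "(SOME fs. fs \<in> cycle_of es) \<in> cycle_of es" by (rule someI)
  then show ?thesis by (simp add: in_cycle_of_iff)
qed

lemma cyclic_passages_rotate: "cyclic_passages (rotate n es) = rotate n (cyclic_passages es)"
proof -
  have 1: "cyclic_passages (rotate1 es) = rotate1 (cyclic_passages es)" for es :: "'e list"
  proof (cases es)
    case (Cons a xs)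
    then show ?thesis
    proof (cases xs)
      case (Cons b ys)
      have "zip ((b # ys) @ [a]) ((ys @ [a]) @ [b]) = zip (b # ys) (ys @ [a]) @ zip [a] [b]"
        by (rule zip_append) simp
      then show ?thesis using Cons \<open>es = a # xs\<close> by (simp add: cyclic_passages_def)
    qed (simp add: cyclic_passages_def)
  qed (simp add: cyclic_passages_def)
  show ?thesis by (induction n) (auto simp: 1)
qed

lemma sum_list_rotate: "sum_list (rotate n xs) = sum_list (xs :: 'b::comm_monoid_add list)"
proof (induction n)
  case (Suc n)
  have "sum_list (rotate1 ys) = sum_list ys" for ys :: "'b list"
    by (cases ys) (simp_all add: add.commute)
  then show ?case using Suc by simp
qed simp

lemma cycle_weight_cycle_of: "cycle_weight N (cycle_of es) = closed_walk_weight N es"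
  using some_cycle_of[of es]
  by (auto simp: cycle_weight_def closed_walk_weight_def passages_weight_def
      cyclic_passages_rotate rotate_map[symmetric] sum_list_rotate)

lemma cycle_class_cycle_of: "cycle_class S N (cycle_of es) = H1_class S (walk_chain N es)"
  using some_cycle_of[of es]
  by (auto simp: cycle_class_def walk_chain_def rotate_map[symmetric] sum_list_rotate)

lemma singular_simplex_edge_simplex:
  assumes "pathin S (curve N e)"
  shows "singular_simplex 1 S (edge_simplex N e)"
proof -
  have "continuous_map (subtopology (powertop_real UNIV) (standard_simplex 1))
          (subtopology euclideanreal {0..1}) (\<lambda>x. x 1)"
    by (auto simp: continuous_map_in_subtopology standard_simplex_def 
        intro!: continuous_map_from_subtopology continuous_map_product_projection)
  from continuous_map_compose[OF this assms[unfolded pathin_def]]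
  have "continuous_map (subtopology (powertop_real UNIV) (standard_simplex 1)) S (\<lambda>x. curve N e (x 1))"
    by (simp add: o_def)
  then show ?thesis unfolding singular_simplex_def edge_simplex_def
    by (auto elim!: continuous_map_eq)
qed

lemma chain_boundary_edge_simplex:
  "chain_boundary 1 (frag_of (edge_simplex N e)) =
     frag_of (restrict (\<lambda>_. head N e) (standard_simplex 0)) -
     frag_of (restrict (\<lambda>_. tail N e) (standard_simplex 0))"
proof -
  have a: "singular_face 1 0 (edge_simplex N e) = restrict (\<lambda>_. head N e) (standard_simplex 0)"
    using simplical_face_in_standard_simplex[of 1 0]
    by (fastforce simp: singular_face_def edge_simplex_def simplical_face_def fun_eq_iff standard_simplex_0)
  have b: "singular_face 1 1 (edge_simplex N e) = restrict (\<lambda>_. tail N e) (standard_simplex 0)"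
    using simplical_face_in_standard_simplex[of 1 1]
    by (fastforce simp: singular_face_def edge_simplex_def simplical_face_def fun_eq_iff standard_simplex_0)
  show ?thesis using a b by (simp add: chain_boundary_of frag_cmul_minus_one)
qed

lemma closed_boundary:
  assumes "closed_walk N es" shows "chain_boundary 1 (walk_chain N es) = 0"
proof -
  let ?p = "\<lambda>x. frag_of (restrict (\<lambda>_. x) (standard_simplex 0))"
  have "chain_boundary 1 (walk_chain N es) = (\<Sum>e\<leftarrow>es. ?p (head N e) - ?p (tail N e))"
    unfolding walk_chain_def
    by (induction es) (simp_all del: restrict_apply One_nat_def add: chain_boundary_edge_simplex chain_boundary_add)
  also have "\<dots> = (\<Sum>e\<leftarrow>es. ?p (head N e)) - (\<Sum>e\<leftarrow>es. ?p (tail N e))"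
    by (rule sum_list_subtractf)
  also have "map (head N) es = map (tail N) (rotate1 es)"
  proof (rule nth_equalityI)
    fix i assume "i < length (map (head N) es)"
    then have i: "i < length es" by simp
    then have "(es ! i, rotate1 es ! i) \<in> set (cyclic_passages es)"
      unfolding cyclic_passages_def set_zip by auto
    then have "head N (es ! i) = tail N (rotate1 es ! i)"
      using assms unfolding closed_walk_def by blast
    then show "map (head N) es ! i = map (tail N) (rotate1 es) ! i"
      using i by simp
  qed simp
  then have "(\<Sum>e\<leftarrow>es. ?p (head N e)) = (\<Sum>e\<leftarrow>rotate1 es. ?p (tail N e))"
    by (simp only: map_map[symmetric, unfolded o_def, of ?p "head N"]
          map_map[symmetric, unfolded o_def, of ?p "tail N"])
  also have "\<dots> = (\<Sum>e\<leftarrow>es. ?p (tail N e))"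
    using sum_list_rotate[of 1 "map (\<lambda>e. ?p (tail N e)) es"] by (simp add: rotate1_map del: restrict_apply)
  finally show ?thesis by (simp del: restrict_apply)
qed

lemma H1_class_closed_walk:
  assumes "oriented_network S A N" "closed_walk N es"
  shows "H1_class S (walk_chain N es) \<in> carrier (homology_group 1 S)"
proof -
  have "singular_chain 1 S (walk_chain N es)" if "set es \<subseteq> edges N" for es
    using that unfolding walk_chain_def
  proof (induction es)
    case (Cons e es)
    with assms(1) have "pathin S (curve N e)"
      by (auto simp: oriented_network_def arc_edge_def loop_edge_def)
    then have "singular_chain 1 S (frag_of (edge_simplex N e))"
      by (simp only: singular_chain_of singular_simplex_edge_simplex)
    with Cons show ?case by (simp del: One_nat_def add: singular_chain_add)
  qed simp
  moreover have "set es \<subseteq> edges N" using assms(2) by (simp add: closed_walk_def)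
  ultimately have "singular_relcycle 1 S {} (walk_chain N es)"
    using closed_boundary[OF assms(2)] by (simp add: singular_cycle)
  then show ?thesis
    using carrier_relative_homology_group[of 1 S "{}"] by (auto simp: H1_class_def)
qed


section \<open>Formal sums and measurements\<close>

text \<open>The formal sum of the terms \<open>c q * wt q\<close> for \<open>q \<in> Q\<close> is the formal power series \<open>F\<close>
  (given by its coefficients); this requires each monomial to occur only finitely often.\<close>

definition has_formal_sum ::
    "'q set \<Rightarrow> ('q \<Rightarrow> rat) \<Rightarrow> ('q \<Rightarrow> 'v monomial) \<Rightarrow> ('v monomial \<Rightarrow> rat) \<Rightarrow> bool" where
  "has_formal_sum Q c wt F \<longleftrightarrow>
     (\<forall>m. finite {q \<in> Q. wt q = m} \<and> F m = (\<Sum>q | q \<in> Q \<and> wt q = m. c q))"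

definition has_boundary_measurement ::
    "'a topology \<Rightarrow> ('a, 'e) network \<Rightarrow> 'a \<Rightarrow> 'e list \<Rightarrow> 'a \<Rightarrow> ('a monomial \<Rightarrow> rat) \<Rightarrow> bool" where
  "has_boundary_measurement S N u p v F \<longleftrightarrow>
     has_formal_sum {q. highway_path N u q v \<and> homologous_paths S N q p}
       (\<lambda>_. 1) (path_weight N) F"

definition has_cycle_measurement ::
    "'a topology \<Rightarrow> ('a, 'e) network \<Rightarrow> 'e list set \<Rightarrow> ('a monomial \<Rightarrow> rat) \<Rightarrow> bool" where
  "has_cycle_measurement S N p F \<longleftrightarrow>
     has_formal_sum {q \<in> highway_cycles N. cycle_class S N q = cycle_class S N p}
       (\<lambda>q. 1 / of_nat (cycle_mult N q)) (cycle_weight N) F"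

definition monomial_degree :: "'v monomial \<Rightarrow> nat" where
  "monomial_degree m = (\<Sum>v \<in> Poly_Mapping.keys m. Poly_Mapping.lookup m v)"

definition homogeneous :: "'v mpoly \<Rightarrow> bool" where
  "homogeneous P \<longleftrightarrow> (\<exists>d. \<forall>m \<in> Poly_Mapping.keys P. monomial_degree m = d)"

definition is_homogeneous_polynomial :: "('v monomial \<Rightarrow> rat) \<Rightarrow> bool" where
  "is_homogeneous_polynomial F \<longleftrightarrow> (\<exists>P. homogeneous P \<and> F = Poly_Mapping.lookup P)"

end

theory Submission
  imports Defs
begin

text \<open>
  Both parts say that only finitely many highway walks lie in a given homology class and that all of
  them have the same number of highway passages. Both facts come from one
  description of what it means that two walks are homologous.

  Let \<open>a(e)\<close> be the difference of the numbers of times that two homologous walks use the edge \<open>e\<close>. Then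
  \<open>\<Sum> a(e) e\<close> is the boundary of a singular 2-chain \<open>B\<close>. Off the network \<open>B\<close> has a local degree, which is
  constant on each face, and crossing an edge \<open>e\<close> from its right side to its left side changes it by
  \<open>a(e)\<close>. So there are integers \<open>l(e)\<close> and \<open>r(e)\<close> on the two sides of \<open>e\<close> with
  \<open>a(e) = l(e) - r(e)\<close>. At a crossing with incoming edges \<open>e1, e2\<close> and outgoing edges
  \<open>f1, f2\<close> four faces meet, which gives
  \<open>r(e1) = l(e2)\<close>, \<open>r(e2) = r(f1)\<close>, \<open>l(f1) = r(f2)\<close>, \<open>l(f2) = l(e1)\<close>.
  On an edge that ends at the boundary of the surface, \<open>l = r = 0\<close> (\<open>edge_sides\<close>).

  Homogeneity (\<open>homologous_flows_crossings\<close>): since a highway walk never runs along \<open>e2, f2\<close>, the numbers of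
  highway passages of the two walks at a vertex differ by \<open>a(e1) - a(f2) = r(f2) - r(e1)\<close>. As
  \<open>r(e2) = r(f1)\<close>, this is the sum of \<open>r\<close> over the outgoing edges minus the sum over the incoming edges.
  Summed over all vertices the result is \<open>0\<close>.

  Finiteness (\<open>finite_homologous_highway_paths\<close>, \<open>finite_homologous_highway_closed_walks\<close>): among infinitely many
  walks in one class there are, by Dickson's lemma, two such that the second contains every passage of the
  first, with multiplicity, and some further ones. As the numbers of highway passages agree, the
  further passages are turns, so that \<open>a\<close> is unchanged at turns and nonnegative. Then \<open>l\<close> and \<open>r\<close> never increase along the second walk
  (\<open>sides_decrease\<close>). A path between boundary vertices begins and ends with \<open>l = r = 0\<close>, so
  \<open>a = 0\<close> along it, a contradiction. Along a closed walk \<open>l\<close> and \<open>r\<close> must be constant, and again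
  \<open>a = 0\<close> if the walk has a highway passage. If it has none, then a positive multiple of its class is zero, and
  the class is zero because the first homology group of an oriented surface is torsion-free
  (\<open>H1_torsion_free\<close>).

  The topological input is obtained from winding numbers. In the plane, a 1-cycle in an open set that winds around no
  point outside bounds in the set (\<open>cycle_with_zero_winding_is_boundary\<close>). In the charts of an oriented surface
  winding numbers define the local degree of a 2-chain. Edges may be wild arcs without a product neighbourhood, so their
  sides are found from the local degree: a short piece of the edge is replaced by a bypass inside a chart
  (\<open>degree_near_edge\<close>).
\<close>

section \<open>Singular chains\<close>

abbreviation chain_in :: "nat \<Rightarrow> 'a topology \<Rightarrow> 'a set \<Rightarrow> 'a chain \<Rightarrow> bool" where
  "chain_in p X T c \<equiv> singular_chain p (subtopology X T) c"

lemma chain_in_imp_chain: "chain_in p X T c \<Longrightarrow> singular_chain p X c"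
  by (simp add: singular_chain_subtopology)

lemma chain_in_Int:
  assumes "chain_in p X T c" "chain_in p X T' c"
  shows "chain_in p X (T \<inter> T') c"
  using assms by (auto simp: singular_chain_subtopology)

text \<open>Small simplices: after subdivision every simplex lies in \<open>U\<close> or in \<open>V\<close>, and the chain
  homotopy between a chain and its subdivision maps chains of a subspace to chains of that
  subspace. Hence the correction term coming from the boundary can be absorbed in the two
  summands as soon as the boundary itself splits.\<close>

lemma chain_split:
  assumes U: "openin X U" and V: "openin X V" and c: "chain_in p X (U \<union> V) c"
    and bd: "chain_boundary p c = u1 + u2"
    and u1: "chain_in (p - 1) X U u1" and u2: "chain_in (p - 1) X V u2"
    and p: "p > 0"
  obtains c1 c2 d where "chain_in p X U c1" "chain_in p X V c2" "chain_in (Suc p) X (U \<union> V) d"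
    "c = c1 + c2 + chain_boundary (Suc p) d"
proof -
  let ?Y = "subtopology X (U \<union> V)"
  have top: "topspace ?Y = U \<union> V"
    using U V openin_subset by fastforce
  obtain n where n: "\<And>m f. \<lbrakk>n \<le> m; f \<in> Poly_Mapping.keys ((singular_subdivision p ^^ m) c)\<rbrakk>
      \<Longrightarrow> \<exists>W \<in> {U, V}. f \<in> standard_simplex p \<rightarrow> W"
  proof (rule sufficient_iterated_singular_subdivision_exists[of "{U, V}" ?Y p c])
    show "openin ?Y W" if "W \<in> {U, V}" for W
      using that U V by (auto simp: openin_subtopology_Int2 intro: openin_subset_topspace_eq
          openin_open_subtopology[THEN iffD2])
  qed (use top c in auto)
  obtain h where h: "\<And>p. h p 0 = (0 :: 'a chain)"
        "\<And>p c1 c2. h p (c1-c2) = h p c1 - h p c2"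
        "\<And>p X c. singular_chain p X c \<Longrightarrow> singular_chain (Suc p) X (h p c)"
        "\<And>p X c. singular_chain p X c
                 \<Longrightarrow> chain_boundary (Suc p) (h p c) + h (p - Suc 0) (chain_boundary p c)
                     = (singular_subdivision p ^^ n) c - c"
    by (rule chain_homotopic_iterated_singular_subdivision[of n]) blast
  let ?s = "(singular_subdivision p ^^ n) c"
  have scs: "singular_chain p ?Y ((singular_subdivision p ^^ m) c)" for m
    by (induction m) (auto simp: c singular_chain_singular_subdivision)
  have "Poly_Mapping.keys ?s \<subseteq> singular_simplex_set p (subtopology X U)
      \<union> singular_simplex_set p (subtopology X V)"
  proof
    fix f assume f: "f \<in> Poly_Mapping.keys ?s"
    then have "singular_simplex p ?Y f"
      using scs[of n] by (auto simp: singular_chain_def)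
    moreover have "\<exists>W \<in> {U, V}. f \<in> standard_simplex p \<rightarrow> W"
      using n[OF order_refl f] .
    ultimately show "f \<in> singular_simplex_set p (subtopology X U)
      \<union> singular_simplex_set p (subtopology X V)"
      by (auto simp: singular_simplex_subtopology)
  qed
  then obtain s1 s2 where s: "Poly_Mapping.keys s1 \<subseteq> singular_simplex_set p (subtopology X U)"
      "Poly_Mapping.keys s2 \<subseteq> singular_simplex_set p (subtopology X V)" "s1 + s2 = ?s"
    by (rule frag_split)
  have h_minus: "h q (- a) = - h q a" for q a
    using h(2)[of q 0 a] h(1) by simp
  have h_add: "h q (a + b) = h q a + h q b" for q a b
    using h(2)[of q a "- b"] by (simp add: h_minus)
  have "c = (s1 - h (p - 1) u1) + (s2 - h (p - 1) u2) + chain_boundary (Suc p) (- h p c)"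
    using h(4)[OF c] s(3) by (simp add: bd h_add chain_boundary_minus algebra_simps)
  moreover have "chain_in p X U (h (p - 1) u1)" "chain_in p X V (h (p - 1) u2)"
    using h(3)[OF u1] h(3)[OF u2] p by simp_all
  moreover have "chain_in (Suc p) X (U \<union> V) (- h p c)"
    using h(3)[OF c] by (simp add: singular_chain_minus)
  moreover have "chain_in p X U s1" "chain_in p X V s2"
    using s by (simp_all add: singular_chain_def)
  ultimately show thesis
    by (intro that[of "s1 - h (p - 1) u1" "s2 - h (p - 1) u2"]) (auto intro: singular_chain_diff)
qed

lemma contractible_cycle_is_boundary:
  assumes X: "contractible_space X" and p: "p > 0" and c: "singular_chain p X c" "chain_boundary p c = 0"
  obtains d where "singular_chain (Suc p) X d" "chain_boundary (Suc p) d = c"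
proof (cases "topspace X = {}")
  case True
  then have "c = 0" using c(1) singular_chain_empty by blast
  then show ?thesis using that[of 0] by simp
next
  case False
  then obtain a where a: "homotopic_with (\<lambda>x. True) X X id (\<lambda>x. a)"
    using X by (auto simp: contractible_space_def)
  then have cont: "continuous_map X X (\<lambda>x. a)"
    using homotopic_with_imp_continuous_maps by blast
  then have aX: "a \<in> topspace X" using False by (simp add: continuous_map_def)
  have rel: "singular_relcycle p X {} c" using c by (simp add: singular_cycle)
  have "homotopic_with (\<lambda>h. h \<in> {} \<rightarrow> {}) X X id (\<lambda>x. a)" using a by simp
  then have "homologous_rel p X {} (chain_map p id c) (chain_map p (\<lambda>x. a) c)"
    by (rule homotopic_imp_homologous_rel_chain_maps[OF _ rel])
  then have 1: "singular_relboundary p X {} (c - chain_map p (\<lambda>x. a) c)"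
    using chain_map_id_gen[OF c(1), of id] by (simp add: homologous_rel_def)
  let ?A = "subtopology X {a}"
  have "singular_relcycle p ?A {} (chain_map p (\<lambda>x. a) c)"
    by (rule singular_relcycle_chain_map[OF rel]) (use aX in \<open>auto simp: continuous_map_in_subtopology\<close>)
  then have "singular_relboundary p ?A {} (chain_map p (\<lambda>x. a) c)"
    using singular_boundary_eq_cycle_singleton[of ?A a p] aX p by (simp add: topspace_subtopology Int_commute)
  then have "singular_relboundary p X {} (chain_map p (\<lambda>x. a) c)"
    by (auto simp: singular_boundary intro: chain_in_imp_chain)
  from singular_relboundary_add[OF 1 this] show ?thesis
    using that by (auto simp: singular_boundary)
qed

lemma convex_cycle_is_boundary:
  fixes C :: "'b::real_normed_vector set"
  assumes "convex C" "p > 0" "chain_in p euclidean C c" "chain_boundary p c = 0"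
  obtains d where "chain_in (Suc p) euclidean C d" "chain_boundary (Suc p) d = c"
  using contractible_cycle_is_boundary[of "top_of_set C" p c] assms
  by (auto simp: contractible_space_top_of_set convex_imp_contractible)

lemma singular_relboundary_sum:
  assumes "\<And>i. i \<in> I \<Longrightarrow> singular_relboundary p X T (f i)"
  shows "singular_relboundary p X T (sum f I)"
  using assms by (induction I rule: infinite_finite_induct) (auto simp: singular_relboundary_add)

lemma singular_relboundary_extend:
  assumes "\<And>i. i \<in> Poly_Mapping.keys c \<Longrightarrow> singular_relboundary p X T (f i)"
  shows "singular_relboundary p X T (frag_extend f c)"
  unfolding frag_extend_def by (intro singular_relboundary_sum singular_relboundary_cmul assms)

subsection \<open>Supports\<close>

definition support :: "nat \<Rightarrow> 'a chain \<Rightarrow> 'a set" where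
  "support p c = (\<Union>f \<in> Poly_Mapping.keys c. f ` standard_simplex p)"

lemma chain_in_iff_support: "chain_in p X T c \<longleftrightarrow> singular_chain p X c \<and> support p c \<subseteq> T"
  by (auto simp: singular_chain_subtopology support_def)

lemma compactin_support:
  assumes "singular_chain p X c" shows "compactin X (support p c)"
  unfolding support_def
proof (rule compactin_Union, simp, clarify)
  fix f assume "f \<in> Poly_Mapping.keys c"
  then have "continuous_map (subtopology (powertop_real UNIV) (standard_simplex p)) X f"
    using assms by (auto simp: singular_chain_def singular_simplex_def)
  moreover have "compactin (subtopology (powertop_real UNIV) (standard_simplex p)) (standard_simplex p)"
    by (simp add: compactin_subtopology compactin_standard_simplex)
  ultimately show "compactin X (f ` standard_simplex p)"
    using image_compactin by blast
qed

lemma closedin_support: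
  assumes "singular_chain p X c" "Hausdorff_space X" shows "closedin X (support p c)"
  using assms compactin_imp_closedin compactin_support by blast

lemma compact_support:
  fixes c :: "'b::t2_space chain"
  assumes "singular_chain p euclidean c" shows "compact (support p c)"
  using compactin_support[OF assms] by simp

subsection \<open>Linear functionals on chains\<close>

definition frag_eval :: "('b \<Rightarrow> 'r::comm_ring_1) \<Rightarrow> ('b \<Rightarrow>\<^sub>0 int) \<Rightarrow> 'r" where
  "frag_eval w c = (\<Sum>f \<in> Poly_Mapping.keys c. of_int (Poly_Mapping.lookup c f) * w f)"

lemma frag_eval_superset:
  assumes "finite K" "Poly_Mapping.keys c \<subseteq> K"
  shows "frag_eval w c = (\<Sum>f \<in> K. of_int (Poly_Mapping.lookup c f) * w f)"
  unfolding frag_eval_def by (rule sum.mono_neutral_left) (use assms in \<open>auto simp: in_keys_iff\<close>)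

lemma frag_eval_add: "frag_eval w (a + b) = frag_eval w a + frag_eval w b"
proof -
  let ?K = "Poly_Mapping.keys a \<union> Poly_Mapping.keys b"
  have K: "finite ?K" by simp
  have "frag_eval w (a + b) = (\<Sum>f\<in>?K. of_int (Poly_Mapping.lookup (a + b) f) * w f)"
    by (rule frag_eval_superset[OF K keys_add])
  also have "\<dots> = (\<Sum>f\<in>?K. of_int (Poly_Mapping.lookup a f) * w f) + (\<Sum>f\<in>?K. of_int (Poly_Mapping.lookup b f) * w f)"
    by (simp only: lookup_add of_int_add distrib_right sum.distrib)
  also have "\<dots> = frag_eval w a + frag_eval w b"
    by (simp only: frag_eval_superset[OF K Un_upper1] frag_eval_superset[OF K Un_upper2])
  finally show ?thesis .
qed

lemma frag_eval_0 [simp]: "frag_eval w 0 = 0"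
  by (simp add: frag_eval_def)

lemma frag_eval_minus: "frag_eval w (- a) = - frag_eval w a"
  using frag_eval_add[of w a "- a"] by (simp add: minus_unique)

lemma frag_eval_diff: "frag_eval w (a - b) = frag_eval w a - frag_eval w b"
  using frag_eval_add[of w a "- b"] by (simp add: frag_eval_minus)

lemma frag_eval_of [simp]: "frag_eval w (frag_of f) = w f"
  by (simp add: frag_eval_def)

lemma frag_eval_sum: "frag_eval w (sum g I) = (\<Sum>i\<in>I. frag_eval w (g i))"
  by (induction I rule: infinite_finite_induct) (simp_all add: frag_eval_add)

lemma frag_eval_cmul: "frag_eval w (frag_cmul k a) = of_int k * frag_eval w a"
  using frag_eval_superset[OF finite_keys keys_cmul, of w k a]
  by (simp add: frag_eval_def sum_distrib_left mult.assoc)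

lemma frag_eval_extend: "frag_eval w (frag_extend g c) = frag_eval (\<lambda>f. frag_eval w (g f)) c"
  unfolding frag_extend_def frag_eval_sum frag_eval_cmul by (simp only: frag_eval_def)

subsection \<open>Paths as one-simplices\<close>

definition path_simplex :: "(real \<Rightarrow> 'a) \<Rightarrow> (nat \<Rightarrow> real) \<Rightarrow> 'a" where
  "path_simplex g = restrict (\<lambda>x. g (x 1)) (standard_simplex 1)"

definition point_simplex :: "'a \<Rightarrow> (nat \<Rightarrow> real) \<Rightarrow> 'a" where
  "point_simplex a = restrict (\<lambda>_. a) (standard_simplex 0)"

text \<open>The standard 1-simplex consists of the points \<open>(1 - t, t, 0, 0, \<dots>)\<close>.\<close>

definition simplex_path :: "((nat \<Rightarrow> real) \<Rightarrow> 'a) \<Rightarrow> real \<Rightarrow> 'a" where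
  "simplex_path f t = f (\<lambda>i. if i = 0 then 1 - t else if i = 1 then t else 0)"

lemma standard_simplex_1: "(\<lambda>i. if i = 0 then 1 - t else if i = 1 then t else 0) \<in> standard_simplex 1
    \<longleftrightarrow> 0 \<le> t \<and> t \<le> (1::real)"
  by (auto simp: standard_simplex_def)

lemma standard_simplex_1_eq:
  assumes "x \<in> standard_simplex 1"
  shows "x = (\<lambda>i. if i = 0 then 1 - x 1 else if i = 1 then x 1 else 0)" "x 1 \<in> {0..1}"
proof -
  have "x 0 + x 1 = 1" "\<And>i. i > 1 \<Longrightarrow> x i = 0" "x 1 \<in> {0..1}"
    using assms by (auto simp: standard_simplex_def)
  then show "x 1 \<in> {0..1}" "x = (\<lambda>i. if i = 0 then 1 - x 1 else if i = 1 then x 1 else 0)"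
    by (auto simp: fun_eq_iff algebra_simps)
qed

lemma simplex_path_path_simplex:
  "0 \<le> t \<Longrightarrow> t \<le> 1 \<Longrightarrow> simplex_path (path_simplex g) t = g t"
  by (simp add: simplex_path_def path_simplex_def standard_simplex_1[simplified])

lemma path_simplex_simplex_path:
  assumes "singular_simplex 1 X f" shows "path_simplex (simplex_path f) = f"
proof
  fix x show "path_simplex (simplex_path f) x = f x"
  proof (cases "x \<in> standard_simplex 1")
    case True
    then show ?thesis
      by (simp add: path_simplex_def simplex_path_def flip: standard_simplex_1_eq(1)[OF True] del: One_nat_def)
  next
    case False
    then show ?thesis using assms by (auto simp: path_simplex_def singular_simplex_def extensional_def)
  qed
qed

lemma image_path_simplex: "path_simplex g ` standard_simplex 1 = g ` {0..1}"
proof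
  show "path_simplex g ` standard_simplex 1 \<subseteq> g ` {0..1}"
    using standard_simplex_1_eq(2) by (force simp: path_simplex_def)
  show "g ` {0..1} \<subseteq> path_simplex g ` standard_simplex 1"
  proof
    fix y assume "y \<in> g ` {0..1}"
    then obtain t where "0 \<le> t" "t \<le> 1" "y = g t" by auto
    then show "y \<in> path_simplex g ` standard_simplex 1"
      using standard_simplex_1[of t]
      by (intro image_eqI[of _ _ "\<lambda>i. if i = 0 then 1 - t else if i = 1 then t else 0"])
        (auto simp: path_simplex_def)
  qed
qed

lemma image_simplex_path: "simplex_path f ` {0..1} = f ` standard_simplex 1"
proof
  show "simplex_path f ` {0..1} \<subseteq> f ` standard_simplex 1"
    using standard_simplex_1 by (fastforce simp: simplex_path_def)
  show "f ` standard_simplex 1 \<subseteq> simplex_path f ` {0..1}"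
  proof
    fix y assume "y \<in> f ` standard_simplex 1"
    then obtain x where x: "x \<in> standard_simplex 1" "y = f x" by auto
    then have "y = simplex_path f (x 1)"
      by (simp add: simplex_path_def x(2) flip: standard_simplex_1_eq(1)[OF x(1)] del: One_nat_def)
    then show "y \<in> simplex_path f ` {0..1}" using standard_simplex_1_eq(2)[OF x(1)] by blast
  qed
qed

lemma continuous_map_simplex_coordinate:
  "continuous_map (subtopology (powertop_real UNIV) (standard_simplex p)) euclideanreal (\<lambda>x. x i)"
  by (intro continuous_map_from_subtopology continuous_map_product_projection) simp

lemma singular_simplex_path_simplex:
  assumes "pathin X g" shows "singular_simplex 1 X (path_simplex g)"
proof -
  have "continuous_map (subtopology (powertop_real UNIV) (standard_simplex 1))
          (subtopology euclideanreal {0..1}) (\<lambda>x. x 1)"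
    using continuous_map_simplex_coordinate standard_simplex_1_eq(2)
    by (auto simp: continuous_map_in_subtopology)
  from continuous_map_compose[OF this assms[unfolded pathin_def]]
  show ?thesis unfolding singular_simplex_def path_simplex_def
    by (auto simp: o_def elim!: continuous_map_eq)
qed

lemma pathin_simplex_path:
  assumes "singular_simplex 1 X f" shows "pathin X (simplex_path f)"
proof -
  have "continuous_map (subtopology euclideanreal {0..1})
     (subtopology (powertop_real UNIV) (standard_simplex 1))
     (\<lambda>t i. if i = 0 then 1 - t else if i = 1 then t else 0)"
    unfolding continuous_map_in_subtopology continuous_map_componentwise
  proof (intro conjI ballI allI)
    show "continuous_map (top_of_set {0..1}) euclideanreal
        (\<lambda>t. if k = 0 then 1 - t else if k = 1 then t else 0)" for k :: nat
      by (cases "k = 0"; cases "k = 1") (auto intro!: continuous_intros)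
  qed (use standard_simplex_1 in \<open>auto simp: Pi_iff\<close>)
  from continuous_map_compose[OF this, of X f] assms show ?thesis
    by (simp add: pathin_def singular_simplex_def o_def simplex_path_def[abs_def])
qed

lemma boundary_path_simplex:
  "chain_boundary 1 (frag_of (path_simplex g)) =
     frag_of (point_simplex (g 1)) - frag_of (point_simplex (g 0))"
proof -
  have a: "singular_face 1 0 (path_simplex g) = point_simplex (g 1)"
    using simplical_face_in_standard_simplex[of 1 0]
    by (fastforce simp: singular_face_def path_simplex_def point_simplex_def simplical_face_def
        fun_eq_iff standard_simplex_0)
  have b: "singular_face 1 1 (path_simplex g) = point_simplex (g 0)"
    using simplical_face_in_standard_simplex[of 1 1]
    by (fastforce simp: singular_face_def path_simplex_def point_simplex_def simplical_face_def
        fun_eq_iff standard_simplex_0)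
  show ?thesis using a b by (simp add: chain_boundary_of frag_cmul_minus_one)
qed

definition subarc_simplex :: "(real \<Rightarrow> 'a) \<Rightarrow> real \<Rightarrow> real \<Rightarrow> (nat \<Rightarrow> real) \<Rightarrow> 'a" where
  "subarc_simplex g a b = path_simplex (\<lambda>t. g (a + (b - a) * t))"

lemma singular_simplex_0_eq_point:
  assumes "singular_simplex 0 X f"
  shows "f = point_simplex (f (\<lambda>j. if j = 0 then 1 else 0))" "f (\<lambda>j. if j = 0 then 1 else 0) \<in> topspace X"
proof -
  let ?e = "\<lambda>j. if j = 0 then 1 else 0 :: real"
  show "f ?e \<in> topspace X"
    using assms by (auto simp: singular_simplex_def standard_simplex_0 continuous_map_def Pi_iff)
  show "f = point_simplex (f ?e)"
  proof
    fix x show "f x = point_simplex (f ?e) x"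
      using assms by (cases "x = ?e")
        (auto simp: point_simplex_def singular_simplex_def standard_simplex_0 extensional_def)
  qed
qed

lemma point_simplex_inject [simp]: "point_simplex a = point_simplex b \<longleftrightarrow> a = b"
proof -
  have "point_simplex a (\<lambda>j. if j = 0 then 1 else 0) = a" for a :: 'a
    by (simp add: point_simplex_def standard_simplex_0)
  then show ?thesis by metis
qed

text \<open>Degenerate triangles inside the image of a path show that the path is homologous, within its
  image, to the sum of its parts.\<close>

lemma subarc_simplex_split:
  assumes g: "pathin X g" and abc: "a \<in> {0..1}" "b \<in> {0..1}" "c \<in> {0..1}"
  obtains t where "chain_in 2 X (g ` {0..1}) t"
    "chain_boundary 2 t = frag_of (subarc_simplex g a b) + frag_of (subarc_simplex g b c)
       - frag_of (subarc_simplex g a c)"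
proof -
  define s where "s = restrict (\<lambda>x. g (a * x 0 + b * x 1 + c * x 2)) (standard_simplex 2)"
  have in01: "a * x 0 + b * x 1 + c * x 2 \<in> {0..1}" if "x \<in> standard_simplex 2" for x
  proof -
    have x: "x 0 \<ge> 0" "x 1 \<ge> 0" "x 2 \<ge> 0" "x 0 + x 1 + x 2 = 1"
      using that by (auto simp: standard_simplex_def numeral_2_eq_2)
    have "a * x 0 + b * x 1 + c * x 2 \<le> 1 * x 0 + 1 * x 1 + 1 * x 2"
      using abc x by (intro add_mono mult_right_mono) auto
    then show ?thesis using x abc by auto
  qed
  have cont: "continuous_map (subtopology (powertop_real UNIV) (standard_simplex 2))
          (subtopology euclideanreal {0..1}) (\<lambda>x. a * x 0 + b * x 1 + c * x 2)"
    unfolding continuous_map_in_subtopology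
    using in01 by (auto intro!: continuous_intros continuous_map_simplex_coordinate)
  from continuous_map_compose[OF this g[unfolded pathin_def]]
  have "singular_simplex 2 X s" unfolding singular_simplex_def s_def
    by (auto simp: o_def elim!: continuous_map_eq)
  moreover have "s ` standard_simplex 2 \<subseteq> g ` {0..1}" using in01 by (auto simp: s_def)
  ultimately have s: "singular_simplex 2 (subtopology X (g ` {0..1})) s"
    by (simp add: singular_simplex_subtopology)
  have face: "simplical_face k x \<in> standard_simplex 2" if "k \<le> 2" "x \<in> standard_simplex (2 - Suc 0)" for k and x :: "nat \<Rightarrow> real"
    using simplical_face_in_standard_simplex[of 2 k x] that by simp
  have x0: "x 0 = 1 - x 1" if "x \<in> standard_simplex 1" for x
    using that by (auto simp: standard_simplex_def)
  have f0: "singular_face 2 0 s = subarc_simplex g b c"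
    unfolding singular_face_def subarc_simplex_def path_simplex_def
    by (rule ext) (auto simp: restrict_def s_def face[simplified] face, auto simp: simplical_face_def x0 algebra_simps)
  have f1: "singular_face 2 1 s = subarc_simplex g a c"
    unfolding singular_face_def subarc_simplex_def path_simplex_def
    by (rule ext) (auto simp: restrict_def s_def face[simplified] face, auto simp: simplical_face_def x0 algebra_simps)
  have f2: "singular_face 2 2 s = subarc_simplex g a b"
    unfolding singular_face_def subarc_simplex_def path_simplex_def
    by (rule ext) (auto simp: restrict_def s_def face[simplified] face, auto simp: simplical_face_def x0 algebra_simps)
  have "{..2::nat} = {0, 1, 2}" by auto
  then have "chain_boundary 2 (frag_of s) = frag_of (subarc_simplex g a b) + frag_of (subarc_simplex g b c)
       - frag_of (subarc_simplex g a c)"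
    using f0 f1 f2 by (simp add: chain_boundary_of frag_cmul_minus_one)
  then show thesis using that[of "frag_of s"] s by (simp add: singular_chain_of)
qed

section \<open>Winding numbers of one-chains in the plane\<close>

definition winding :: "complex chain \<Rightarrow> complex \<Rightarrow> complex" where
  "winding c w = frag_eval (\<lambda>f. winding_number (simplex_path f) w) c"

lemma winding_simps [simp]: "winding 0 w = 0"
  and winding_add: "winding (a + b) w = winding a w + winding b w"
  and winding_diff: "winding (a - b) w = winding a w - winding b w"
  and winding_minus: "winding (- a) w = - winding a w"
  and winding_cmul: "winding (frag_cmul k a) w = of_int k * winding a w"
  by (simp_all add: winding_def frag_eval_add frag_eval_diff frag_eval_minus frag_eval_cmul)

lemma path_simplex_path:
  assumes "chain_in 1 euclidean T c" "f \<in> Poly_Mapping.keys c"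
  shows "path (simplex_path f)" "path_image (simplex_path f) \<subseteq> T"
proof -
  have "singular_simplex 1 (top_of_set T) f" using assms by (auto simp: singular_chain_def)
  then have "pathin (top_of_set T) (simplex_path f)" by (rule pathin_simplex_path)
  then show "path (simplex_path f)" "path_image (simplex_path f) \<subseteq> T"
    by (auto simp: pathin_canon_iff path_image_def)
qed

lemma winding_path_simplex [simp]: "winding (frag_of (path_simplex g)) w = winding_number g w"
  unfolding winding_def frag_eval_of by (rule winding_number_cong) (simp add: simplex_path_path_simplex)

text \<open>A singular triangle that avoids \<open>w\<close> is the image of a convex set, so the loop formed by its three
  sides contracts in the complement of \<open>w\<close>.\<close>

lemma winding_boundary:
  assumes "chain_in 2 euclidean (- {w}) b"
  shows "winding (chain_boundary 2 b) w = 0"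
proof -
  let ?S = "singular_simplex_set 2 (top_of_set (- {w}))"
  have "Poly_Mapping.keys b \<subseteq> ?S" using assms by (simp add: singular_chain_def)
  then show ?thesis
  proof (induction rule: frag_induction)
    case (one s)
    define v :: "complex \<Rightarrow> nat \<Rightarrow> real" where
      "v z = (\<lambda>i. if i = 0 then 1 - Re z - Im z else if i = 1 then Re z else if i = 2 then Im z else 0)" for z
    define T where "T = {z. 0 \<le> Re z} \<inter> {z. 0 \<le> Im z} \<inter> {z::complex. Re z + Im z \<le> 1}"
    have T: "convex T" unfolding T_def
      using convex_halfspace_Re_ge[of 0] convex_halfspace_Im_ge[of 0]
        convex_halfspace_le[of "1 + \<i>" 1]
      by (intro convex_Int) (simp_all add: inner_complex_def)
    have vT: "v z \<in> standard_simplex 2" if "z \<in> T" for z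
      using that by (auto simp: v_def T_def standard_simplex_def numeral_2_eq_2)
    have s: "singular_simplex 2 (top_of_set (- {w})) s" using one by simp
    have "continuous_map (top_of_set T) (subtopology (powertop_real UNIV) (standard_simplex 2)) v"
      unfolding continuous_map_in_subtopology continuous_map_componentwise
    proof (intro conjI ballI)
      show "continuous_map (top_of_set T) euclideanreal (\<lambda>z. v z k)" for k
        by (cases "k = 0"; cases "k = 1"; cases "k = 2") (auto simp: v_def intro!: continuous_intros)
    qed (use vT in auto)
    from continuous_map_compose[OF this, of "top_of_set (- {w})" s] s
    have "continuous_map (top_of_set T) (top_of_set (- {w})) (s \<circ> v)"
      by (simp add: singular_simplex_def)
    then have cont: "continuous_on T (s \<circ> v)" and im: "s \<circ> v \<in> T \<rightarrow> - {w}"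
      by (auto simp: continuous_map_in_subtopology)
    let ?p = "linepath 0 1 +++ linepath 1 \<i>"
    have T_pts: "0 \<in> T" "1 \<in> T" "\<i> \<in> T" by (auto simp: T_def)
    have seg: "closed_segment a b \<subseteq> T" if "a \<in> T" "b \<in> T" for a b
      using that T by (simp add: closed_segment_subset)
    have "homotopic_paths T ?p (linepath 0 \<i>)"
      using convex_imp_simply_connected[OF T] seg T_pts
      unfolding simply_connected_eq_homotopic_paths by (auto simp: path_image_join)
    then have "homotopic_paths (- {w}) ((s \<circ> v) \<circ> ?p) ((s \<circ> v) \<circ> linepath 0 \<i>)"
      using cont im by (rule homotopic_paths_continuous_image)
    then have "winding_number ((s \<circ> v) \<circ> ?p) w = winding_number ((s \<circ> v) \<circ> linepath 0 \<i>) w"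
      by (rule winding_number_homotopic_paths)
    moreover have path: "path ((s \<circ> v) \<circ> linepath a b)" "w \<notin> path_image ((s \<circ> v) \<circ> linepath a b)"
      if "a \<in> T" "b \<in> T" for a b
      using seg[OF that] cont im
      by (auto intro!: path_continuous_image continuous_on_subset[OF cont] simp: path_image_compose)
    ultimately have eq: "winding_number ((s \<circ> v) \<circ> linepath 0 1) w + winding_number ((s \<circ> v) \<circ> linepath 1 \<i>) w
        = winding_number ((s \<circ> v) \<circ> linepath 0 \<i>) w"
      using path[OF T_pts(1,2)] path[OF T_pts(2,3)]
      by (subst (asm) path_compose_join, subst (asm) winding_number_join)
         (auto simp: pathfinish_compose pathstart_compose)
    have face: "winding_number (simplex_path (singular_face 2 k s)) w = winding_number ((s \<circ> v) \<circ> linepath a b) w"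
      if "(k, a, b) \<in> {(0, 1, \<i>), (1, 0, \<i>), (2, 0, 1)}" for k a b
    proof (rule winding_number_cong)
      fix t :: real assume t: "0 \<le> t" "t \<le> 1"
      let ?u = "\<lambda>i::nat. if i = 0 then 1 - t else if i = 1 then t else 0"
      have "?u \<in> standard_simplex (2 - Suc 0)" using standard_simplex_1[of t] t by simp
      then have "simplex_path (singular_face 2 k s) t = s (simplical_face k ?u)"
        by (simp add: simplex_path_def singular_face_def del: One_nat_def)
      also have "simplical_face k ?u = v (linepath a b t)"
      proof
        fix i :: nat
        consider "i = 0" | "i = 1" | "i = 2" | "i > 2" by linarith
        then show "simplical_face k ?u i = v (linepath a b t) i"
          using that by cases (auto simp: v_def linepath_def simplical_face_def)
      qed
      finally show "simplex_path (singular_face 2 k s) t = ((s \<circ> v) \<circ> linepath a b) t" by simp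
    qed
    have "{..2::nat} = {0, 1, 2}" by auto
    then have b: "chain_boundary 2 (frag_of s) = frag_of (singular_face 2 0 s) - frag_of (singular_face 2 1 s)
       + frag_of (singular_face 2 2 s)"
      by (simp add: chain_boundary_of frag_cmul_minus_one)
    show ?case unfolding b winding_add winding_diff
      unfolding winding_def frag_eval_of face[of 0 1 \<i>, simplified] face[of 1 0 \<i>, simplified] face[of 2 0 1, simplified]
        face[of 1 0 \<i>, simplified One_nat_def, simplified] One_nat_def eq[symmetric] by simp
  qed (simp_all add: chain_boundary_diff winding_diff)
qed

lemma winding_continuous_on:
  assumes "chain_in 1 euclidean (- Q) c" shows "continuous_on Q (winding c)"
proof -
  have "continuous_on Q (\<lambda>w. winding_number (simplex_path f) w)" if "f \<in> Poly_Mapping.keys c" for f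
    using path_simplex_path[OF assms that]
    by (intro continuous_at_imp_continuous_on ballI continuous_at_winding_number) auto
  then show ?thesis unfolding winding_def frag_eval_def by (intro continuous_intros) auto
qed

text \<open>Along a path, \<open>2\<pi>\<i>\<close> times the winding number is the increment of a branch of the
  logarithm, and for a cycle the principal values at the end points cancel.\<close>

lemma winding_Ints:
  assumes c: "chain_in 1 euclidean (- {w}) c" and cyc: "chain_boundary 1 c = 0"
  shows "winding c w \<in> \<int>"
proof -
  define L :: "((nat \<Rightarrow> real) \<Rightarrow> complex) \<Rightarrow> complex" where
    "L f = Ln (f (\<lambda>j. if j = 0 then 1 else 0) - w) / (2 * pi * \<i>)" for f
  have Lpt: "L (point_simplex a) = Ln (a - w) / (2 * pi * \<i>)" for a
    by (simp add: L_def point_simplex_def standard_simplex_0)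
  have "winding c w - frag_eval L (chain_boundary 1 c) \<in> \<int>"
    using c[unfolded singular_chain_def]
  proof (induction rule: frag_induction)
    case (one s)
    define g where "g = simplex_path s"
    have "chain_in 1 euclidean (- {w}) (frag_of s)" using one by (simp add: singular_chain_of)
    then have g: "path g" "w \<notin> path_image g" using path_simplex_path[of "- {w}" "frag_of s" s] by (auto simp: g_def)
    have s: "s = path_simplex g" using one path_simplex_simplex_path[of "top_of_set (- {w})" s] by (simp add: g_def)
    have ne: "g 0 \<noteq> w" "g 1 \<noteq> w" using g(2) by (auto simp: path_image_def)
    let ?n = "winding_number g w"
    have "exp (2 * pi * \<i> * ?n) * (g 0 - w) = g 1 - w"
      using winding_number_exp_2pi[OF g] by (simp add: pathfinish_def pathstart_def)
    then have "exp (2 * pi * \<i> * ?n - Ln (g 1 - w) + Ln (g 0 - w)) = 1"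
      using ne by (simp add: exp_add exp_diff)
    then obtain n :: int where n: "2 * pi * \<i> * ?n - Ln (g 1 - w) + Ln (g 0 - w) = of_int (2 * n) * pi * \<i>"
      using complex_eq_iff by (force dest!: exp_eq_1[THEN iffD1])
    have "?n - (Ln (g 1 - w) / (2 * pi * \<i>) - Ln (g 0 - w) / (2 * pi * \<i>))
        = (2 * pi * \<i> * ?n - Ln (g 1 - w) + Ln (g 0 - w)) / (2 * pi * \<i>)"
      by (simp add: field_simps)
    also have "\<dots> = of_int n" unfolding n by simp
    finally have "winding (frag_of s) w - frag_eval L (chain_boundary 1 (frag_of s)) = of_int n"
      unfolding s boundary_path_simplex by (simp add: frag_eval_diff Lpt)
    then show ?case by simp
  next
    case (diff a b)
    then show ?case
      using Ints_diff by (fastforce simp: chain_boundary_diff winding_diff frag_eval_diff algebra_simps)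
  qed simp
  then show ?thesis unfolding cyc by simp
qed

lemma winding_constant:
  assumes c: "chain_in 1 euclidean (- Q) c" and cyc: "chain_boundary 1 c = 0" and Q: "connected Q"
    and xy: "x \<in> Q" "y \<in> Q"
  shows "winding c x = winding c y"
proof -
  have "winding c constant_on Q"
  proof (rule continuous_discrete_range_constant[OF Q winding_continuous_on[OF c]])
    have Ints: "winding c x \<in> \<int>" if "x \<in> Q" for x
      using that by (intro winding_Ints[OF _ cyc] singular_chain_mono[OF c]) auto
    have "1 \<le> norm (winding c y - winding c x)" if "x \<in> Q" "y \<in> Q" "winding c y \<noteq> winding c x" for x y
    proof -
      have "winding c y - winding c x \<in> \<int>" using Ints that by (intro Ints_diff) auto
      then obtain n where n: "winding c y - winding c x = of_int n" by (auto elim: Ints_cases)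
      have "n \<noteq> 0" using n that by auto
      then show ?thesis unfolding n norm_of_int by linarith
    qed
    then show "\<exists>e>0. \<forall>y. y \<in> Q \<and> winding c y \<noteq> winding c x \<longrightarrow> e \<le> norm (winding c y - winding c x)"
      if "x \<in> Q" for x
      using that by (intro exI[of _ 1]) auto
  qed
  then show ?thesis using xy by (auto simp: constant_on_def)
qed

lemma winding_outside_convex:
  assumes "convex C" "chain_in 1 euclidean C c" "chain_boundary 1 c = 0" "w \<notin> C"
  shows "winding c w = 0"
proof -
  obtain d where "chain_in 2 euclidean C d" "chain_boundary 2 d = c"
    using convex_cycle_is_boundary[of C 1 c] assms by (auto simp: numeral_2_eq_2)
  then show ?thesis using winding_boundary[of w d] singular_chain_mono[of 2 euclidean C d "- {w}"] assms(4)
    by auto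
qed

subsection \<open>Cycles with vanishing winding numbers\<close>

text \<open>The homology form of Cauchy's theorem: a cycle in an open set \<open>O\<close> whose winding numbers
  about all points outside \<open>O\<close> vanish is a boundary in \<open>O\<close>. The cycle is first deformed into a
  fine square grid. A cycle on the grid is a combination of boundaries of grid squares, and the
  coefficient of a square is the winding number about its interior points; so only squares
  contained in \<open>O\<close> occur.\<close>

definition steps :: "(int \<Rightarrow> 'b::ab_group_add) \<Rightarrow> int \<Rightarrow> 'b" where
  "steps f i = (if i \<le> 0 then \<Sum>k\<in>{i..<0}. f k else - (\<Sum>k\<in>{0..<i}. f k))"

lemma steps_eq: "steps f i = f i + steps f (i + 1)"
proof -
  have a: "{i..<0} = insert i {i + 1..<0}" if "i < 0" using that by auto
  have b: "{0..<i + 1} = insert i {0..<i}" if "i \<ge> 0" using that by auto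
  have c: "{0..<1::int} = {0}" by auto
  show ?thesis by (cases "i < 0"; cases "i = 0") (auto simp: steps_def a b c)
qed

lemma steps_unique:
  assumes "\<And>i. g i = f i + g (i + 1)" shows "steps f i = g i - g 0"
proof (induction i rule: int_induct[where k = 0])
  case base then show ?case by (simp add: steps_def)
next
  case (step1 i) then show ?case using assms[of i] steps_eq[of f i] by (simp add: algebra_simps)
next
  case (step2 i) then show ?case using assms[of "i - 1"] steps_eq[of f "i - 1"] by (simp add: algebra_simps)
qed

lemma steps_diff: "i \<le> j \<Longrightarrow> steps f i - steps f j = (\<Sum>k\<in>{i..<j}. f k)"
proof (induction j rule: int_ge_induct)
  case (step j)
  then have "{i..<j + 1} = insert j {i..<j}" by auto
  then show ?case using step steps_eq[of f j] by (simp add: algebra_simps)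
qed simp

lemma chain_boundary_steps: "chain_boundary p (steps f i) = steps (\<lambda>k. chain_boundary p (f k)) i"
  by (simp add: steps_def chain_boundary_sum chain_boundary_minus o_def)

context fixes h :: real
begin

definition gpoint :: "int \<Rightarrow> int \<Rightarrow> complex" where "gpoint i j = Complex (h * i) (h * j)"

definition hedge :: "int \<Rightarrow> int \<Rightarrow> complex chain" where
  "hedge i j = frag_of (path_simplex (linepath (gpoint i j) (gpoint (i + 1) j)))"

definition vedge :: "int \<Rightarrow> int \<Rightarrow> complex chain" where
  "vedge i j = frag_of (path_simplex (linepath (gpoint i j) (gpoint i (j + 1))))"

definition square :: "int \<times> int \<Rightarrow> complex chain" where
  "square = (\<lambda>(i, j). hedge i j + vedge (i + 1) j - hedge i (j + 1) - vedge i j)"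

definition comb :: "int \<Rightarrow> int \<Rightarrow> complex chain" where
  "comb i j = steps (\<lambda>k. hedge k j) i + steps (vedge 0) j"

definition lpath :: "int \<Rightarrow> int \<Rightarrow> int \<Rightarrow> int \<Rightarrow> complex chain" where
  "lpath i j i' j' = steps (\<lambda>k. hedge k j) i - steps (\<lambda>k. hedge k j) i' + (steps (vedge i') j - steps (vedge i') j')"

lemma boundary_hedge: "chain_boundary 1 (hedge i j) = frag_of (point_simplex (gpoint (i + 1) j)) - frag_of (point_simplex (gpoint i j))"
  unfolding hedge_def boundary_path_simplex by (simp add: linepath_def)

lemma boundary_vedge: "chain_boundary 1 (vedge i j) = frag_of (point_simplex (gpoint i (j + 1))) - frag_of (point_simplex (gpoint i j))"
  unfolding vedge_def boundary_path_simplex by (simp add: linepath_def)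

lemma boundary_lpath:
  "chain_boundary 1 (lpath i j i' j') = frag_of (point_simplex (gpoint i' j')) - frag_of (point_simplex (gpoint i j))"
proof -
  let ?p = "\<lambda>i j. - frag_of (point_simplex (gpoint i j))"
  have 1: "chain_boundary 1 (steps (\<lambda>k. hedge k j) i) = ?p i j - ?p 0 j" for i j
    unfolding chain_boundary_steps by (rule steps_unique) (simp only: boundary_hedge, simp)
  have 2: "chain_boundary 1 (steps (vedge i) j) = ?p i j - ?p i 0" for i j
    unfolding chain_boundary_steps by (rule steps_unique) (simp only: boundary_vedge, simp)
  show ?thesis unfolding lpath_def by (simp only: chain_boundary_add chain_boundary_diff 1 2) simp
qed

text \<open>The grid edges that lie in a row or in column 0 form a tree, and modulo squares every
  grid path can be moved into this tree.\<close>

lemma lpath_eq_comb: "\<exists>n. lpath i j i' j' = comb i j - comb i' j' + frag_extend square n"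
proof -
  let ?A = "\<lambda>j. steps (vedge i') j - comb i' j"
  have sq: "steps (\<lambda>k. square (k, l)) i = steps (\<lambda>k. hedge k l) i - steps (\<lambda>k. hedge k (l + 1)) i - vedge i l + vedge 0 l" for i l
  proof -
    have "steps (\<lambda>k. square (k, l)) i = (\<lambda>i. steps (\<lambda>k. hedge k l) i - steps (\<lambda>k. hedge k (l + 1)) i - vedge i l) i
      - (\<lambda>i. steps (\<lambda>k. hedge k l) i - steps (\<lambda>k. hedge k (l + 1)) i - vedge i l) 0"
    proof (rule steps_unique)
      fix i
      show "steps (\<lambda>k. hedge k l) i - steps (\<lambda>k. hedge k (l + 1)) i - vedge i l = square (i, l) +
          (steps (\<lambda>k. hedge k l) (i + 1) - steps (\<lambda>k. hedge k (l + 1)) (i + 1) - vedge (i + 1) l)"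
        using steps_eq[of "\<lambda>k. hedge k l" i] steps_eq[of "\<lambda>k. hedge k (l + 1)" i]
        by (simp add: square_def algebra_simps)
    qed
    then show ?thesis by (simp add: steps_def algebra_simps)
  qed
  have span: "\<exists>n. steps (\<lambda>k. square (k, l)) i = frag_extend square n" for i l
  proof -
    have "frag_extend square (steps (\<lambda>k. frag_of (k, l)) i) = steps (\<lambda>k. square (k, l)) i"
      by (simp add: steps_def frag_extend_sum frag_extend_minus o_def)
    then show ?thesis by metis
  qed
  have A: "?A j - ?A (j + 1) = - steps (\<lambda>k. square (k, j)) i'" for j
    using steps_eq[of "vedge i'" j] steps_eq[of "vedge 0" j] by (simp add: comb_def sq algebra_simps)
  have step: "y - z = (x - z) + m" "x - z = (y - z) - m" if "x - y = - m" for x y z m :: "complex chain"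
    using that by (simp_all add: algebra_simps)
  have "\<exists>n. ?A j - ?A 0 = frag_extend square n" for j
  proof (induction j rule: int_induct[where k = 0])
    case base show ?case by (rule exI[of _ 0]) simp
  next
    case (step1 j)
    then obtain n m where "?A j - ?A 0 = frag_extend square n" "steps (\<lambda>k. square (k, j)) i' = frag_extend square m"
      using span by metis
    then have "?A (j + 1) - ?A 0 = frag_extend square (n + m)"
      using step(1)[OF A[of j], of "?A 0"] by (simp only: frag_extend_add)
    then show ?case by blast
  next
    case (step2 j)
    then obtain n m where "?A j - ?A 0 = frag_extend square n" "steps (\<lambda>k. square (k, j - 1)) i' = frag_extend square m"
      using span by metis
    then have "?A (j - 1) - ?A 0 = frag_extend square (n - m)"
      using step(2)[OF A[of "j - 1"], of "?A 0"] by (simp only: frag_extend_diff diff_add_cancel)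
    then show ?case by blast
  qed
  then obtain n m where n: "?A j - ?A 0 = frag_extend square n" and m: "?A j' - ?A 0 = frag_extend square m" by metis
  have "lpath i j i' j' = comb i j - comb i' j' + ((?A j - ?A 0) - (?A j' - ?A 0))"
    unfolding lpath_def comb_def by (simp add: algebra_simps)
  also have "\<dots> = comb i j - comb i' j' + frag_extend square (n - m)"
    unfolding n m by (simp add: frag_extend_diff)
  finally show ?thesis by blast
qed

lemma gpoint_simps [simp]: "Re (gpoint i j) = h * i" "Im (gpoint i j) = h * j"
  by (simp_all add: gpoint_def)

lemma linepath_chain_in:
  "convex C \<Longrightarrow> a \<in> C \<Longrightarrow> b \<in> C \<Longrightarrow> chain_in 1 euclidean C (frag_of (path_simplex (linepath a b)))"
proof -
  assume "convex C" "a \<in> C" "b \<in> C"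
  then have "closed_segment a b \<subseteq> C" by (simp add: closed_segment_subset)
  then have "pathin (top_of_set C) (linepath a b)"
    by (auto simp: pathin_canon_iff linepath_image_01 simp flip: image_subset_iff_funcset)
  then show ?thesis by (simp only: singular_chain_of singular_simplex_path_simplex)
qed

lemma steps_diff_chain_in:
  assumes "\<And>k. min i i' \<le> k \<Longrightarrow> k < max i i' \<Longrightarrow> chain_in p X C (f k)"
  shows "chain_in p X C (steps f i - steps f i')"
proof (cases "i \<le> i'")
  case True
  then show ?thesis using assms by (auto simp: steps_diff intro!: singular_chain_sum)
next
  case False
  then have "chain_in p X C (- (steps f i' - steps f i))"
    unfolding singular_chain_minus using assms
    by (subst steps_diff) (auto intro!: singular_chain_sum)
  then show ?thesis by simp
qed

lemma scaled_int_between: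
  assumes h: "h > 0" and k: "min i i' \<le> k" "k \<le> max i i'"
    and i: "\<bar>h * of_int i - x\<bar> < r" "\<bar>h * of_int i' - x\<bar> < r"
  shows "\<bar>h * of_int k - x\<bar> < r"
proof -
  have "of_int (min i i') \<le> (of_int k :: real)" "of_int k \<le> (of_int (max i i') :: real)"
    using k by (simp_all del: of_int_min of_int_max)
  then have "h * of_int (min i i') \<le> h * of_int k" "h * of_int k \<le> h * of_int (max i i')"
    using h by simp_all
  then show ?thesis using i by (auto simp: min_def max_def split: if_splits)
qed

lemma lpath_in_box:
  assumes h: "h > 0" and C: "C = {w. \<bar>Re w - a\<bar> < r \<and> \<bar>Im w - b\<bar> < r}"
    and pts: "gpoint i j \<in> C" "gpoint i' j' \<in> C"
  shows "chain_in 1 euclidean C (lpath i j i' j')"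
proof -
  have conv: "convex C"
  proof -
    have "C = {w. Re w > a - r} \<inter> {w. Re w < a + r} \<inter> {w. Im w > b - r} \<inter> {w. Im w < b + r}"
      unfolding C by auto
    then show ?thesis
      by (simp add: convex_Int convex_halfspace_Re_gt convex_halfspace_Re_lt convex_halfspace_Im_gt convex_halfspace_Im_lt)
  qed
  have "gpoint k j \<in> C" if "min i i' \<le> k" "k \<le> max i i'" for k
    using pts scaled_int_between[OF h that, of a r] by (auto simp: C)
  then have "chain_in 1 euclidean C (hedge k j)" if "min i i' \<le> k" "k < max i i'" for k
    unfolding hedge_def using that by (intro linepath_chain_in conv) auto
  then have 1: "chain_in 1 euclidean C (steps (\<lambda>k. hedge k j) i - steps (\<lambda>k. hedge k j) i')"
    by (rule steps_diff_chain_in)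
  have "gpoint i' k \<in> C" if "min j j' \<le> k" "k \<le> max j j'" for k
    using pts scaled_int_between[OF h that, of b r] by (auto simp: C)
  then have "chain_in 1 euclidean C (vedge i' k)" if "min j j' \<le> k" "k < max j j'" for k
    unfolding vedge_def using that by (intro linepath_chain_in conv) auto
  then have 2: "chain_in 1 euclidean C (steps (vedge i') j - steps (vedge i') j')"
    by (rule steps_diff_chain_in)
  show ?thesis unfolding lpath_def by (rule singular_chain_add[OF 1 2])
qed

lemma square_chain:
  assumes h: "h > 0"
  shows "chain_in 1 euclidean (cbox (gpoint i j) (gpoint (i + 1) (j + 1))) (square (i, j))"
    "chain_boundary 1 (square (i, j)) = 0"
proof -
  have "h * of_int k \<le> h * (of_int k + 1)" for k using h by simp
  then have c: "gpoint a b \<in> cbox (gpoint i j) (gpoint (i + 1) (j + 1))" if "a \<in> {i, i + 1}" "b \<in> {j, j + 1}" for a b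
    using that h by (auto simp: in_cbox_complex_iff)
  show "chain_in 1 euclidean (cbox (gpoint i j) (gpoint (i + 1) (j + 1))) (square (i, j))"
    unfolding square_def prod.case hedge_def vedge_def
    by (intro singular_chain_add singular_chain_diff linepath_chain_in convex_box c) auto
  show "chain_boundary 1 (square (i, j)) = 0"
    unfolding square_def prod.case chain_boundary_add chain_boundary_diff boundary_hedge boundary_vedge by simp
qed

lemma winding_square:
  assumes h: "h > 0"
  shows "w \<in> box (gpoint i j) (gpoint (i + 1) (j + 1)) \<Longrightarrow> winding (square (i, j)) w = 1"
    and "w \<notin> cbox (gpoint i j) (gpoint (i + 1) (j + 1)) \<Longrightarrow> winding (square (i, j)) w = 0"
proof -
  let ?a = "gpoint i j" and ?c = "gpoint (i + 1) (j + 1)"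
  have corner: "Complex (Re ?c) (Im ?a) = gpoint (i + 1) j" "Complex (Re ?a) (Im ?c) = gpoint i (j + 1)"
    by (simp_all add: gpoint_def)
  have eq: "winding (square (i, j)) w = winding_number (rectpath ?a ?c) w"
    if "w \<notin> path_image (rectpath ?a ?c)"
  proof -
    let ?b = "gpoint (i + 1) j" and ?d = "gpoint i (j + 1)"
    have r: "rectpath ?a ?c = linepath ?a ?b +++ linepath ?b ?c +++ linepath ?c ?d +++ linepath ?d ?a"
      by (simp add: rectpath_def Let_def corner del: gpoint_simps)
    have nw: "w \<notin> closed_segment ?a ?b" "w \<notin> closed_segment ?b ?c" "w \<notin> closed_segment ?c ?d" "w \<notin> closed_segment ?d ?a"
      using that unfolding r by (auto simp: path_image_join)
    have rev: "winding_number (linepath u v) w = - winding_number (linepath v u) w" if "w \<notin> closed_segment v u" for u v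
      using winding_number_reversepath[of "linepath v u" w] that by simp
    have "winding_number (rectpath ?a ?c) w = winding_number (linepath ?a ?b) w + winding_number (linepath ?b ?c) w
       + winding_number (linepath ?c ?d) w + winding_number (linepath ?d ?a) w"
      unfolding r using nw by (simp add: winding_number_join path_image_join)
    moreover have "winding_number (linepath ?c ?d) w = - winding_number (linepath ?d ?c) w"
      "winding_number (linepath ?d ?a) w = - winding_number (linepath ?a ?d) w"
      using nw by (auto intro!: rev simp: closed_segment_commute)
    ultimately show ?thesis
      by (simp add: square_def hedge_def vedge_def winding_add winding_diff)
  qed
  have le: "Re ?a \<le> Re ?c" "Im ?a \<le> Im ?c" using h by simp_all
  show "w \<in> box ?a ?c \<Longrightarrow> winding (square (i, j)) w = 1"
    using eq winding_number_rectpath path_image_rectpath_inter_box[OF le] by fastforce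
  show "w \<notin> cbox ?a ?c \<Longrightarrow> winding (square (i, j)) w = 0"
    using eq winding_number_rectpath_outside[OF le] path_image_rectpath_subset_cbox[OF le] by fastforce
qed

text \<open>The lower left grid point of the square containing a given point.\<close>

definition gindex :: "complex \<Rightarrow> int \<times> int" where
  "gindex p = (\<lfloor>Re p / h\<rfloor>, \<lfloor>Im p / h\<rfloor>)"

lemma gindex_near:
  assumes "h > 0" "gindex p = (i, j)"
  shows "\<bar>h * i - Re p\<bar> < h" "\<bar>h * j - Im p\<bar> < h"
    "p \<in> cbox (gpoint i j) (gpoint (i + 1) (j + 1))"
proof -
  have *: "h * \<lfloor>x / h\<rfloor> \<le> x" "x < h * \<lfloor>x / h\<rfloor> + h" for x
    using assms(1) floor_divide_lower[of h x] floor_divide_upper[of h x] by (simp_all add: algebra_simps)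
  show "\<bar>h * i - Re p\<bar> < h" "\<bar>h * j - Im p\<bar> < h"
    "p \<in> cbox (gpoint i j) (gpoint (i + 1) (j + 1))"
    using *[of "Re p"] *[of "Im p"] assms by (auto simp: gindex_def in_cbox_complex_iff algebra_simps)
qed

end

lemma extend_chain_boundary_1:
  assumes "singular_chain 1 X c"
  shows "frag_extend n (chain_boundary 1 c) =
    frag_extend (\<lambda>f. n (point_simplex (simplex_path f 1)) - n (point_simplex (simplex_path f 0))) c"
  using assms[unfolded singular_chain_def]
proof (induction rule: frag_induction)
  case (one f)
  then have f: "path_simplex (simplex_path f) = f" using path_simplex_simplex_path by blast
  show ?case using boundary_path_simplex[of "simplex_path f"]
    by (simp add: f frag_extend_diff)
qed (simp_all add: chain_boundary_diff frag_extend_diff)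

theorem cycle_with_zero_winding_is_boundary:
  assumes Dop: "open D" and z: "chain_in 1 euclidean D z" "chain_boundary 1 z = 0"
    and wz: "\<And>w. w \<notin> D \<Longrightarrow> winding z w = 0"
  obtains d where "chain_in 2 euclidean D d" "chain_boundary 2 d = z"
proof -
  let ?B = "singular_relboundary 1 (top_of_set D) {}"
  have zs: "singular_chain 1 euclidean z" using z(1) by (rule chain_in_imp_chain)
  let ?K = "support 1 z"
  have K: "compact ?K" "?K \<subseteq> D" using compact_support[OF zs] z(1) by (auto simp: chain_in_iff_support)
  obtain \<delta> where \<delta>0: "\<delta> > 0" "(\<Union>x\<in>?K. ball x \<delta>) \<subseteq> D"
    by (rule compact_subset_open_imp_ball_epsilon_subset[OF K(1) Dop K(2)])
  then have \<delta>: "\<delta> > 0" "\<And>x. x \<in> ?K \<Longrightarrow> ball x \<delta> \<subseteq> D" by blast+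
  define h where "h = \<delta> / 8"
  have h: "h > 0" using \<delta>(1) by (simp add: h_def)
  have zK: "singular_relcycle 1 (top_of_set ?K) {} z"
    using z zs by (simp add: singular_cycle chain_in_iff_support)
  obtain z' where z': "singular_relcycle 1 (top_of_set ?K) {} z'" "homologous_rel 1 (top_of_set ?K) {} z z'"
    and small: "\<And>f. f \<in> Poly_Mapping.keys z' \<Longrightarrow> \<exists>V \<in> (\<lambda>x. ?K \<inter> ball x (2*h)) ` ?K. f \<in> standard_simplex 1 \<rightarrow> V"
    by (rule small_homologous_rel_relcycle_exists[of "(\<lambda>x. ?K \<inter> ball x (2*h)) ` ?K" "top_of_set ?K", OF _ _ zK])
      (use h in auto)
  have zz': "?B (z - z')"
    using z'(2) K(2) singular_boundary_mono by (auto simp: homologous_rel_def)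
  have z'c: "singular_chain 1 (top_of_set ?K) z'" "chain_boundary 1 z' = 0"
    using z'(1) by (auto simp: singular_cycle)
  let ?g = "\<lambda>p. gpoint h (fst (gindex h p)) (snd (gindex h p))"
  let ?n = "\<lambda>p. frag_of (path_simplex (linepath p (?g p)))"
  let ?L = "\<lambda>p q. lpath h (fst (gindex h p)) (snd (gindex h p)) (fst (gindex h q)) (snd (gindex h q))"
  let ?T = "\<lambda>p. comb h (fst (gindex h p)) (snd (gindex h p))"
  define N where "N p q = (SOME n. ?L p q = ?T p - ?T q + frag_extend (square h) n)" for p q
  have N: "?L p q = ?T p - ?T q + frag_extend (square h) (N p q)" for p q
    unfolding N_def by (rule someI_ex) (rule lpath_eq_comb)
  let ?s = "\<lambda>f. simplex_path f 0" and ?t = "\<lambda>f. simplex_path f 1"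
  define l where "l f = ?n (?s f) - ?n (?t f) + ?L (?s f) (?t f)" for f
  have sub: "?B (frag_of f - l f)" if f: "f \<in> Poly_Mapping.keys z'" for f
  proof -
    obtain x where x: "x \<in> ?K" "f \<in> standard_simplex 1 \<rightarrow> ball x (2*h)" using small[OF f] by auto
    define C where "C = {w. \<bar>Re w - Re x\<bar> < 4*h \<and> \<bar>Im w - Im x\<bar> < 4*h}"
    have Cc: "convex C"
    proof -
      have "C = box (x - Complex (4*h) (4*h)) (x + Complex (4*h) (4*h))"
        by (auto simp: C_def in_box_complex_iff)
      then show ?thesis by (simp add: convex_box)
    qed
    have "C \<subseteq> ball x \<delta>"
    proof
      fix w assume "w \<in> C"
      then have "cmod (w - x) < 8 * h" using cmod_le[of "w - x"] by (auto simp: C_def)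
      then show "w \<in> ball x \<delta>" by (simp add: h_def dist_norm norm_minus_commute)
    qed
    then have CD: "C \<subseteq> D" using \<delta>(2)[OF x(1)] by blast
    have near: "p \<in> C \<and> ?g p \<in> C" if "dist x p < 2 * h" for p
    proof -
      have "\<bar>Re p - Re x\<bar> < 2 * h" "\<bar>Im p - Im x\<bar> < 2 * h"
        using that abs_Re_le_cmod[of "p - x"] abs_Im_le_cmod[of "p - x"] by (auto simp: dist_norm norm_minus_commute)
      then show ?thesis using gindex_near(1,2)[OF h, of p "fst (gindex h p)" "snd (gindex h p)"]
        by (auto simp: C_def)
    qed
    have sf: "singular_simplex 1 (top_of_set ?K) f" using f z'c(1) by (auto simp: singular_chain_def)
    have fC: "f \<in> standard_simplex 1 \<rightarrow> C" using x(2) near by fastforce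
    have "singular_simplex 1 (top_of_set C) f"
      using sf fC by (auto simp: singular_simplex_def continuous_map_in_subtopology)
    then have 1: "chain_in 1 euclidean C (frag_of f)" by (simp add: singular_chain_of)
    have "simplex_path f ` {0..1} \<subseteq> ball x (2*h)" using x(2) unfolding image_simplex_path by auto
    then have "?s f \<in> ball x (2*h)" "?t f \<in> ball x (2*h)" by (auto simp: image_subset_iff)
    then have pq: "dist x (?s f) < 2 * h" "dist x (?t f) < 2 * h" by auto
    have 2: "chain_in 1 euclidean C (l f)" unfolding l_def
      using near[OF pq(1)] near[OF pq(2)]
      by (intro singular_chain_add singular_chain_diff linepath_chain_in Cc
          lpath_in_box[OF h C_def]) auto
    have "chain_boundary 1 (frag_of f - l f) = 0"
      unfolding l_def chain_boundary_diff chain_boundary_add boundary_lpath boundary_path_simplex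
        boundary_path_simplex[of "simplex_path f", unfolded path_simplex_simplex_path[OF sf]]
      by (simp add: linepath_def)
    then obtain d where "chain_in 2 euclidean C d" "chain_boundary 2 d = frag_of f - l f"
      using convex_cycle_is_boundary[OF Cc, of 1 "frag_of f - l f"] singular_chain_diff[OF 1 2]
      by (auto simp: numeral_2_eq_2)
    then show ?thesis using singular_chain_mono[of 2 euclidean C d D] CD
      by (auto simp: singular_boundary numeral_2_eq_2)
  qed
  have z's: "singular_chain 1 euclidean z'" using z'c(1) by (rule chain_in_imp_chain)
  define n where "n = frag_extend (\<lambda>f. N (?s f) (?t f)) z'"
  define G where "G = frag_extend (square h) n"
  text \<open>The connecting segments and the tree paths cancel because \<open>z'\<close> is a cycle.\<close>
  let ?\<nu> = "\<lambda>f. ?T (f (\<lambda>j. if j = 0 then 1 else 0)) + ?n (f (\<lambda>j. if j = 0 then 1 else 0))"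
  have pt: "?\<nu> (point_simplex p) = ?T p + ?n p" for p
    by (simp add: point_simplex_def standard_simplex_0)
  have "0 = frag_extend ?\<nu> (chain_boundary 1 z')" by (simp only: z'c(2) frag_extend_0)
  also have "\<dots> = frag_extend (\<lambda>f. (?T (?t f) + ?n (?t f)) - (?T (?s f) + ?n (?s f))) z'"
    unfolding extend_chain_boundary_1[OF z's] pt ..
  finally have cancel: "frag_extend (\<lambda>f. (?T (?t f) + ?n (?t f)) - (?T (?s f) + ?n (?s f))) z' = 0" ..
  have fsum: "frag_extend (\<lambda>f. a f + b f) c = frag_extend a c + frag_extend b c" for a b :: "_ \<Rightarrow> complex chain" and c :: "complex chain"
    by (simp add: frag_extend_def frag_cmul_distrib2 sum.distrib)
  have "frag_extend l z' = frag_extend (\<lambda>f. ((?T (?t f) + ?n (?t f)) - (?T (?s f) + ?n (?s f))) + l f) z'"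
    by (simp only: fsum[of "\<lambda>f. (?T (?t f) + ?n (?t f)) - (?T (?s f) + ?n (?s f))"] cancel add_0)
  also have "(\<lambda>f. ((?T (?t f) + ?n (?t f)) - (?T (?s f) + ?n (?s f))) + l f) = (\<lambda>f. frag_extend (square h) (N (?s f) (?t f)))"
    unfolding l_def N by (simp add: fun_eq_iff algebra_simps)
  also have "frag_extend (\<lambda>f. frag_extend (square h) (N (?s f) (?t f))) z' = G"
    unfolding G_def n_def by (simp add: frag_extend_def[of _ z'] frag_extend_sum frag_extend_cmul o_def)
  finally have lG: "frag_extend l z' = G" .
  have "?B (frag_extend (\<lambda>f. frag_of f - l f) z')"
    using sub by (rule singular_relboundary_extend)
  also have "frag_extend (\<lambda>f. frag_of f - l f) z' = z' - G"
  proof -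
    have "frag_extend frag_of z' = frag_extend (\<lambda>f. frag_of f - l f) z' + frag_extend l z'"
      using fsum[of "\<lambda>f. frag_of f - l f" l z'] by simp
    then show ?thesis unfolding lG frag_expansion[symmetric] eq_diff_eq by (rule sym)
  qed
  finally have zG: "?B (z - G)" using singular_relboundary_add[OF zz'] by fastforce
  then have G: "chain_in 1 euclidean D G" "chain_boundary 1 G = 0"
    using singular_relboundary_imp_relcycle[OF zG] z singular_chain_diff[of 1 "top_of_set D" z "z - G"]
    by (auto simp: singular_cycle chain_boundary_diff)
  have wG: "winding G w = 0" if "w \<notin> D" for w
  proof -
    obtain d where d: "chain_in 2 euclidean D d" "chain_boundary 2 d = z - G"
      using zG by (auto simp: singular_boundary numeral_2_eq_2)
    have "chain_in 2 euclidean (- {w}) d" using d(1) that by (rule_tac singular_chain_mono) auto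
    then have "winding (z - G) w = 0" using winding_boundary[of w d] d(2) by simp
    then show ?thesis using wz[OF that] by (simp add: winding_diff)
  qed
  have Gsum: "winding G w = (\<Sum>s\<in>Poly_Mapping.keys n. of_int (Poly_Mapping.lookup n s) * winding (square h s) w)" for w
    unfolding G_def winding_def frag_eval_extend by (simp add: frag_eval_def)
  let ?Q = "\<lambda>(i, j). cbox (gpoint h i j) (gpoint h (i + 1) (j + 1))"
  have inD: "?Q s \<subseteq> D" if s: "s \<in> Poly_Mapping.keys n" for s
  proof
    obtain i j where ij: "s = (i, j)" by force
    fix w assume w: "w \<in> ?Q s"
    show "w \<in> D"
    proof (rule ccontr)
      assume nD: "w \<notin> D"
      have "compact (support 1 G)" using G(1) chain_in_imp_chain compact_support by blast
      moreover have "w \<notin> support 1 G" using G(1) nD by (auto simp: chain_in_iff_support)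
      ultimately obtain e where e: "e > 0" "ball w e \<subseteq> - support 1 G"
        using open_contains_ball[of "- support 1 G"] by (auto dest: compact_imp_closed)
      let ?b = "box (gpoint h i j) (gpoint h (i + 1) (j + 1))"
      have "(gpoint h i j + gpoint h (i + 1) (j + 1)) / 2 \<in> ?b"
        using h by (auto simp: in_box_complex_iff algebra_simps)
      then have "closure ?b = ?Q s" unfolding ij prod.case by (intro closure_box) auto
      then have "w \<in> closure ?b" using w by simp
      then obtain w' where w': "w' \<in> ?b" "dist w' w < e"
        using e(1) by (auto simp: closure_approachable)
      have "chain_in 1 euclidean (- ball w e) G"
        using G(1) e(2) by (auto simp: chain_in_iff_support intro: chain_in_imp_chain)
      then have "winding G w' = winding G w"
        by (rule winding_constant[OF _ G(2)]) (use w' e in \<open>auto simp: dist_commute\<close>)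
      then have "winding G w' = 0" using wG[OF nD] by simp
      have other: "winding (square h t) w' = 0" if "t \<noteq> s" for t
      proof -
        obtain k l where kl: "t = (k, l)" by force
        have "w' \<notin> cbox (gpoint h k l) (gpoint h (k + 1) (l + 1))"
        proof
          assume "w' \<in> cbox (gpoint h k l) (gpoint h (k + 1) (l + 1))"
          with w'(1) have "h * of_int k < h * of_int (i + 1)" "h * of_int i < h * of_int (k + 1)"
            "h * of_int l < h * of_int (j + 1)" "h * of_int j < h * of_int (l + 1)"
            by (auto simp: in_box_complex_iff in_cbox_complex_iff)
          then have "k < i + 1" "i < k + 1" "l < j + 1" "j < l + 1"
            using h by (simp_all only: mult_less_cancel_left_pos of_int_less_iff)
          then show False using that by (auto simp: kl ij)
        qed
        then show ?thesis unfolding kl by (rule winding_square(2)[OF h])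
      qed
      have "winding G w' = (\<Sum>t\<in>Poly_Mapping.keys n. if t = s then of_int (Poly_Mapping.lookup n s) else 0)"
        unfolding Gsum
        by (rule sum.cong) (use other winding_square(1)[OF h w'(1)] in \<open>auto simp: ij\<close>)
      also have "\<dots> = of_int (Poly_Mapping.lookup n s)" using s by simp
      finally show False using \<open>winding G w' = 0\<close> s by (simp add: in_keys_iff)
    qed
  qed
  have "?B G" unfolding G_def
  proof (rule singular_relboundary_extend)
    fix s assume s: "s \<in> Poly_Mapping.keys n"
    obtain i j where ij: "s = (i, j)" by force
    obtain d where "chain_in 2 euclidean (?Q s) d" "chain_boundary 2 d = square h s"
      using convex_cycle_is_boundary[OF convex_box(1), of 1 _ _ "square h (i, j)"] square_chain[OF h, of i j]
      by (auto simp: ij numeral_2_eq_2)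
    then show "?B (square h s)"
      using singular_chain_mono[OF _ inD[OF s], of 2 euclidean d] by (auto simp: singular_boundary numeral_2_eq_2)
  qed
  from singular_relboundary_add[OF zG this] have "?B z" by simp
  then show thesis using that by (auto simp: singular_boundary numeral_2_eq_2)
qed

section \<open>Local degrees on an oriented surface\<close>

abbreviation halfplane :: "complex set" where "halfplane \<equiv> {z. 0 \<le> Im z}"

text \<open>A point on or below the real axis can be moved down and out of the half-plane without meeting the cycle.\<close>

lemma winding_boundary_of_halfplane:
  assumes z: "chain_in 1 euclidean (halfplane - {w}) z" "chain_boundary 1 z = 0" and w: "Im w \<le> 0"
  shows "winding z w = 0"
proof -
  let ?Q = "closed_segment w (w - \<i>)"
  have "Im v \<le> 0 \<and> (Im v = 0 \<longrightarrow> v = w)" if v: "v \<in> ?Q" for v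
  proof -
    obtain u where "v = (1 - u) *\<^sub>R w + u *\<^sub>R (w - \<i>)" "0 \<le> u"
      using v unfolding closed_segment_def by blast
    then have "Re v = Re w" "Im v = Im w - u" by (auto simp: algebra_simps)
    then show ?thesis using w \<open>0 \<le> u\<close> by (auto simp: complex_eq_iff)
  qed
  then have "chain_in 1 euclidean (- ?Q) z"
    by (intro singular_chain_mono[OF z(1)]) (auto intro: order_antisym)
  then have "winding z w = winding z (w - \<i>)"
    by (rule winding_constant[OF _ z(2)]) auto
  also have "\<dots> = 0"
    by (rule winding_outside_convex[OF convex_halfspace_Im_ge[of 0] singular_chain_mono[OF z(1)] z(2)])
      (use w in auto)
  finally show ?thesis .
qed

lemma simplex_map_path_simplex: "simplex_map 1 g (path_simplex c) = path_simplex (g \<circ> c)"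
  by (auto simp: simplex_map_def path_simplex_def restrict_def fun_eq_iff)

lemma chain_in_Compl: "chain_in p X (topspace X - K) c \<longleftrightarrow> chain_in p X (- K) c"
proof -
  have "topspace X - K = topspace X \<inter> - K" by auto
  then show ?thesis by (metis subtopology_restrict)
qed

lemma chain_split_closed:
  assumes U: "openin X U" and Q: "closedin X Q" "Q \<subseteq> U" and b: "singular_chain p X b"
    and bd: "chain_in (p - 1) X (- Q) (chain_boundary p b)" and p: "p > 0"
  obtains b1 b2 d where "chain_in p X U b1" "chain_in p X (- Q) b2" "singular_chain (Suc p) X d"
    "b = b1 + b2 + chain_boundary (Suc p) d" "chain_in (p - 1) X (- Q) (chain_boundary p b1)"
proof -
  have cover: "U \<union> (topspace X - Q) = topspace X" using Q openin_subset[OF U] by auto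
  obtain b1 b2 d where b: "chain_in p X U b1" "chain_in p X (topspace X - Q) b2"
    "chain_in (Suc p) X (U \<union> (topspace X - Q)) d" "b = b1 + b2 + chain_boundary (Suc p) d"
    using chain_split[OF U openin_diff[OF openin_topspace Q(1)], of p b 0 "chain_boundary p b"] b bd p
    unfolding cover by (auto simp: chain_in_Compl)
  have d: "singular_chain (Suc p) X d" using b(3) by (simp add: cover)
  have b2: "chain_in p X (- Q) b2" using b(2) by (simp add: chain_in_Compl)
  have "chain_boundary p b1 = chain_boundary p b - chain_boundary p b2"
    using chain_boundary_boundary_alt[OF d] by (simp add: b(4) chain_boundary_add)
  then have "chain_in (p - 1) X (- Q) (chain_boundary p b1)"
    using bd singular_chain_boundary[OF b2] by (simp add: singular_chain_diff)
  then show thesis using that b(1,4) b2 d by blast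
qed

locale surface =
  fixes S :: "'a topology" and A :: "'a chart set"
  assumes surface: "compact_connected_oriented_surface S A"
begin

abbreviation positive :: "'a set \<Rightarrow> ('a \<Rightarrow> complex) \<Rightarrow> bool" where
  "positive U \<phi> \<equiv> positive_chart S A (U, \<phi>)"

lemma Hausdorff: "Hausdorff_space S" and compact: "compact_space S" and connected: "connected_space S"
  and atlas: "oriented_atlas S A"
  using surface by (auto simp: compact_connected_oriented_surface_def)

lemma positive_atlas: "(U, \<phi>) \<in> A \<Longrightarrow> positive U \<phi>"
  using atlas by (auto simp: oriented_atlas_def positive_chart_def)

lemma atlas_chart_at: "x \<in> topspace S \<Longrightarrow> \<exists>U \<phi>. (U, \<phi>) \<in> A \<and> x \<in> U"
  using atlas by (fastforce simp: oriented_atlas_def)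

lemma closedin_point: "x \<in> topspace S \<Longrightarrow> closedin S {x}"
  using Hausdorff by (simp add: Hausdorff_imp_t1_space closedin_t1_singleton)

lemma positive_chart_facts:
  assumes "positive U \<phi>"
  shows positive_openin: "openin S U"
    and positive_inj: "inj_on \<phi> U"
    and positive_continuous: "continuous_map (subtopology S U) (top_of_set (\<phi> ` U)) \<phi>"
    and positive_inverse: "continuous_map (top_of_set (\<phi> ` U)) (subtopology S U) (inv_into U \<phi>)"
    and positive_halfplane: "\<phi> ` U \<subseteq> halfplane"
    and positive_image_openin: "\<And>V. openin S V \<Longrightarrow> V \<subseteq> U \<Longrightarrow> openin (top_of_set halfplane) (\<phi> ` V)"
    and positive_preimage_openin: "\<And>W. openin (top_of_set halfplane) W \<Longrightarrow> openin S {x \<in> U. \<phi> x \<in> W}"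
proof -
  have U: "openin S U" and im: "openin (top_of_set halfplane) (\<phi> ` U)"
    and hom: "homeomorphic_map (subtopology S U) (top_of_set (\<phi> ` U)) \<phi>"
    using assms by (auto simp: positive_chart_def surface_chart_def)
  have top: "topspace (subtopology S U) = U" using openin_subset[OF U] by auto
  show "openin S U" by fact
  show inj: "inj_on \<phi> U" using homeomorphic_imp_injective_map[OF hom] unfolding top .
  show "continuous_map (subtopology S U) (top_of_set (\<phi> ` U)) \<phi>"
    by (rule homeomorphic_imp_continuous_map[OF hom])
  obtain g where g: "homeomorphic_maps (subtopology S U) (top_of_set (\<phi> ` U)) \<phi> g"
    using hom homeomorphic_map_maps by blast
  have "g y = inv_into U \<phi> y" if "y \<in> \<phi> ` U" for y
    using g that inj unfolding homeomorphic_maps_def top by auto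
  moreover have "continuous_map (top_of_set (\<phi> ` U)) (subtopology S U) g"
    using g by (simp add: homeomorphic_maps_def)
  ultimately show "continuous_map (top_of_set (\<phi> ` U)) (subtopology S U) (inv_into U \<phi>)"
    by (auto elim: continuous_map_eq)
  show "\<phi> ` U \<subseteq> halfplane" using openin_subset[OF im] by simp
  show "openin (top_of_set halfplane) (\<phi> ` V)" if "openin S V" "V \<subseteq> U" for V
  proof -
    have "openin (subtopology S U) V" using that openin_subset_topspace_eq openin_open_subtopology[OF U] by blast
    then have "openin (top_of_set (\<phi> ` U)) (\<phi> ` V)"
      using homeomorphic_imp_open_map[OF hom] by (simp add: open_map_def)
    then show ?thesis using im openin_trans by blast
  qed
  show "openin S {x \<in> U. \<phi> x \<in> W}" if "openin (top_of_set halfplane) W" for W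
  proof -
    have "continuous_map (subtopology S U) (top_of_set halfplane) \<phi>"
      using homeomorphic_imp_continuous_map[OF hom] openin_subset[OF im]
      by (auto simp: continuous_map_in_subtopology)
    from openin_continuous_map_preimage[OF this that]
    have "openin (subtopology S U) {x \<in> U. \<phi> x \<in> W}" unfolding top .
    then show ?thesis using openin_open_subtopology[OF U] by blast
  qed
qed

lemma chain_map_positive:
  assumes "positive U \<phi>" "V \<subseteq> U" "chain_in p S V c"
  shows "chain_in p euclidean (\<phi> ` V) (chain_map p \<phi> c)"
proof (rule singular_chain_chain_map[OF assms(3)])
  show "continuous_map (subtopology S V) (top_of_set (\<phi> ` V)) \<phi>"
    using continuous_map_from_subtopology_mono[of S U _ \<phi> V] positive_continuous[OF assms(1)] assms(2)
    by (auto simp: continuous_map_in_subtopology)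
qed

lemma chain_map_positive_inverse:
  assumes "positive U \<phi>" "V \<subseteq> U" "chain_in p euclidean (\<phi> ` V) c"
  shows "chain_in p S V (chain_map p (inv_into U \<phi>) c)"
proof (rule singular_chain_chain_map[OF assms(3)])
  have "inv_into U \<phi> (\<phi> v) = v" if "v \<in> V" for v
    using positive_inj[OF assms(1)] that assms(2) by auto
  then show "continuous_map (top_of_set (\<phi> ` V)) (subtopology S V) (inv_into U \<phi>)"
    using continuous_map_from_subtopology_mono[of euclidean "\<phi> ` U" _ "inv_into U \<phi>" "\<phi> ` V"]
      positive_inverse[OF assms(1)] assms(2)
    by (auto simp: continuous_map_in_subtopology image_mono)
qed

lemma chain_map_inverse_chain_map:
  assumes "positive U \<phi>" "chain_in p S U c"
  shows "chain_map p (inv_into U \<phi>) (chain_map p \<phi> c) = c"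
proof -
  have "chain_map p (inv_into U \<phi> \<circ> \<phi>) c = c"
    using positive_inj[OF assms(1)] openin_subset[OF positive_openin[OF assms(1)]]
    by (intro chain_map_id_gen[OF assms(2)]) auto
  then show ?thesis by (simp add: chain_map_compose)
qed

subsection \<open>Discs in charts\<close>

lemma small_discs:
  assumes "positive U \<phi>" "openin S V" "x \<in> V" "V \<subseteq> U"
  obtains r where "r > 0" "ball (\<phi> x) r \<inter> halfplane \<subseteq> \<phi> ` V"
proof -
  have "openin (top_of_set halfplane) (\<phi> ` V)" using positive_image_openin assms by blast
  then obtain T where T: "open T" "\<phi> ` V = halfplane \<inter> T" by (auto simp: openin_open)
  then obtain r where "r > 0" "ball (\<phi> x) r \<subseteq> T" using assms(3) open_contains_ball by blast
  then show thesis using that T(2) by blast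
qed

definition preimage :: "'a set \<Rightarrow> ('a \<Rightarrow> complex) \<Rightarrow> complex set \<Rightarrow> 'a set" where
  "preimage U \<phi> W = {x \<in> U. \<phi> x \<in> W}"

lemma preimage_subset: "preimage U \<phi> W \<subseteq> U"
  by (auto simp: preimage_def)

lemma preimage_image:
  assumes U: "positive U \<phi>" and V: "V \<subseteq> U" and W: "W \<inter> halfplane \<subseteq> \<phi> ` V"
  shows "preimage U \<phi> W \<subseteq> V"
proof
  fix x assume "x \<in> preimage U \<phi> W"
  then have x: "x \<in> U" "\<phi> x \<in> W" by (auto simp: preimage_def)
  then have "\<phi> x \<in> \<phi> ` V" using positive_halfplane[OF U] W by blast
  then show "x \<in> V" using inj_on_image_mem_iff[OF positive_inj[OF U] x(1) V] by simp
qed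

lemma image_preimage:
  assumes U: "positive U \<phi>" and W: "W \<inter> halfplane \<subseteq> \<phi> ` U"
  shows "\<phi> ` preimage U \<phi> W = W \<inter> halfplane"
proof
  show "\<phi> ` preimage U \<phi> W \<subseteq> W \<inter> halfplane"
    using positive_halfplane[OF U] by (auto simp: preimage_def)
  show "W \<inter> halfplane \<subseteq> \<phi> ` preimage U \<phi> W"
    using W by (auto simp: preimage_def)
qed

lemma openin_preimage:
  assumes U: "positive U \<phi>" and W: "open W" shows "openin S (preimage U \<phi> W)"
proof -
  have "preimage U \<phi> W = {x \<in> U. \<phi> x \<in> halfplane \<inter> W}"
    using positive_halfplane[OF U] by (auto simp: preimage_def)
  then show ?thesis using positive_preimage_openin[OF U, of "halfplane \<inter> W"] W
    by (simp add: openin_open_Int)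
qed

lemma compactin_preimage:
  assumes "positive U \<phi>" "compact W" "W \<subseteq> \<phi> ` U"
  shows "compactin S (preimage U \<phi> W)" "closedin S (preimage U \<phi> W)"
proof -
  have "preimage U \<phi> W = inv_into U \<phi> ` W"
  proof
    show "preimage U \<phi> W \<subseteq> inv_into U \<phi> ` W"
      using positive_inj[OF assms(1)] by (force simp: preimage_def)
    show "inv_into U \<phi> ` W \<subseteq> preimage U \<phi> W"
      using assms(3) by (auto simp: preimage_def inv_into_into f_inv_into_f subset_iff)
  qed
  moreover have "compactin (top_of_set (\<phi> ` U)) W" using assms by (simp add: compactin_subtopology)
  ultimately have "compactin (subtopology S U) (preimage U \<phi> W)"
    using image_compactin positive_inverse[OF assms(1)] by metis
  then show "compactin S (preimage U \<phi> W)" by (simp add: compactin_subtopology)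
  then show "closedin S (preimage U \<phi> W)" using Hausdorff compactin_imp_closedin by blast
qed

lemma disc_cycle_is_boundary:
  assumes U: "positive U \<phi>" and W: "convex W" "W \<subseteq> \<phi> ` U" and p: "p > 0"
    and c: "chain_in p S (preimage U \<phi> W) c" "chain_boundary p c = 0"
  obtains d where "chain_in (Suc p) S (preimage U \<phi> W) d" "chain_boundary (Suc p) d = c"
proof -
  let ?P = "preimage U \<phi> W"
  have im: "\<phi> ` ?P = W" using W(2) by (auto simp: preimage_def)
  have "chain_in p euclidean W (chain_map p \<phi> c)"
    using chain_map_positive[OF U preimage_subset c(1)] unfolding im .
  moreover have "chain_boundary p (chain_map p \<phi> c) = 0"
    using chain_boundary_chain_map[OF c(1)] c(2) by simp
  ultimately obtain d where d: "chain_in (Suc p) euclidean W d" "chain_boundary (Suc p) d = chain_map p \<phi> c"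
    using convex_cycle_is_boundary[OF W(1) p] by blast
  let ?d = "chain_map (Suc p) (inv_into U \<phi>) d"
  have "chain_boundary (Suc p) ?d = chain_map p (inv_into U \<phi>) (chain_map p \<phi> c)"
    using chain_boundary_chain_map[OF d(1), of "inv_into U \<phi>"] d(2) by simp
  also have "\<dots> = c"
    using chain_map_inverse_chain_map[OF U] singular_chain_mono[OF c(1) preimage_subset] by blast
  finally have "chain_boundary (Suc p) ?d = c" .
  moreover have "chain_in (Suc p) S ?P ?d"
    by (rule chain_map_positive_inverse[OF U preimage_subset]) (simp add: im d(1))
  ultimately show thesis using that by blast
qed

subsection \<open>Winding numbers in charts\<close>

definition chart_winding :: "('a \<Rightarrow> complex) \<Rightarrow> 'a chain \<Rightarrow> 'a \<Rightarrow> complex" where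
  "chart_winding \<phi> b x = winding (chain_map 1 \<phi> (chain_boundary 2 b)) (\<phi> x)"

lemma chart_winding_simps:
  "chart_winding \<phi> 0 x = 0"
  "chart_winding \<phi> (a + b) x = chart_winding \<phi> a x + chart_winding \<phi> b x"
  "chart_winding \<phi> (a - b) x = chart_winding \<phi> a x - chart_winding \<phi> b x"
  "chart_winding \<phi> (frag_cmul k a) x = of_int k * chart_winding \<phi> a x"
  by (simp_all add: chart_winding_def chain_boundary_add chain_boundary_diff chain_boundary_cmul
      chain_map_add chain_map_diff winding_add winding_diff winding_cmul)

lemma chart_winding_eq_0:
  assumes U: "positive U \<phi>" and V: "V \<subseteq> U" "x \<in> U" "x \<notin> V" and b: "chain_in 2 S V b"
  shows "chart_winding \<phi> b x = 0"
proof -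
  have "chain_in 2 euclidean (\<phi> ` V) (chain_map 2 \<phi> b)" by (rule chain_map_positive[OF U V(1) b])
  moreover have "\<phi> ` V \<subseteq> - {\<phi> x}" using positive_inj[OF U] V by (auto simp: inj_on_def)
  ultimately have "winding (chain_boundary 2 (chain_map 2 \<phi> b)) (\<phi> x) = 0"
    by (intro winding_boundary) (rule singular_chain_mono)
  moreover have "chain_boundary 2 (chain_map 2 \<phi> b) = chain_map 1 \<phi> (chain_boundary 2 b)"
    using chain_boundary_chain_map[OF b, of \<phi>] by simp
  ultimately show ?thesis by (simp add: chart_winding_def)
qed

text \<open>Excision: a chain in a chart that is homologous, relative to the complement of \<open>x\<close>, to
  zero in the whole surface has winding number zero about \<open>x\<close>.\<close>

lemma chart_winding_excision:
  assumes U: "positive U \<phi>" and x: "x \<in> U" and b: "chain_in 2 S U b1" "chain_in 2 S (- {x}) b2"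
    and d: "singular_chain 3 S d" and eq: "b1 + b2 + chain_boundary 3 d = 0"
  shows "chart_winding \<phi> b1 x = 0"
proof -
  have xS: "x \<in> topspace S" using x positive_openin[OF U] openin_subset by blast
  have oU: "openin S U" by (rule positive_openin[OF U])
  have oV: "openin S (topspace S - {x})" using closedin_point[OF xS] by blast
  have cover: "U \<union> (topspace S - {x}) = topspace S" using x openin_subset[OF oU] by auto
  have "chain_boundary 3 d = - b1 + - b2" using eq by (simp add: add_eq_0_iff)
  then obtain d1 d2 e where d12: "chain_in 3 S U d1" "chain_in 3 S (topspace S - {x}) d2"
    "chain_in 4 S (U \<union> (topspace S - {x})) e" "d = d1 + d2 + chain_boundary 4 e"
    using chain_split[OF oU oV, of 3 d "- b1" "- b2"] b d unfolding cover
    by (auto simp: chain_in_Compl singular_chain_minus)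
  have "chain_boundary 3 (chain_boundary 4 e) = 0"
    using chain_boundary_boundary_alt[of 3 S e] d12(3) by (simp add: cover)
  then have "b1 + b2 + (chain_boundary 3 d1 + chain_boundary 3 d2) = 0"
    using eq unfolding d12(4) chain_boundary_add by simp
  then have "(b1 + chain_boundary 3 d1) + (b2 + chain_boundary 3 d2) = 0"
    by (simp only: add_ac)
  then have "b1 + chain_boundary 3 d1 = - (b2 + chain_boundary 3 d2)"
    by (simp only: eq_neg_iff_add_eq_0)
  moreover have "chain_in 2 S U (b1 + chain_boundary 3 d1)"
    using b(1) d12(1) singular_chain_boundary[of 3 _ d1] by (intro singular_chain_add) auto
  moreover have "chain_in 2 S (- {x}) (- (b2 + chain_boundary 3 d2))"
    unfolding singular_chain_minus
    using b(2) d12(2) singular_chain_boundary[of 3 _ d2] by (intro singular_chain_add) (auto simp: chain_in_Compl)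
  ultimately have "chain_in 2 S (U \<inter> - {x}) (b1 + chain_boundary 3 d1)"
    using chain_in_Int by metis
  then have "chart_winding \<phi> (b1 + chain_boundary 3 d1) x = 0"
    by (rule chart_winding_eq_0[OF U, rotated 3]) (use x in auto)
  moreover have "chain_boundary 2 (chain_boundary 3 d1) = 0"
    using chain_boundary_boundary[OF d12(1)] by simp
  ultimately show ?thesis by (simp add: chart_winding_simps) (simp add: chart_winding_def)
qed

lemma chart_winding_Ints:
  assumes U: "positive U \<phi>" and x: "x \<in> U" and b: "chain_in 2 S U b" "chain_in 1 S (- {x}) (chain_boundary 2 b)"
  shows "chart_winding \<phi> b x \<in> \<int>"
    and "chain_in 1 euclidean (\<phi> ` U - {\<phi> x}) (chain_map 1 \<phi> (chain_boundary 2 b))"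
    and "chain_boundary 1 (chain_map 1 \<phi> (chain_boundary 2 b)) = 0"
proof -
  let ?z = "chain_map 1 \<phi> (chain_boundary 2 b)"
  have bU: "chain_in 1 S U (chain_boundary 2 b)" using singular_chain_boundary[OF b(1)] by simp
  then have "chain_in 1 S (U \<inter> - {x}) (chain_boundary 2 b)" using b(2) by (rule chain_in_Int)
  then have "chain_in 1 euclidean (\<phi> ` (U \<inter> - {x})) ?z" by (intro chain_map_positive[OF U]) auto
  moreover have "\<phi> ` (U \<inter> - {x}) \<subseteq> \<phi> ` U - {\<phi> x}" using positive_inj[OF U] x by (auto simp: inj_on_def)
  ultimately show 1: "chain_in 1 euclidean (\<phi> ` U - {\<phi> x}) ?z" by (rule singular_chain_mono)
  have "chain_boundary 1 (chain_boundary 2 b) = 0" using chain_boundary_boundary[OF b(1)] by simp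
  then show 2: "chain_boundary 1 ?z = 0"
    using chain_boundary_chain_map[OF bU, of \<phi>] by simp
  show "chart_winding \<phi> b x \<in> \<int>" unfolding chart_winding_def
    by (rule winding_Ints[OF singular_chain_mono[OF 1] 2]) auto
qed

text \<open>Charts with coherent orientations give the same winding numbers: near an interior point the
  cycle is homologous to a multiple of a small circle, and the transition map
  preserves the winding number of the circle. At a boundary point both winding numbers vanish.\<close>

lemma chart_winding_coherent_interior:
  assumes U: "positive U \<phi>" and V: "positive V \<psi>" and coh: "coherent_charts (U, \<phi>) (V, \<psi>)"
    and x: "x \<in> U" "x \<in> V" "0 < Im (\<phi> x)"
  obtains W where "openin S W" "x \<in> W" "W \<subseteq> U \<inter> V"
    "\<And>b. chain_in 2 S W b \<Longrightarrow> chain_in 1 S (- {x}) (chain_boundary 2 b) \<Longrightarrow>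
       chart_winding \<phi> b x = chart_winding \<psi> b x"
proof -
  have oUV: "openin S (U \<inter> V)" using positive_openin U V by blast
  obtain r0 where r0: "r0 > 0" "ball (\<phi> x) r0 \<inter> halfplane \<subseteq> \<phi> ` (U \<inter> V)"
    using small_discs[OF U oUV] x by blast
  define r where "r = min r0 (Im (\<phi> x))"
  have r: "r > 0" using r0 x by (simp add: r_def)
  let ?B = "ball (\<phi> x) r"
  have BH: "?B \<subseteq> halfplane"
  proof
    fix z assume "z \<in> ?B"
    then have "\<bar>Im (\<phi> x - z)\<bar> < Im (\<phi> x)"
      using abs_Im_le_cmod[of "\<phi> x - z"] by (auto simp: r_def dist_norm)
    then show "z \<in> halfplane" by auto
  qed
  have "?B \<subseteq> ball (\<phi> x) r0" by (auto simp: r_def)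
  then have BUV: "?B \<subseteq> \<phi> ` (U \<inter> V)" using BH r0(2) by blast
  let ?W = "preimage U \<phi> ?B" and ?g = "\<psi> \<circ> inv_into U \<phi>"
  have WUV: "?W \<subseteq> U \<inter> V" using BUV by (intro preimage_image[OF U]) auto
  have xW: "x \<in> ?W" using x r by (simp add: preimage_def)
  have "?B \<inter> halfplane = ?B" using BH by blast
  moreover have BU: "?B \<subseteq> \<phi> ` U" using BUV by blast
  ultimately have imW: "\<phi> ` ?W = ?B" using image_preimage[OF U, of ?B] by simp
  obtain s where s: "0 < s" "s < r" "winding_number (?g \<circ> circlepath (\<phi> x) s) (\<psi> x) = 1"
  proof -
    have "\<forall>\<^sub>F s in at_right 0. winding_number (?g \<circ> circlepath (\<phi> x) s) (\<psi> x) = 1"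
      using coh x by (auto simp: coherent_charts_def)
    moreover have "\<forall>\<^sub>F s in at_right 0. s < r" "\<forall>\<^sub>F s in at_right (0::real). s > 0"
      using r by (auto intro: eventually_at_right_less order_tendstoD simp: eventually_at_right_field)
    ultimately have "\<forall>\<^sub>F s in at_right 0. 0 < s \<and> s < r \<and> winding_number (?g \<circ> circlepath (\<phi> x) s) (\<psi> x) = 1"
      by eventually_elim auto
    then show thesis using that eventually_happens'[OF trivial_limit_at_right_real] by blast
  qed
  let ?D = "?B - {\<phi> x}"
  let ?c = "frag_of (path_simplex (circlepath (\<phi> x) s))"
  have circ: "chain_in 1 euclidean ?D ?c"
  proof -
    have "path_image (circlepath (\<phi> x) s) \<subseteq> ?D" using s by (auto simp: dist_norm norm_minus_commute)
    then have "pathin (top_of_set ?D) (circlepath (\<phi> x) s)"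
      by (auto simp: pathin_canon_iff path_image_def simp flip: image_subset_iff_funcset)
    then show ?thesis by (simp only: singular_chain_of singular_simplex_path_simplex)
  qed
  have circ_cycle: "chain_boundary 1 ?c = 0"
    unfolding boundary_path_simplex using pathstart_circlepath[of "\<phi> x" s] pathfinish_circlepath[of "\<phi> x" s]
    by (simp add: pathstart_def pathfinish_def)
  have g: "continuous_map (top_of_set ?B) euclidean ?g" "?g \<in> ?D \<rightarrow> - {\<psi> x}"
  proof -
    have "continuous_map (top_of_set ?B) (subtopology S ?W) (inv_into U \<phi>)"
      using continuous_map_from_subtopology_mono[OF positive_inverse[OF U], of ?B] BUV
        positive_inj[OF U]
      by (auto simp: continuous_map_in_subtopology subset_iff preimage_def f_inv_into_f inv_into_into image_iff Bex_def)
    moreover have "continuous_map (subtopology S ?W) euclidean \<psi>"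
      using continuous_map_from_subtopology_mono[of S V _ \<psi> ?W] positive_continuous[OF V] WUV
      by (auto simp: continuous_map_in_subtopology)
    ultimately show "continuous_map (top_of_set ?B) euclidean ?g" by (rule continuous_map_compose)
    show "?g \<in> ?D \<rightarrow> - {\<psi> x}"
    proof
      fix z assume z: "z \<in> ?D"
      then obtain y where y: "y \<in> U \<inter> V" "z = \<phi> y" using BUV by blast
      then have "inv_into U \<phi> z = y" using positive_inj[OF U] by auto
      moreover have "y \<noteq> x" using z y by auto
      ultimately show "?g z \<in> - {\<psi> x}" using y x positive_inj[OF V] by (auto simp: inj_on_def)
    qed
  qed
  show thesis
  proof (rule that)
    show "openin S ?W" by (rule openin_preimage[OF U]) simp
    show "x \<in> ?W" "?W \<subseteq> U \<inter> V" by fact+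
    fix b assume b: "chain_in 2 S ?W b" "chain_in 1 S (- {x}) (chain_boundary 2 b)"
    have bU: "chain_in 2 S U b" using b(1) by (rule singular_chain_mono) (use WUV in auto)
    let ?z = "chain_map 1 \<phi> (chain_boundary 2 b)"
    have bW: "chain_in 1 S ?W (chain_boundary 2 b)" using singular_chain_boundary[OF b(1)] by simp
    have z1: "chain_in 1 euclidean ?B ?z"
      using chain_map_positive[OF U _ bW] WUV imW by auto
    have z: "chain_in 1 euclidean ?D ?z"
      by (rule singular_chain_mono[OF chain_in_Int[OF z1 chart_winding_Ints(2)[OF U x(1) bU b(2)]]]) auto
    have z_cycle: "chain_boundary 1 ?z = 0" by (rule chart_winding_Ints(3)[OF U x(1) bU b(2)])
    obtain n where n: "chart_winding \<phi> b x = of_int n"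
      using chart_winding_Ints(1)[OF U x(1) bU b(2)] by (auto elim: Ints_cases)
    let ?y = "?z - frag_cmul n ?c"
    have y: "chain_in 1 euclidean ?D ?y" "chain_boundary 1 ?y = 0"
      using z circ z_cycle circ_cycle
      by (simp_all add: singular_chain_diff singular_chain_cmul chain_boundary_diff chain_boundary_cmul)
    have "winding ?y w = 0" if "w \<notin> ?D" for w
    proof (cases "w = \<phi> x")
      case True
      show ?thesis unfolding True winding_diff winding_cmul chart_winding_def[symmetric] n
        using s by (simp add: winding_number_circlepath_centre)
    next
      case False
      then have "w \<notin> ?B" using that by auto
      then show ?thesis
        using winding_outside_convex[of ?B ?y w] y singular_chain_mono[OF y(1), of ?B] by auto
    qed
    then obtain d where d: "chain_in 2 euclidean ?D d" "chain_boundary 2 d = ?y"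
      using cycle_with_zero_winding_is_boundary[of ?D ?y] y open_delete[of ?B] by auto
    have gd: "chain_in 2 euclidean (- {\<psi> x}) (chain_map 2 ?g d)"
      by (rule singular_chain_chain_map[OF d(1)])
        (use g in \<open>auto simp: continuous_map_in_subtopology intro: continuous_on_subset\<close>)
    have "chain_boundary 2 (chain_map 2 ?g d) = chain_map 1 ?g ?y"
      using chain_boundary_chain_map[OF d(1), of ?g] d(2) by simp
    then have 0: "winding (chain_map 1 ?g ?y) (\<psi> x) = 0" using winding_boundary[OF gd] by simp
    have gc: "chain_map 1 ?g ?c = frag_of (path_simplex (?g \<circ> circlepath (\<phi> x) s))"
      by (simp only: chain_map_of simplex_map_path_simplex)
    have "chain_map 1 ?g ?z = chain_map 1 \<psi> (chain_map 1 (inv_into U \<phi>) ?z)"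
      by (simp only: chain_map_compose o_apply)
    also have "\<dots> = chain_map 1 \<psi> (chain_boundary 2 b)"
      using chain_map_inverse_chain_map[OF U singular_chain_mono[OF bW]] WUV by simp
    finally have "chain_map 1 ?g ?y = chain_map 1 \<psi> (chain_boundary 2 b) - frag_cmul n (chain_map 1 ?g ?c)"
      by (simp only: chain_map_diff chain_map_cmul)
    then have "chart_winding \<psi> b x = of_int n"
      using 0 s(3) unfolding gc by (simp add: winding_diff winding_cmul chart_winding_def del: One_nat_def)
    then show "chart_winding \<phi> b x = chart_winding \<psi> b x" using n by simp
  qed
qed

lemma chart_winding_boundary_point:
  assumes U: "positive U \<phi>" and x: "x \<in> U" "Im (\<phi> x) = 0"
    and b: "chain_in 2 S U b" "chain_in 1 S (- {x}) (chain_boundary 2 b)"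
  shows "chart_winding \<phi> b x = 0"
  unfolding chart_winding_def
proof (rule winding_boundary_of_halfplane)
  show "chain_in 1 euclidean (halfplane - {\<phi> x}) (chain_map 1 \<phi> (chain_boundary 2 b))"
    using chart_winding_Ints(2)[OF U x(1) b] positive_halfplane[OF U] by (rule_tac singular_chain_mono) auto
qed (use x chart_winding_Ints(3)[OF U x(1) b] in auto)

lemma chart_winding_coherent:
  assumes U: "positive U \<phi>" and V: "(V, \<psi>) \<in> A" and x: "x \<in> U" "x \<in> V"
  obtains W where "openin S W" "x \<in> W" "W \<subseteq> U \<inter> V"
    "\<And>b. chain_in 2 S W b \<Longrightarrow> chain_in 1 S (- {x}) (chain_boundary 2 b) \<Longrightarrow>
       chart_winding \<phi> b x = chart_winding \<psi> b x"
proof -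
  have V': "positive V \<psi>" using V by (rule positive_atlas)
  have coh: "coherent_charts (U, \<phi>) (V, \<psi>)" "coherent_charts (V, \<psi>) (U, \<phi>)"
    using U V by (auto simp: positive_chart_def)
  have Im: "0 \<le> Im (\<phi> x)" "0 \<le> Im (\<psi> x)"
    using x positive_halfplane[OF U] positive_halfplane[OF V'] by auto
  consider "0 < Im (\<phi> x)" | "0 < Im (\<psi> x)" | "Im (\<phi> x) = 0" "Im (\<psi> x) = 0"
    using Im by linarith
  then show thesis
  proof cases
    case 1
    then show ?thesis using chart_winding_coherent_interior[OF U V' coh(1) x] that by blast
  next
    case 2
    obtain W where W: "openin S W" "x \<in> W" "W \<subseteq> V \<inter> U"
      "\<And>b. chain_in 2 S W b \<Longrightarrow> chain_in 1 S (- {x}) (chain_boundary 2 b) \<Longrightarrow>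
       chart_winding \<psi> b x = chart_winding \<phi> b x"
      using chart_winding_coherent_interior[OF V' U coh(2) x(2,1) 2] by blast
    show ?thesis using W(3,4) by (intro that[OF W(1,2)]) auto
  next
    case 3
    show ?thesis
    proof (rule that)
      show "openin S (U \<inter> V)" using positive_openin U V' by blast
      fix b assume b: "chain_in 2 S (U \<inter> V) b" "chain_in 1 S (- {x}) (chain_boundary 2 b)"
      have "chart_winding \<phi> b x = 0"
        by (rule chart_winding_boundary_point[OF U x(1) 3(1) singular_chain_mono[OF b(1)] b(2)]) auto
      moreover have "chart_winding \<psi> b x = 0"
        by (rule chart_winding_boundary_point[OF V' x(2) 3(2) singular_chain_mono[OF b(1)] b(2)]) auto
      ultimately show "chart_winding \<phi> b x = chart_winding \<psi> b x" by simp
    qed (use x in auto)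
  qed
qed

subsection \<open>The local degree of a two-chain\<close>

text \<open>The local degree of \<open>b\<close> at a point \<open>x\<close> off the support of \<open>\<partial> b\<close> is the class of \<open>b\<close>
  in the local homology group \<open>H\<^sub>2(S, S - x)\<close>, identified with the integers by winding
  numbers in a positive chart. At boundary points it is zero.\<close>

definition relative_cycle :: "'a set \<Rightarrow> 'a chain \<Rightarrow> bool" where
  "relative_cycle K b \<longleftrightarrow> singular_chain 2 S b \<and> chain_in 1 S (- K) (chain_boundary 2 b)"

definition degree_in :: "'a set \<Rightarrow> ('a \<Rightarrow> complex) \<Rightarrow> 'a \<Rightarrow> 'a chain \<Rightarrow> int \<Rightarrow> bool" where
  "degree_in U \<phi> x b k \<longleftrightarrow> (\<exists>b1 b2 d. chain_in 2 S U b1 \<and> chain_in 2 S (- {x}) b2 \<and> singular_chain 3 S d \<and>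
     b = b1 + b2 + chain_boundary 3 d \<and> chart_winding \<phi> b1 x = of_int k)"

definition degree :: "'a \<Rightarrow> 'a chain \<Rightarrow> int" where
  "degree x b = (THE k. \<forall>U \<phi>. positive U \<phi> \<longrightarrow> x \<in> U \<longrightarrow> degree_in U \<phi> x b k)"

lemma relative_cycle_mono: "relative_cycle K b \<Longrightarrow> L \<subseteq> K \<Longrightarrow> relative_cycle L b"
  by (auto simp: relative_cycle_def elim!: singular_chain_mono)

lemma relative_cycle_add: "relative_cycle K a \<Longrightarrow> relative_cycle K b \<Longrightarrow> relative_cycle K (a + b)"
  and relative_cycle_diff: "relative_cycle K a \<Longrightarrow> relative_cycle K b \<Longrightarrow> relative_cycle K (a - b)"
  and relative_cycle_cmul: "relative_cycle K a \<Longrightarrow> relative_cycle K (frag_cmul k a)"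
  by (simp_all add: relative_cycle_def chain_boundary_add chain_boundary_diff chain_boundary_cmul
      singular_chain_add singular_chain_diff singular_chain_cmul)

lemma relative_cycle_decompose:
  assumes b: "relative_cycle Q b" and Q: "closedin S Q" "Q \<subseteq> W" and W: "openin S W"
  obtains b1 b2 d where "chain_in 2 S W b1" "chain_in 2 S (- Q) b2" "singular_chain 3 S d"
    "b = b1 + b2 + chain_boundary 3 d" "chain_in 1 S (- Q) (chain_boundary 2 b1)"
  using chain_split_closed[OF W Q, of 2 b] b by (auto simp: relative_cycle_def)

lemma degree_in_unique:
  assumes U: "positive U \<phi>" "x \<in> U" and k: "degree_in U \<phi> x b k" "degree_in U \<phi> x b l"
  shows "k = l"
proof -
  obtain b1 b2 d where b: "chain_in 2 S U b1" "chain_in 2 S (- {x}) b2" "singular_chain 3 S d"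
     "b = b1 + b2 + chain_boundary 3 d" "chart_winding \<phi> b1 x = of_int k"
    using k(1) by (auto simp: degree_in_def)
  obtain c1 c2 e where c: "chain_in 2 S U c1" "chain_in 2 S (- {x}) c2" "singular_chain 3 S e"
     "b = c1 + c2 + chain_boundary 3 e" "chart_winding \<phi> c1 x = of_int l"
    using k(2) by (auto simp: degree_in_def)
  have "(b1 - c1) + (b2 - c2) + chain_boundary 3 (d - e) = (b1 + b2 + chain_boundary 3 d) - (c1 + c2 + chain_boundary 3 e)"
    by (simp add: chain_boundary_diff)
  also have "\<dots> = 0" using b(4) c(4) by simp
  finally have "chart_winding \<phi> (b1 - c1) x = 0"
    using b c by (intro chart_winding_excision[OF U, of _ "b2 - c2" "d - e"]) (auto intro: singular_chain_diff)
  then show ?thesis using b(5) c(5) by (simp add: chart_winding_simps)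
qed

lemma degree_in_exists:
  assumes U: "positive U \<phi>" "x \<in> U" and W: "openin S W" "x \<in> W" "W \<subseteq> U" and b: "relative_cycle {x} b"
  obtains k b1 b2 d where "chain_in 2 S W b1" "chain_in 2 S (- {x}) b2" "singular_chain 3 S d"
     "b = b1 + b2 + chain_boundary 3 d" "chart_winding \<phi> b1 x = of_int k"
     "chain_in 1 S (- {x}) (chain_boundary 2 b1)"
proof -
  have "closedin S {x}" using closedin_point openin_subset[OF W(1)] W(2) by blast
  then obtain b1 b2 d where d: "chain_in 2 S W b1" "chain_in 2 S (- {x}) b2" "singular_chain 3 S d"
    "b = b1 + b2 + chain_boundary 3 d" "chain_in 1 S (- {x}) (chain_boundary 2 b1)"
    using relative_cycle_decompose[OF b _ _ W(1)] W(2) by auto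
  have "chart_winding \<phi> b1 x \<in> \<int>"
    by (rule chart_winding_Ints(1)[OF U singular_chain_mono[OF d(1) W(3)] d(5)])
  then show thesis using that d by (auto elim!: Ints_cases)
qed

lemma degree_iff:
  assumes b: "relative_cycle {x} b" and U: "positive U \<phi>" "x \<in> U"
  shows "degree_in U \<phi> x b k \<longleftrightarrow> degree x b = k"
proof -
  have xS: "x \<in> topspace S" using U openin_subset positive_openin by blast
  obtain V \<psi> where V: "(V, \<psi>) \<in> A" "x \<in> V" using atlas_chart_at[OF xS] by blast
  have V': "positive V \<psi>" using V(1) by (rule positive_atlas)
  obtain k0 where k0: "degree_in V \<psi> x b k0"
    using degree_in_exists[OF V' V(2) positive_openin[OF V'] V(2) subset_refl b] unfolding degree_in_def by metis
  have all: "degree_in U \<phi> x b k0" if U: "positive U \<phi>" "x \<in> U" for U \<phi>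
  proof -
    obtain W where W: "openin S W" "x \<in> W" "W \<subseteq> U \<inter> V"
      "\<And>b. chain_in 2 S W b \<Longrightarrow> chain_in 1 S (- {x}) (chain_boundary 2 b) \<Longrightarrow>
       chart_winding \<phi> b x = chart_winding \<psi> b x"
      using chart_winding_coherent[OF U(1) V(1) U(2) V(2)] by blast
    have WU: "W \<subseteq> U" using W(3) by blast
    obtain l b1 b2 d where d: "chain_in 2 S W b1" "chain_in 2 S (- {x}) b2" "singular_chain 3 S d"
     "b = b1 + b2 + chain_boundary 3 d" "chart_winding \<phi> b1 x = of_int l"
     "chain_in 1 S (- {x}) (chain_boundary 2 b1)"
      by (rule degree_in_exists[OF U W(1,2) WU b])
    have "chain_in 2 S U b1" "chain_in 2 S V b1" using W(3) singular_chain_mono[OF d(1)] by auto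
    moreover have "chart_winding \<psi> b1 x = of_int l" using W(4)[OF d(1,6)] d(5) by simp
    ultimately have "degree_in U \<phi> x b l" "degree_in V \<psi> x b l"
      using d(2-5) unfolding degree_in_def by blast+
    then show ?thesis using degree_in_unique[OF V' V(2) k0] by simp
  qed
  have "degree x b = k0" unfolding degree_def
    by (rule the_equality) (use all degree_in_unique[OF V' V(2) k0] V' V(2) in blast)+
  then show ?thesis using all[OF U] degree_in_unique[OF U] by blast
qed

lemma degree_eqI:
  assumes "relative_cycle {x} b" "positive U \<phi>" "x \<in> U" "chain_in 2 S U b1" "chain_in 2 S (- {x}) b2"
    "singular_chain 3 S d" "b = b1 + b2 + chain_boundary 3 d"
  shows "chart_winding \<phi> b1 x = of_int (degree x b)"
proof -
  have d: "chain_boundary 2 (chain_boundary 3 d) = 0" using chain_boundary_boundary[OF assms(6)] by simp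
  have "chain_boundary 2 b1 = chain_boundary 2 b - chain_boundary 2 b2"
    unfolding assms(7) chain_boundary_add d by simp
  moreover have "chain_in 1 S (- {x}) (chain_boundary 2 b2)" using singular_chain_boundary[OF assms(5)] by simp
  ultimately have "chain_in 1 S (- {x}) (chain_boundary 2 b1)"
    using assms(1) by (simp add: relative_cycle_def singular_chain_diff)
  then obtain k where k: "chart_winding \<phi> b1 x = of_int k"
    using chart_winding_Ints(1)[OF assms(2-4)] by (auto elim: Ints_cases)
  then have "degree_in U \<phi> x b k" using assms unfolding degree_in_def by blast
  then show ?thesis using degree_iff[OF assms(1-3)] k by simp
qed

lemma degree_chart:
  assumes "positive U \<phi>" "x \<in> U" "chain_in 2 S U b" "chain_in 1 S (- {x}) (chain_boundary 2 b)"
  shows "chart_winding \<phi> b x = of_int (degree x b)"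
  using assms by (intro degree_eqI[of x b U \<phi> b 0 0]) (auto simp: relative_cycle_def intro: chain_in_imp_chain)

lemma degree_lincomb:
  assumes x: "x \<in> topspace S" and a: "relative_cycle {x} a" and b: "relative_cycle {x} b"
  shows "degree x (frag_cmul m a + frag_cmul n b) = m * degree x a + n * degree x b"
proof -
  obtain U \<phi> where "(U, \<phi>) \<in> A" "x \<in> U" using atlas_chart_at[OF x] by blast
  then have U: "positive U \<phi>" "x \<in> U" using positive_atlas by auto
  obtain k a1 a2 d where A1: "chain_in 2 S U a1" "chain_in 2 S (- {x}) a2" "singular_chain 3 S d"
     "a = a1 + a2 + chain_boundary 3 d" "chart_winding \<phi> a1 x = of_int k" "chain_in 1 S (- {x}) (chain_boundary 2 a1)"
    by (rule degree_in_exists[OF U positive_openin[OF U(1)] U(2) subset_refl a])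
  obtain l b1 b2 e where B1: "chain_in 2 S U b1" "chain_in 2 S (- {x}) b2" "singular_chain 3 S e"
     "b = b1 + b2 + chain_boundary 3 e" "chart_winding \<phi> b1 x = of_int l" "chain_in 1 S (- {x}) (chain_boundary 2 b1)"
    by (rule degree_in_exists[OF U positive_openin[OF U(1)] U(2) subset_refl b])
  let ?c = "\<lambda>u v. frag_cmul m u + frag_cmul n v"
  have "chart_winding \<phi> (?c a1 b1) x = of_int (degree x (?c a b))"
  proof (rule degree_eqI[OF _ U])
    show "relative_cycle {x} (?c a b)" by (intro relative_cycle_add relative_cycle_cmul a b)
    show "?c a b = ?c a1 b1 + ?c a2 b2 + chain_boundary 3 (?c d e)"
      unfolding A1(4) B1(4) chain_boundary_add chain_boundary_cmul frag_cmul_distrib2 by (simp only: add_ac)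
  qed (use A1 B1 in \<open>auto intro: singular_chain_add singular_chain_cmul\<close>)
  also have "chart_winding \<phi> (?c a1 b1) x = of_int (m * degree x a + n * degree x b)"
    using degree_eqI[OF a U A1(1-4)] degree_eqI[OF b U B1(1-4)] by (simp add: chart_winding_simps)
  finally show ?thesis by (simp only: of_int_eq_iff)
qed

lemma degree_add: "x \<in> topspace S \<Longrightarrow> relative_cycle {x} a \<Longrightarrow> relative_cycle {x} b \<Longrightarrow>
    degree x (a + b) = degree x a + degree x b"
  using degree_lincomb[of x a b 1 1] by simp

lemma degree_cmul: "x \<in> topspace S \<Longrightarrow> relative_cycle {x} a \<Longrightarrow> degree x (frag_cmul n a) = n * degree x a"
  using degree_lincomb[of x a a n 0] by simp

lemma degree_diff: "x \<in> topspace S \<Longrightarrow> relative_cycle {x} a \<Longrightarrow> relative_cycle {x} b \<Longrightarrow>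
    degree x (a - b) = degree x a - degree x b"
  using degree_lincomb[of x a b 1 "-1"] by simp

lemma degree_eq_0:
  assumes x: "x \<in> topspace S" and b: "chain_in 2 S (- {x}) b"
  shows "degree x b = 0"
proof -
  obtain U \<phi> where "(U, \<phi>) \<in> A" "x \<in> U" using atlas_chart_at[OF x] by blast
  then have U: "positive U \<phi>" "x \<in> U" using positive_atlas by auto
  have "relative_cycle {x} b" using b singular_chain_boundary[OF b]
    by (auto simp: relative_cycle_def intro: chain_in_imp_chain)
  from degree_eqI[OF this U, of 0 b 0] b show ?thesis by (simp add: chart_winding_simps)
qed

lemma degree_boundary_point:
  assumes x: "x \<in> surface_boundary S A" and b: "relative_cycle {x} b"
  shows "degree x b = 0"
proof -
  obtain U \<phi> where U: "(U, \<phi>) \<in> A" "x \<in> U" "Im (\<phi> x) = 0" using x by (auto simp: surface_boundary_def)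
  then have U': "positive U \<phi>" using positive_atlas by auto
  obtain k a1 a2 d where A1: "chain_in 2 S U a1" "chain_in 2 S (- {x}) a2" "singular_chain 3 S d"
     "b = a1 + a2 + chain_boundary 3 d" "chart_winding \<phi> a1 x = of_int k" "chain_in 1 S (- {x}) (chain_boundary 2 a1)"
    by (rule degree_in_exists[OF U' U(2) positive_openin[OF U'] U(2) subset_refl b])
  have "of_int (degree x b) = chart_winding \<phi> a1 x" using degree_eqI[OF b U' U(2) A1(1-4)] by simp
  also have "\<dots> = 0" by (rule chart_winding_boundary_point[OF U' U(2,3) A1(1,6)])
  finally show ?thesis by simp
qed

lemma degree_constant_in_chart:
  assumes U: "positive U \<phi>" and Q: "closedin S Q" "Q \<subseteq> U" "connected (\<phi> ` Q)" and b: "relative_cycle Q b"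
    and xy: "x \<in> Q" "y \<in> Q"
  shows "degree x b = degree y b"
proof -
  obtain b1 b2 d where d: "chain_in 2 S U b1" "chain_in 2 S (- Q) b2" "singular_chain 3 S d"
    "b = b1 + b2 + chain_boundary 3 d" "chain_in 1 S (- Q) (chain_boundary 2 b1)"
    by (rule relative_cycle_decompose[OF b Q(1,2) positive_openin[OF U]])
  have *: "chart_winding \<phi> b1 x = of_int (degree x b)" if x: "x \<in> Q" for x
    by (rule degree_eqI[OF relative_cycle_mono[OF b] U _ d(1) singular_chain_mono[OF d(2)] d(3,4)])
      (use x Q in auto)
  let ?z = "chain_map 1 \<phi> (chain_boundary 2 b1)"
  have bU: "chain_in 1 S U (chain_boundary 2 b1)" using singular_chain_boundary[OF d(1)] by simp
  have "chain_in 1 euclidean (\<phi> ` (U \<inter> - Q)) ?z"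
    by (rule chain_map_positive[OF U _ chain_in_Int[OF bU d(5)]]) auto
  moreover have "\<phi> ` (U \<inter> - Q) \<subseteq> - \<phi> ` Q" using positive_inj[OF U] Q(2) by (auto simp: inj_on_def)
  ultimately have z: "chain_in 1 euclidean (- \<phi> ` Q) ?z" by (rule singular_chain_mono)
  have "chain_boundary 1 (chain_boundary 2 b1) = 0" using chain_boundary_boundary[OF d(1)] by simp
  then have "chain_boundary 1 ?z = 0" using chain_boundary_chain_map[OF bU, of \<phi>] by simp
  then have "winding ?z (\<phi> x) = winding ?z (\<phi> y)" using xy by (intro winding_constant[OF z _ Q(3)]) auto
  then show ?thesis using *[OF xy(1)] *[OF xy(2)] by (simp add: chart_winding_def)
qed

lemma degree_locally_constant:
  assumes b: "relative_cycle {x} b" and x: "x \<in> topspace S"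
  obtains W where "openin S W" "x \<in> W" "relative_cycle W b" "\<And>y. y \<in> W \<Longrightarrow> degree y b = degree x b"
proof -
  let ?Z = "support 1 (chain_boundary 2 b)"
  have bc: "singular_chain 2 S b" and bd: "singular_chain 1 S (chain_boundary 2 b)" "x \<notin> ?Z"
    using b by (auto simp: relative_cycle_def chain_in_iff_support)
  obtain U \<phi> where "(U, \<phi>) \<in> A" "x \<in> U" using atlas_chart_at[OF x] by blast
  then have U: "positive U \<phi>" "x \<in> U" using positive_atlas by auto
  have "openin S (U - ?Z)" using positive_openin[OF U(1)] closedin_support[OF bd(1) Hausdorff] by blast
  then obtain r where r: "r > 0" "ball (\<phi> x) r \<inter> halfplane \<subseteq> \<phi> ` (U - ?Z)"
    using small_discs[OF U(1), of "U - ?Z" x] bd(2) U(2) by blast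
  let ?C = "cball (\<phi> x) (r / 2) \<inter> halfplane"
  let ?Q = "preimage U \<phi> ?C" and ?W = "preimage U \<phi> (ball (\<phi> x) (r / 2))"
  have Cb: "cball (\<phi> x) (r / 2) \<subseteq> ball (\<phi> x) r" using r(1) by auto
  have C: "compact ?C" "?C \<subseteq> \<phi> ` U" "convex ?C"
  proof -
    have "closed halfplane" by (rule closed_halfspace_Im_ge)
    then show "compact ?C" by (intro compact_Int_closed) auto
    show "?C \<subseteq> \<phi> ` U" using Cb r(2) by blast
    show "convex ?C" by (intro convex_Int convex_cball convex_halfspace_Im_ge)
  qed
  have QZ: "?Q \<subseteq> U - ?Z" by (rule preimage_image[OF U(1)]) (use Cb r(2) in auto)
  have Q: "relative_cycle ?Q b"
    unfolding relative_cycle_def chain_in_iff_support using bc bd(1) QZ by blast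
  have WQ: "?W \<subseteq> ?Q" using positive_halfplane[OF U(1)] by (auto simp: preimage_def)
  show thesis
  proof (rule that)
    show "openin S ?W" by (rule openin_preimage[OF U(1)]) simp
    show xW: "x \<in> ?W" using U(2) r(1) by (simp add: preimage_def)
    show "relative_cycle ?W b" by (rule relative_cycle_mono[OF Q WQ])
    have im: "\<phi> ` ?Q = ?C" using C(2) image_preimage[OF U(1), of ?C] by auto
    fix y assume "y \<in> ?W"
    then show "degree y b = degree x b"
      using WQ xW convex_connected[OF C(3)] preimage_subset
      by (intro degree_constant_in_chart[OF U(1) compactin_preimage(2)[OF U(1) C(1,2)] _ _ Q]) (auto simp: im)
  qed
qed

lemma degree_constant:
  assumes K: "connectedin S K" and b: "relative_cycle K b" and xy: "x \<in> K" "y \<in> K"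
  shows "degree x b = degree y b"
proof -
  have KS: "K \<subseteq> topspace S" using K connectedin_subset_topspace by blast
  have "continuous_map (subtopology S K) (discrete_topology UNIV) (\<lambda>x. degree x b)"
    unfolding continuous_map_def
  proof (intro conjI allI impI)
    fix T :: "int set"
    show "openin (subtopology S K) {x \<in> topspace (subtopology S K). degree x b \<in> T}"
    proof (subst openin_subopen, clarify)
      fix x assume x: "x \<in> topspace (subtopology S K)" "degree x b \<in> T"
      then have "x \<in> K" "x \<in> topspace S" by auto
      then obtain W where W: "openin S W" "x \<in> W" "\<And>y. y \<in> W \<Longrightarrow> degree y b = degree x b"
        using degree_locally_constant[of x b] relative_cycle_mono[OF b, of "{x}"] by auto
      have "openin (subtopology S K) (W \<inter> K)" using W(1) by (rule openin_subtopology_Int)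
      moreover have "W \<inter> K \<subseteq> {x \<in> topspace (subtopology S K). degree x b \<in> T}"
        using x(2) W(3) KS by auto
      ultimately show "\<exists>V. openin (subtopology S K) V \<and> x \<in> V \<and> V \<subseteq> {x \<in> topspace (subtopology S K). degree x b \<in> T}"
        using W(2) \<open>x \<in> K\<close> by blast
    qed
  qed auto
  moreover have "connectedin (subtopology S K) K" using K by (simp add: connectedin_subtopology)
  ultimately have "connectedin (discrete_topology UNIV) ((\<lambda>x. degree x b) ` K)"
    by (rule connectedin_continuous_map_image)
  then obtain k where "(\<lambda>x. degree x b) ` K \<subseteq> {k}"
    unfolding connectedin_discrete_topology by blast
  then show ?thesis using xy by (simp add: image_subset_iff)
qed

end

section \<open>The first homology group is torsion-free\<close>

definition fold_halfplane :: "complex \<Rightarrow> complex" where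
  "fold_halfplane z = Complex (Re z) \<bar>Im z\<bar>"

lemma fold_halfplane_simps [simp]: "Re (fold_halfplane z) = Re z" "Im (fold_halfplane z) = \<bar>Im z\<bar>"
  by (simp_all add: fold_halfplane_def)

lemma fold_halfplane_id: "z \<in> halfplane \<Longrightarrow> fold_halfplane z = z"
  by (simp add: complex_eq_iff)

lemma continuous_on_fold_halfplane: "continuous_on T fold_halfplane"
proof -
  have eq: "fold_halfplane = (\<lambda>z. complex_of_real (Re z) + \<i> * complex_of_real \<bar>Im z\<bar>)"
    by (simp add: fun_eq_iff complex_eq_iff)
  show ?thesis unfolding eq by (intro continuous_intros)
qed

lemma frag_cmul_diff_right: "frag_cmul k (a - b) = frag_cmul k a - frag_cmul k b"
  by (auto simp: right_diff_distrib lookup_minus poly_mapping_eqI)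

text \<open>A 0-chain of total weight zero in a path-connected set bounds there.\<close>

lemma path_connected_fill_boundary:
  assumes V: "path_connectedin X V" and z: "singular_chain 1 X z" "chain_in 0 X V (chain_boundary 1 z)"
  obtains y where "chain_in 1 X V y" "chain_boundary 1 y = chain_boundary 1 z"
proof (cases "V = {}")
  case True
  then have "chain_boundary 1 z = 0" using z(2) by (simp add: singular_chain_empty)
  then show ?thesis using that[of 0] by simp
next
  case False
  then obtain v0 where v0: "v0 \<in> V" by blast
  have VX: "V \<subseteq> topspace X" using V path_connectedin_subset_topspace by blast
  have "\<forall>v\<in>V. \<exists>g. pathin (subtopology X V) g \<and> g 0 = v0 \<and> g 1 = v"
    using V v0 unfolding path_connectedin_def path_connected_space_def using VX
    by (simp add: Int_absorb1)
  then obtain g where g: "\<And>v. v \<in> V \<Longrightarrow> pathin (subtopology X V) (g v) \<and> g v 0 = v0 \<and> g v 1 = v"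
    by metis
  let ?v = "\<lambda>f :: (nat \<Rightarrow> real) \<Rightarrow> 'a. f (\<lambda>j. if j = 0 then 1 else 0)"
  let ?y = "frag_extend (\<lambda>f. frag_of (path_simplex (g (?v f)))) (chain_boundary 1 z)"
  have k: "f = point_simplex (?v f)" "?v f \<in> V" if "f \<in> Poly_Mapping.keys (chain_boundary 1 z)" for f
  proof -
    have "singular_simplex 0 (subtopology X V) f" using z(2) that by (auto simp: singular_chain_def)
    from singular_simplex_0_eq_point[OF this] show "f = point_simplex (?v f)" "?v f \<in> V" by auto
  qed
  have y: "chain_in 1 X V ?y"
  proof (rule singular_chain_extend)
    fix f assume "f \<in> Poly_Mapping.keys (chain_boundary 1 z)"
    then show "chain_in 1 X V (frag_of (path_simplex (g (?v f))))"
      using g[OF k(2)] by (simp only: singular_chain_of singular_simplex_path_simplex)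
  qed
  have "chain_boundary 1 ?y = (\<Sum>f\<in>Poly_Mapping.keys (chain_boundary 1 z).
      frag_cmul (Poly_Mapping.lookup (chain_boundary 1 z) f) (chain_boundary 1 (frag_of (path_simplex (g (?v f))))))"
    unfolding frag_extend_def by (simp only: chain_boundary_sum o_def chain_boundary_cmul)
  also have "\<dots> = (\<Sum>f\<in>Poly_Mapping.keys (chain_boundary 1 z).
      frag_cmul (Poly_Mapping.lookup (chain_boundary 1 z) f) (frag_of f - frag_of (point_simplex v0)))"
  proof (rule sum.cong[OF refl])
    fix f assume f: "f \<in> Poly_Mapping.keys (chain_boundary 1 z)"
    have "chain_boundary 1 (frag_of (path_simplex (g (?v f)))) = frag_of f - frag_of (point_simplex v0)"
      unfolding boundary_path_simplex using g[OF k(2)[OF f]] k(1)[OF f] by simp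
    then show "frag_cmul (Poly_Mapping.lookup (chain_boundary 1 z) f) (chain_boundary 1 (frag_of (path_simplex (g (?v f)))))
      = frag_cmul (Poly_Mapping.lookup (chain_boundary 1 z) f) (frag_of f - frag_of (point_simplex v0))" by simp
  qed
  also have "\<dots> = frag_extend frag_of (chain_boundary 1 z) - frag_extend (\<lambda>f. frag_of (point_simplex v0)) (chain_boundary 1 z)"
    unfolding frag_extend_def by (simp only: frag_cmul_diff_right sum_subtractf)
  also have "frag_extend (\<lambda>f. frag_of (point_simplex v0)) (chain_boundary 1 z) = 0"
    unfolding extend_chain_boundary_1[OF z(1)] by (simp add: frag_extend_def)
  finally have "chain_boundary 1 ?y = chain_boundary 1 z" by (simp flip: frag_expansion)
  then show ?thesis using that y by blast
qed

context surface
begin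

text \<open>Injectivity of \<open>H\<^sub>2(S, S - L) \<rightarrow> \<Prod>\<^bsub>x \<in> L\<^esub> H\<^sub>2(S, S - x)\<close> for a closed set \<open>L\<close> inside
  a disc. The boundary of the part of the chain in the disc is a cycle in the plane with vanishing
  winding numbers. In a half-disc, folding the plane along the real axis brings the filling back into
  the half-plane.\<close>

lemma degree_zero_imp_relative_boundary:
  assumes U: "positive U \<phi>" and r: "ball c r \<inter> halfplane \<subseteq> \<phi> ` U"
    and L: "closedin S L" "L \<subseteq> preimage U \<phi> (ball c r)" and b: "relative_cycle L b"
    and deg: "\<And>x. x \<in> L \<Longrightarrow> degree x b = 0"
  obtains w s where "singular_chain 3 S w" "chain_in 2 S (- L) s" "b = chain_boundary 3 w + s"
proof -
  let ?D = "preimage U \<phi> (ball c r)" and ?g = "inv_into U \<phi>"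
  have DU: "?D \<subseteq> U" by (auto simp: preimage_def)
  have D: "openin S ?D" by (rule openin_preimage[OF U]) simp
  obtain b1 b2 d where d: "chain_in 2 S ?D b1" "chain_in 2 S (- L) b2" "singular_chain 3 S d"
    "b = b1 + b2 + chain_boundary 3 d" "chain_in 1 S (- L) (chain_boundary 2 b1)"
    by (rule relative_cycle_decompose[OF b L D])
  have "openin S (?D - L)" using D L(1) by blast
  then obtain T where T: "open T" "\<phi> ` (?D - L) = halfplane \<inter> T"
    using positive_image_openin[OF U, of "?D - L"] DU by (auto simp: openin_open)
  let ?O = "fold_halfplane -` T"
  have O: "open ?O" using T(1) continuous_on_fold_halfplane[of UNIV] by (rule open_vimage)
  have DO: "\<phi> ` (?D - L) \<subseteq> ?O" unfolding T(2) using fold_halfplane_id by auto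
  let ?z = "chain_map 1 \<phi> (chain_boundary 2 b1)"
  have bD: "chain_in 1 S (?D - L) (chain_boundary 2 b1)"
    using chain_in_Int[OF _ d(5), of ?D] singular_chain_boundary[OF d(1)]
    by (simp add: Diff_eq)
  have zD: "chain_in 1 euclidean (\<phi> ` (?D - L)) ?z"
    by (rule chain_map_positive[OF U _ bD]) (use DU in auto)
  have z: "chain_in 1 euclidean ?O ?z" by (rule singular_chain_mono[OF zD DO])
  have "chain_boundary 1 (chain_boundary 2 b1) = 0" using chain_boundary_boundary[OF d(1)] by simp
  then have zc: "chain_boundary 1 ?z = 0" using chain_boundary_chain_map[OF bD, of \<phi>] by simp
  have "winding ?z w = 0" if w: "w \<notin> ?O" for w
  proof (cases "w \<in> \<phi> ` ?D")
    case True
    then obtain x where x: "x \<in> ?D" "w = \<phi> x" by blast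
    then have "x \<in> L" using w DO by blast
    have "chart_winding \<phi> b1 x = of_int (degree x b)"
      by (rule degree_eqI[OF relative_cycle_mono[OF b] U _ singular_chain_mono[OF d(1) DU] singular_chain_mono[OF d(2)] d(3,4)])
        (use x DU \<open>x \<in> L\<close> in auto)
    then show ?thesis using deg[OF \<open>x \<in> L\<close>] x by (simp add: chart_winding_def)
  next
    case False
    have b1: "chain_in 2 euclidean (\<phi> ` ?D) (chain_map 2 \<phi> b1)" by (rule chain_map_positive[OF U DU d(1)])
    have "winding (chain_boundary 2 (chain_map 2 \<phi> b1)) w = 0"
      by (rule winding_boundary[OF singular_chain_mono[OF b1]]) (use False in auto)
    then show ?thesis using chain_boundary_chain_map[OF d(1), of \<phi>] by simp
  qed
  then obtain y where y: "chain_in 2 euclidean ?O y" "chain_boundary 2 y = ?z"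
    using cycle_with_zero_winding_is_boundary[OF O z zc] by blast
  let ?y = "chain_map 2 fold_halfplane y"
  have fy: "chain_in 2 euclidean (\<phi> ` (?D - L)) ?y"
    by (rule singular_chain_chain_map[OF y(1)])
      (auto simp: T(2) continuous_map_in_subtopology continuous_on_fold_halfplane)
  have "chain_boundary 2 ?y = chain_map 1 fold_halfplane ?z"
    using chain_boundary_chain_map[OF y(1), of fold_halfplane] y(2) by simp
  also have "\<dots> = ?z"
    by (rule chain_map_id_gen[OF zD]) (use fold_halfplane_id in \<open>auto simp: T(2)\<close>)
  finally have yz: "chain_boundary 2 ?y = ?z" .
  let ?x = "chain_map 2 ?g ?y"
  have x: "chain_in 2 S (?D - L) ?x" by (rule chain_map_positive_inverse[OF U _ fy]) (use DU in auto)
  have "chain_boundary 2 ?x = chain_map 1 ?g ?z"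
    using chain_boundary_chain_map[OF fy, of ?g] yz by simp
  also have "\<dots> = chain_boundary 2 b1"
    by (rule chain_map_inverse_chain_map[OF U singular_chain_mono[OF bD]]) (use DU in auto)
  finally have bx: "chain_boundary 2 (b1 - ?x) = 0" by (simp add: chain_boundary_diff)
  have D_half: "?D = preimage U \<phi> (ball c r \<inter> halfplane)"
    using positive_halfplane[OF U] by (auto simp: preimage_def)
  have "chain_in 2 S (preimage U \<phi> (ball c r \<inter> halfplane)) (b1 - ?x)"
    unfolding D_half[symmetric] using d(1) singular_chain_mono[OF x, of ?D] by (auto intro: singular_chain_diff)
  then obtain e where e: "chain_in 3 S (preimage U \<phi> (ball c r \<inter> halfplane)) e" "chain_boundary 3 e = b1 - ?x"
    using disc_cycle_is_boundary[OF U _ r, of 2 "b1 - ?x"] bx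
    by (auto simp: convex_Int convex_halfspace_Im_ge numeral_3_eq_3 numeral_2_eq_2)
  show thesis
  proof (rule that)
    show "singular_chain 3 S (e + d)" using chain_in_imp_chain[OF e(1)] d(3) by (rule singular_chain_add)
    show "chain_in 2 S (- L) (?x + b2)"
      by (rule singular_chain_add[OF singular_chain_mono[OF x] d(2)]) auto
    show "b = chain_boundary 3 (e + d) + (?x + b2)"
      unfolding chain_boundary_add e(2) by (simp add: d(4))
  qed
qed

subsection \<open>Gluing relative chains\<close>

lemma degree_of_boundary: "x \<in> topspace S \<Longrightarrow> singular_chain 3 S w \<Longrightarrow> degree x (chain_boundary 3 w) = 0"
proof -
  assume x: "x \<in> topspace S" and w: "singular_chain 3 S w"
  obtain U \<phi> where "(U, \<phi>) \<in> A" "x \<in> U" using atlas_chart_at[OF x] by blast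
  then have U: "positive U \<phi>" "x \<in> U" using positive_atlas by auto
  have "chain_boundary 2 (chain_boundary 3 w) = 0" using chain_boundary_boundary[OF w] by simp
  then have "relative_cycle {x} (chain_boundary 3 w)"
    using singular_chain_boundary[OF w] by (simp add: relative_cycle_def)
  from degree_eqI[OF this U, of 0 0 w] w show ?thesis by (simp add: chart_winding_simps)
qed

text \<open>The Mayer--Vietoris argument: two chains with the prescribed boundary \<open>z\<close> relative to the
  complements of \<open>K\<close> and \<open>K'\<close> can be corrected to a single one relative to the
  complement of \<open>K \<union> K'\<close>, provided that their difference has degree 0 on \<open>K \<inter> K'\<close>.\<close>

lemma glue:
  assumes U: "positive U \<phi>" and r: "ball c r \<inter> halfplane \<subseteq> \<phi> ` U"
    and K: "closedin S K" "closedin S K'" "K' \<subseteq> preimage U \<phi> (ball c r)"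
    and b: "singular_chain 2 S b" "chain_in 1 S (- K) (chain_boundary 2 b - z)"
    and b': "singular_chain 2 S b'" "chain_in 1 S (- K') (chain_boundary 2 b' - z)"
    and deg: "\<And>x. x \<in> K \<inter> K' \<Longrightarrow> degree x (b - b') = 0"
  obtains s s' w where "chain_in 2 S (- K) s" "chain_in 2 S (- K') s'" "singular_chain 3 S w"
    "b - s = b' + s' + chain_boundary 3 w"
    "chain_in 1 S (- (K \<union> K')) (chain_boundary 2 (b - s) - z)"
proof -
  let ?L = "K \<inter> K'"
  have u: "chain_boundary 2 (b - b') = (chain_boundary 2 b - z) + - (chain_boundary 2 b' - z)"
    by (simp add: chain_boundary_diff)
  have "chain_in 1 S (- ?L) (chain_boundary 2 (b - b'))"
    unfolding u using b(2) b'(2)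
    by (intro singular_chain_add) (auto simp: singular_chain_minus simp del: minus_diff_eq elim!: singular_chain_mono)
  then have rel: "relative_cycle ?L (b - b')"
    using b(1) b'(1) by (simp add: relative_cycle_def singular_chain_diff)
  obtain w q where w: "singular_chain 3 S w" "chain_in 2 S (- ?L) q" "b - b' = chain_boundary 3 w + q"
    by (rule degree_zero_imp_relative_boundary[OF U r _ _ rel deg]) (use K in auto)
  have cover: "(topspace S - K) \<union> (topspace S - K') = topspace S - ?L" by auto
  have "chain_boundary 2 (chain_boundary 3 w) = 0" using chain_boundary_boundary[OF w(1)] by simp
  then have "chain_boundary 2 q = (chain_boundary 2 b - z) + - (chain_boundary 2 b' - z)"
    using u unfolding w(3) chain_boundary_add by simp
  moreover have "openin S (topspace S - K)" "openin S (topspace S - K')" using K by auto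
  ultimately obtain q1 q2 e where q: "chain_in 2 S (topspace S - K) q1" "chain_in 2 S (topspace S - K') q2"
    "chain_in (Suc 2) S ((topspace S - K) \<union> (topspace S - K')) e" "q = q1 + q2 + chain_boundary (Suc 2) e"
    using chain_split[of S "topspace S - K" "topspace S - K'" 2 q "chain_boundary 2 b - z" "- (chain_boundary 2 b' - z)"]
      w(2) b(2) b'(2) unfolding cover
    by (auto simp: chain_in_Compl singular_chain_minus simp del: minus_diff_eq)
  have q1: "chain_in 2 S (- K) q1" and q2: "chain_in 2 S (- K') q2" using q by (simp_all add: chain_in_Compl)
  have e: "singular_chain 3 S e" using chain_in_imp_chain[OF q(3)] by simp
  have eq: "b - q1 = b' + q2 + chain_boundary 3 (w + e)"
  proof -
    have "b = b' + (chain_boundary 3 w + (q1 + q2 + chain_boundary 3 e))"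
      using w(3) unfolding q(4) by (simp add: diff_eq_eq add.commute numeral_3_eq_3 numeral_2_eq_2)
    then show ?thesis by (simp add: chain_boundary_add)
  qed
  have we: "singular_chain 3 S (w + e)" using w(1) e by (rule singular_chain_add)
  have 1: "chain_in 1 S (- K) (chain_boundary 2 (b - q1) - z)"
  proof -
    have eq1: "chain_boundary 2 (b - q1) - z = (chain_boundary 2 b - z) - chain_boundary 2 q1"
      by (simp add: chain_boundary_diff)
    show ?thesis unfolding eq1 by (rule singular_chain_diff[OF b(2)]) (use singular_chain_boundary[OF q1] in simp)
  qed
  have "chain_boundary 2 (chain_boundary 3 (w + e)) = 0" using chain_boundary_boundary[OF we] by simp
  then have eq2: "chain_boundary 2 (b - q1) - z = (chain_boundary 2 b' - z) + chain_boundary 2 q2"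
    unfolding eq chain_boundary_add by simp
  have 2: "chain_in 1 S (- K') (chain_boundary 2 (b - q1) - z)"
    unfolding eq2 by (rule singular_chain_add[OF b'(2)]) (use singular_chain_boundary[OF q2] in simp)
  from chain_in_Int[OF 1 2] have "chain_in 1 S (- (K \<union> K')) (chain_boundary 2 (b - q1) - z)" by simp
  then show thesis using that q1 q2 we eq by blast
qed

definition locally_constant :: "'a set \<Rightarrow> ('a \<Rightarrow> int) \<Rightarrow> bool" where
  "locally_constant K f \<longleftrightarrow> (\<forall>x\<in>K. \<exists>W. openin S W \<and> x \<in> W \<and> (\<forall>y\<in>W \<inter> K. f y = f x))"

lemma locally_constant_subset:
  assumes "locally_constant K f" "L \<subseteq> K" shows "locally_constant L f"
  unfolding locally_constant_def
proof
  fix x assume "x \<in> L"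
  then have "x \<in> K" using assms(2) by blast
  then obtain W where "openin S W" "x \<in> W" "\<forall>y\<in>W \<inter> K. f y = f x"
    using assms(1) unfolding locally_constant_def by meson
  then show "\<exists>W. openin S W \<and> x \<in> W \<and> (\<forall>y\<in>W \<inter> L. f y = f x)"
    using assms(2) by (intro exI[of _ W]) auto
qed

lemma degree_locally_constant_on:
  assumes c: "relative_cycle K c" and K: "closedin S K"
  shows "locally_constant K (\<lambda>x. h (degree x c))"
  unfolding locally_constant_def
proof
  fix x assume x: "x \<in> K"
  have "relative_cycle {x} c" "x \<in> topspace S"
    using relative_cycle_mono[OF c, of "{x}"] x closedin_subset[OF K] by auto
  then obtain W where W: "openin S W" "x \<in> W" "relative_cycle W c" "\<And>y. y \<in> W \<Longrightarrow> degree y c = degree x c"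
    using degree_locally_constant by metis
  have "\<forall>y\<in>W \<inter> K. h (degree y c) = h (degree x c)"
  proof
    fix y assume "y \<in> W \<inter> K"
    then show "h (degree y c) = h (degree x c)" by (intro arg_cong[of _ _ h] W(4)) simp
  qed
  then show "\<exists>W. openin S W \<and> x \<in> W \<and> (\<forall>y\<in>W \<inter> K. h (degree y c) = h (degree x c))"
    using W(1,2) by blast
qed

text \<open>Two properties of a compact set \<open>K\<close>, each of which passes to unions. The first is
  surjectivity of \<open>H\<^sub>2(S, S - K)\<close> onto the locally constant functions on \<open>K\<close> that vanish on
  the boundary; for a closed surface \<open>K = S\<close> this contains the existence of the fundamental class. The
  second says that \<open>H\<^sub>1(S, S - K)\<close> is torsion-free.\<close>

definition degrees_realizable :: "'a set \<Rightarrow> bool" where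
  "degrees_realizable K \<longleftrightarrow> (\<forall>f. locally_constant K f \<longrightarrow> (\<forall>x\<in>K \<inter> surface_boundary S A. f x = 0) \<longrightarrow>
     (\<exists>b. relative_cycle K b \<and> (\<forall>x\<in>K. degree x b = f x)))"

definition relatively_null :: "'a set \<Rightarrow> 'a chain \<Rightarrow> bool" where
  "relatively_null K z \<longleftrightarrow> (\<exists>b. singular_chain 2 S b \<and> chain_in 1 S (- K) (chain_boundary 2 b - z))"

definition torsion_free_at :: "'a set \<Rightarrow> bool" where
  "torsion_free_at K \<longleftrightarrow> (\<forall>z n. n > 0 \<longrightarrow> singular_chain 1 S z \<longrightarrow> chain_in 0 S (- K) (chain_boundary 1 z) \<longrightarrow>
     relatively_null K (frag_cmul n z) \<longrightarrow> relatively_null K z)"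

lemma degrees_realizable_Un:
  assumes U: "positive U \<phi>" and r: "ball c r \<inter> halfplane \<subseteq> \<phi> ` U"
    and K: "closedin S K" "closedin S K'" "K' \<subseteq> preimage U \<phi> (ball c r)"
    and E: "degrees_realizable K" "degrees_realizable K'"
  shows "degrees_realizable (K \<union> K')"
  unfolding degrees_realizable_def
proof (intro allI impI)
  fix f :: "'a \<Rightarrow> int"
  assume f: "locally_constant (K \<union> K') f"
    and f0: "\<forall>x\<in>(K \<union> K') \<inter> surface_boundary S A. f x = 0"
  have KS: "K \<subseteq> topspace S" "K' \<subseteq> topspace S" using K closedin_subset by auto
  have "locally_constant K f" using locally_constant_subset[OF f] by simp
  then obtain b where b: "relative_cycle K b" "\<forall>x\<in>K. degree x b = f x"
    using E(1) f0 unfolding degrees_realizable_def by blast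
  have "locally_constant K' f" using locally_constant_subset[OF f] by simp
  then obtain b' where b': "relative_cycle K' b'" "\<forall>x\<in>K'. degree x b' = f x"
    using E(2) f0 unfolding degrees_realizable_def by blast
  have rel: "relative_cycle {x} a" if "relative_cycle M a" "x \<in> M" for M a x
    using relative_cycle_mono[OF that(1)] that(2) by simp
  have deg: "degree x (b - b') = 0" if "x \<in> K \<inter> K'" for x
    using degree_diff[of x b b'] rel b b' KS that by auto
  have bc: "singular_chain 2 S b" "chain_in 1 S (- K) (chain_boundary 2 b - 0)"
    and bc': "singular_chain 2 S b'" "chain_in 1 S (- K') (chain_boundary 2 b' - 0)"
    using b(1) b'(1) by (simp_all add: relative_cycle_def)
  obtain s s' w where s: "chain_in 2 S (- K) s" "chain_in 2 S (- K') s'" "singular_chain 3 S w"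
    "b - s = b' + s' + chain_boundary 3 w" "chain_in 1 S (- (K \<union> K')) (chain_boundary 2 (b - s) - 0)"
    by (rule glue[OF U r K bc bc' deg])
  have null: "relative_cycle {x} a" "degree x a = 0"
    if "chain_in 2 S (- M) a" "x \<in> M" "x \<in> topspace S" for M a x
  proof -
    have a: "chain_in 2 S (- {x}) a" using that by (auto elim!: singular_chain_mono)
    then show "degree x a = 0" using degree_eq_0 that(3) by blast
    show "relative_cycle {x} a" using a singular_chain_boundary[OF a]
      by (auto simp: relative_cycle_def intro: chain_in_imp_chain)
  qed
  have sc: "relative_cycle (K \<union> K') (b - s)"
    using s(5) b(1) chain_in_imp_chain[OF s(1)] by (simp add: relative_cycle_def singular_chain_diff)
  have "degree x (b - s) = f x" if "x \<in> K \<union> K'" for x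
  proof (cases "x \<in> K")
    case True
    then show ?thesis using degree_diff[of x b s] rel[OF b(1)] null[OF s(1)] b(2) KS by auto
  next
    case False
    then have x: "x \<in> K'" "x \<in> topspace S" using that KS by auto
    have "relative_cycle {x} (chain_boundary 3 w)"
      using chain_boundary_boundary[OF s(3)] singular_chain_boundary[OF s(3)] by (simp add: relative_cycle_def)
    then show ?thesis unfolding s(4)
      using degree_add[OF x(2)] rel[OF b'(1) x(1)] null[OF s(2) x] b'(2) x degree_of_boundary[OF x(2) s(3)]
      by (simp add: relative_cycle_add)
  qed
  then show "\<exists>b. relative_cycle (K \<union> K') b \<and> (\<forall>x\<in>K \<union> K'. degree x b = f x)" using sc by blast
qed

lemma degree_div_realizable:
  assumes E: "degrees_realizable K" and K: "closedin S K" and c: "relative_cycle K c"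
  obtains b where "relative_cycle K b" "\<And>x. x \<in> K \<Longrightarrow> degree x b = degree x c div n"
proof -
  have KS: "K \<subseteq> topspace S" using K closedin_subset by auto
  have "locally_constant K (\<lambda>x. degree x c div n)" by (rule degree_locally_constant_on[OF c K])
  moreover have "degree x c div n = 0" if "x \<in> K \<inter> surface_boundary S A" for x
    using degree_boundary_point[of x c] relative_cycle_mono[OF c, of "{x}"] that by simp
  ultimately have "\<exists>b. relative_cycle K b \<and> (\<forall>x\<in>K. degree x b = degree x c div n)"
    using E[unfolded degrees_realizable_def, rule_format, of "\<lambda>x. degree x c div n"] by blast
  then show thesis using that by blast
qed

text \<open>If \<open>n z\<close> bounds and \<open>z = \<partial> b\<close> rel \<open>S - K\<close>, \<open>z = \<partial> b'\<close> rel \<open>S - K'\<close>, then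
  \<open>deg (b - b')\<close> is the difference of two functions that, after multiplication by \<open>n\<close>, extend over
  \<open>K\<close> and over \<open>K'\<close>. Integer division by \<open>n\<close> makes the functions themselves extend.\<close>

lemma torsion_free_at_Un:
  assumes U: "positive U \<phi>" and r: "ball c r \<inter> halfplane \<subseteq> \<phi> ` U"
    and K: "closedin S K" "closedin S K'" "K' \<subseteq> preimage U \<phi> (ball c r)"
    and E: "degrees_realizable K" "degrees_realizable K'" and T: "torsion_free_at K" "torsion_free_at K'"
  shows "torsion_free_at (K \<union> K')"
  unfolding torsion_free_at_def
proof (intro allI impI)
  fix z and n :: int
  assume n: "n > 0" and z: "singular_chain 1 S z" "chain_in 0 S (- (K \<union> K')) (chain_boundary 1 z)"
    and nz: "relatively_null (K \<union> K') (frag_cmul n z)"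
  have KS: "K \<subseteq> topspace S" "K' \<subseteq> topspace S" using K closedin_subset by auto
  obtain B where B: "singular_chain 2 S B" "chain_in 1 S (- (K \<union> K')) (chain_boundary 2 B - frag_cmul n z)"
    using nz by (auto simp: relatively_null_def)
  have *: "\<exists>b a. singular_chain 2 S b \<and> chain_in 1 S (- M) (chain_boundary 2 b - z) \<and> relative_cycle M a \<and>
      (\<forall>x\<in>M. degree x a = degree x (frag_cmul n b - B) div n) \<and> relative_cycle M (frag_cmul n b - B)"
    if M: "M \<subseteq> K \<union> K'" "closedin S M" "degrees_realizable M" "torsion_free_at M" for M
  proof -
    have sub: "- (K \<union> K') \<subseteq> - M" using M(1) by blast
    have BM: "chain_in 1 S (- M) (chain_boundary 2 B - frag_cmul n z)" by (rule singular_chain_mono[OF B(2) sub])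
    then have "relatively_null M (frag_cmul n z)" using B(1) by (auto simp: relatively_null_def)
    then have "relatively_null M z"
      using M(4) n z(1) singular_chain_mono[OF z(2) sub] by (simp add: torsion_free_at_def)
    then obtain b where b: "singular_chain 2 S b" "chain_in 1 S (- M) (chain_boundary 2 b - z)"
      by (auto simp: relatively_null_def)
    have "chain_boundary 2 (frag_cmul n b - B) = frag_cmul n (chain_boundary 2 b - z) - (chain_boundary 2 B - frag_cmul n z)"
      by (simp add: chain_boundary_diff chain_boundary_cmul frag_cmul_diff_right)
    then have rel: "relative_cycle M (frag_cmul n b - B)"
      using b B(1) BM by (simp add: relative_cycle_def singular_chain_diff singular_chain_cmul)
    obtain a where "relative_cycle M a" "\<And>x. x \<in> M \<Longrightarrow> degree x a = degree x (frag_cmul n b - B) div n"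
      using degree_div_realizable[OF M(3,2) rel, of n] by blast
    then show ?thesis using b rel by blast
  qed
  obtain b a where b: "singular_chain 2 S b" "chain_in 1 S (- K) (chain_boundary 2 b - z)"
    and a: "relative_cycle K a" "\<And>x. x \<in> K \<Longrightarrow> degree x a = degree x (frag_cmul n b - B) div n"
    and ba: "relative_cycle K (frag_cmul n b - B)"
    using *[of K] K E T by blast
  obtain b' a' where b': "singular_chain 2 S b'" "chain_in 1 S (- K') (chain_boundary 2 b' - z)"
    and a': "relative_cycle K' a'" "\<And>x. x \<in> K' \<Longrightarrow> degree x a' = degree x (frag_cmul n b' - B) div n"
    and ba': "relative_cycle K' (frag_cmul n b' - B)"
    using *[of K'] K E T by blast
  have 1: "singular_chain 2 S (b - a)" "singular_chain 2 S (b' - a')"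
    using b(1) b'(1) a(1) a'(1) by (simp_all add: relative_cycle_def singular_chain_diff)
  have sub: "chain_boundary 2 (v - w) - z = (chain_boundary 2 v - z) - chain_boundary 2 w" for v w
    by (simp add: chain_boundary_diff)
  have 2: "chain_in 1 S (- K) (chain_boundary 2 (b - a) - z)" "chain_in 1 S (- K') (chain_boundary 2 (b' - a') - z)"
    unfolding sub using b(2) b'(2) a(1) a'(1) by (simp_all add: relative_cycle_def singular_chain_diff)
  have deg: "degree x ((b - a) - (b' - a')) = 0" if x: "x \<in> K \<inter> K'" for x
  proof -
    have xS: "x \<in> topspace S" using x KS by auto
    have rel: "relative_cycle {x} v" if "relative_cycle M v" "x \<in> M" for M v
      using relative_cycle_mono[OF that(1)] that(2) by simp
    have eq: "chain_boundary 2 (b - b') = (chain_boundary 2 b - z) - (chain_boundary 2 b' - z)"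
      by (simp add: chain_boundary_diff)
    have "chain_in 1 S (- {x}) (chain_boundary 2 b - z)"
      by (rule singular_chain_mono[OF b(2)]) (use x in auto)
    moreover have "chain_in 1 S (- {x}) (chain_boundary 2 b' - z)"
      by (rule singular_chain_mono[OF b'(2)]) (use x in auto)
    ultimately have bb: "relative_cycle {x} (b - b')"
      unfolding relative_cycle_def eq using singular_chain_diff b(1) b'(1) by blast
    have "(frag_cmul n b - B) - (frag_cmul n b' - B) = frag_cmul n (b - b')" by (simp add: frag_cmul_diff_right)
    then have "degree x (frag_cmul n b - B) - degree x (frag_cmul n b' - B) = n * degree x (b - b')"
      using degree_diff[OF xS, of "frag_cmul n b - B" "frag_cmul n b' - B"] degree_cmul[OF xS bb, of n]
        rel[OF ba] rel[OF ba'] x by simp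
    then have "degree x (frag_cmul n b - B) = degree x (frag_cmul n b' - B) + n * degree x (b - b')" by simp
    then have "degree x a - degree x a' = degree x (b - b')"
      using a(2) a'(2) x n by simp
    moreover have eq3: "(b - a) - (b' - a') = (b - b') - (a - a')" by simp
    moreover have "relative_cycle {x} a" "relative_cycle {x} a'" using rel[OF a(1)] rel[OF a'(1)] x by auto
    ultimately show ?thesis unfolding eq3
      using degree_diff[OF xS bb, of "a - a'"] degree_diff[OF xS, of a a'] relative_cycle_diff by simp
  qed
  obtain s s' w where s: "chain_in 2 S (- K) s" "chain_in 2 S (- K') s'" "singular_chain 3 S w"
    "b - a - s = b' - a' + s' + chain_boundary 3 w"
    "chain_in 1 S (- (K \<union> K')) (chain_boundary 2 (b - a - s) - z)"
    by (rule glue[OF U r K 1(1) 2(1) 1(2) 2(2) deg])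
  then show "relatively_null (K \<union> K') z"
    using 1(1) chain_in_imp_chain[OF s(1)] unfolding relatively_null_def by (blast intro: singular_chain_diff)
qed

subsection \<open>Small closed discs\<close>

text \<open>Both properties hold for small discs and half-discs. These are connected, so that only constant functions
  have to be realized, and only the function 0 on a half-disc, which meets the boundary.\<close>

lemma disc_properties:
  assumes U: "(U, \<phi>) \<in> A" and r: "0 < \<rho>" "\<rho> < r" "ball c r \<inter> halfplane \<subseteq> \<phi> ` U" "0 \<le> Im c"
    and c: "Im c = 0 \<or> ball c r \<subseteq> halfplane"
  defines "K \<equiv> preimage U \<phi> (cball c \<rho> \<inter> halfplane)"
  shows "closedin S K" "K \<subseteq> preimage U \<phi> (ball c r)" "degrees_realizable K" "torsion_free_at K"
proof -
  let ?D = "preimage U \<phi> (ball c r)" and ?C = "cball c \<rho> \<inter> halfplane"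
  have P: "positive U \<phi>" using U by (rule positive_atlas)
  have Cb: "?C \<subseteq> ball c r \<inter> halfplane" using r(2) by auto
  have C: "compact ?C" "?C \<subseteq> \<phi> ` U" "convex ?C"
    using Cb r(3) by (auto intro!: compact_Int_closed closed_halfspace_Im_ge convex_Int convex_halfspace_Im_ge)
  have imK: "\<phi> ` K = ?C" using image_preimage[OF P, of ?C] C(2) by (simp add: K_def Int_assoc)
  have imD: "\<phi> ` ?D = ball c r \<inter> halfplane" using image_preimage[OF P r(3)] .
  have DU: "?D \<subseteq> U" and KU: "K \<subseteq> U" by (auto simp: preimage_def K_def)
  have D: "openin S ?D" by (rule openin_preimage[OF P]) simp
  show K: "closedin S K" unfolding K_def by (rule compactin_preimage(2)[OF P C(1,2)])
  show KD: "K \<subseteq> ?D" using Cb by (auto simp: preimage_def K_def)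
  have DK: "\<phi> ` (?D - K) = (ball c r - cball c \<rho>) \<inter> halfplane"
  proof -
    have "\<phi> ` (?D - K) = \<phi> ` ?D - \<phi> ` K"
      by (rule inj_on_image_set_diff[OF positive_inj[OF P]]) (use DU KU in auto)
    then show ?thesis unfolding imD imK by blast
  qed
  have D_half: "?D = preimage U \<phi> (ball c r \<inter> halfplane)"
    using positive_halfplane[OF P] by (auto simp: preimage_def)
  have conv: "convex (ball c r \<inter> halfplane)" by (intro convex_Int convex_ball convex_halfspace_Im_ge)
  show "degrees_realizable K"
    unfolding degrees_realizable_def
  proof (intro allI impI)
    fix f :: "'a \<Rightarrow> int"
    assume f: "locally_constant K f"
      and f0: "\<forall>x\<in>K \<inter> surface_boundary S A. f x = 0"
    have "connectedin (top_of_set (\<phi> ` U)) ?C"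
      using C convex_connected by (simp add: connectedin_subtopology)
    then have "connectedin (subtopology S U) (inv_into U \<phi> ` ?C)"
      by (rule connectedin_continuous_map_image[OF positive_inverse[OF P]])
    moreover have "inv_into U \<phi> ` ?C = K"
      using inv_into_image_cancel[OF positive_inj[OF P] KU] imK by simp
    ultimately have Kc: "connectedin S K" by (simp add: connectedin_subtopology)
    have KS: "K \<subseteq> topspace S" using K closedin_subset by blast
    have "continuous_map (subtopology S K) (discrete_topology UNIV) f"
      unfolding continuous_map_def
    proof (intro conjI allI impI)
      fix T :: "int set"
      show "openin (subtopology S K) {x \<in> topspace (subtopology S K). f x \<in> T}"
      proof (subst openin_subopen, clarify)
        fix x assume x: "x \<in> topspace (subtopology S K)" "f x \<in> T"
        then have "x \<in> K" by auto
        then obtain W where W: "openin S W" "x \<in> W" "\<forall>y\<in>W \<inter> K. f y = f x"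
          using f unfolding locally_constant_def by blast
        have "openin (subtopology S K) (W \<inter> K)" using W(1) by (rule openin_subtopology_Int)
        moreover have "W \<inter> K \<subseteq> {x \<in> topspace (subtopology S K). f x \<in> T}"
          using x(2) W(3) KS by auto
        ultimately show "\<exists>V. openin (subtopology S K) V \<and> x \<in> V \<and> V \<subseteq> {x \<in> topspace (subtopology S K). f x \<in> T}"
          using W(2) \<open>x \<in> K\<close> by blast
      qed
    qed auto
    moreover have "connectedin (subtopology S K) K" using Kc by (simp add: connectedin_subtopology)
    ultimately have "connectedin (discrete_topology UNIV) (f ` K)" by (rule connectedin_continuous_map_image)
    then obtain k where k: "f ` K \<subseteq> {k}" unfolding connectedin_discrete_topology by blast
    show "\<exists>b. relative_cycle K b \<and> (\<forall>x\<in>K. degree x b = f x)"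
    proof (cases "Im c = 0")
      case True
      then have "c \<in> ?C" using r(1) by simp
      then obtain x where x: "x \<in> K" "\<phi> x = c" unfolding imK[symmetric] by blast
      then have "x \<in> surface_boundary S A" using U KU KS True by (auto simp: surface_boundary_def)
      then have "f x = 0" using f0 x(1) by blast
      then have "\<forall>x\<in>K. f x = 0" using k x(1) by (auto simp: image_subset_iff)
      moreover have "degree x 0 = 0" if "x \<in> K" for x using degree_eq_0[of x 0] that KS by auto
      ultimately show ?thesis by (intro exI[of _ 0]) (auto simp: relative_cycle_def)
    next
      case False
      then have bH: "ball c r \<subseteq> halfplane" using c by blast
      define s where "s = (\<rho> + r) / 2"
      have s: "\<rho> < s" "s < r" "0 < s" using r(1,2) by (auto simp: s_def)
      let ?c = "frag_of (path_simplex (circlepath c s))"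
      let ?R = "ball c r - cball c \<rho>"
      have "path_image (circlepath c s) \<subseteq> ?R" using s by (auto simp: dist_norm norm_minus_commute)
      then have "pathin (top_of_set ?R) (circlepath c s)"
        by (auto simp: pathin_canon_iff path_image_def simp flip: image_subset_iff_funcset)
      then have circ: "chain_in 1 euclidean ?R ?c" by (simp only: singular_chain_of singular_simplex_path_simplex)
      have circ0: "chain_boundary 1 ?c = 0"
        unfolding boundary_path_simplex using pathstart_circlepath[of c s] pathfinish_circlepath[of c s]
        by (simp add: pathstart_def pathfinish_def)
      obtain y where y: "chain_in 2 euclidean (ball c r) y" "chain_boundary 2 y = ?c"
        using convex_cycle_is_boundary[of "ball c r" 1 ?c] circ0 singular_chain_mono[OF circ, of "ball c r"]
        by (auto simp: numeral_2_eq_2)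
      let ?g = "inv_into U \<phi>"
      have im: "ball c r = \<phi> ` ?D" "?R = \<phi> ` (?D - K)" using imD DK bH by auto
      let ?b = "chain_map 2 ?g y"
      have b: "chain_in 2 S ?D ?b"
        by (rule chain_map_positive_inverse[OF P DU]) (use y im in simp)
      have bb: "chain_boundary 2 ?b = chain_map 1 ?g ?c"
        using chain_boundary_chain_map[OF y(1), of ?g] y(2) by simp
      have cR: "chain_in 1 euclidean (\<phi> ` (?D - K)) ?c" using circ im(2) by simp
      have "chain_in 1 S (?D - K) (chain_map 1 ?g ?c)"
        by (rule chain_map_positive_inverse[OF P _ cR]) (use DU in auto)
      then have bK: "chain_in 1 S (- K) (chain_boundary 2 ?b)"
        unfolding bb by (rule singular_chain_mono) auto
      then have rel: "relative_cycle K ?b" using chain_in_imp_chain[OF b] by (simp add: relative_cycle_def)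
      have "degree x (frag_cmul k ?b) = f x" if x: "x \<in> K" for x
      proof -
        have "\<phi> x \<in> cball c \<rho>" using x by (simp add: K_def preimage_def)
        have "chain_map 1 \<phi> (chain_map 1 ?g ?c) = chain_map 1 (\<phi> \<circ> ?g) ?c" by (simp only: chain_map_compose o_apply)
        also have "\<dots> = ?c"
          by (rule chain_map_id_gen[OF cR]) (use DU in \<open>auto simp: f_inv_into_f\<close>)
        finally have "chart_winding \<phi> ?b x = winding_number (circlepath c s) (\<phi> x)"
          unfolding chart_winding_def bb by simp
        also have "\<dots> = 1"
          using \<open>\<phi> x \<in> cball c \<rho>\<close> s by (intro winding_number_circlepath) (simp add: dist_norm norm_minus_commute)
        finally have "degree x ?b = 1"
          using degree_chart[OF P _ singular_chain_mono[OF b DU] singular_chain_mono[OF bK], of x] x KU by auto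
        then show ?thesis
          using degree_cmul[of x ?b k] relative_cycle_mono[OF rel, of "{x}"] x KS k by (auto simp: image_subset_iff)
      qed
      then show ?thesis using relative_cycle_cmul[OF rel] by blast
    qed
  qed
  have ann: "path_connected ((ball c r - cball c \<rho>) \<inter> halfplane)"
  proof -
    have eq: "ball c r - cball c \<rho> = {z. \<rho> < norm (z - c) \<and> norm (z - c) < r}"
      by (auto simp: dist_norm norm_minus_commute)
    have pc: "path_connected (ball c r - cball c \<rho>)" unfolding eq by (rule path_connected_annulus) simp
    show ?thesis
    proof (cases "Im c = 0")
      case True
      have n: "norm (fold_halfplane z - c) = norm (z - c)" for z
        using True by (simp add: cmod_def power2_eq_square)
      have "fold_halfplane ` (ball c r - cball c \<rho>) = (ball c r - cball c \<rho>) \<inter> halfplane"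
        unfolding eq using n fold_halfplane_id by (force simp: image_iff)
      then show ?thesis using path_connected_continuous_image[OF continuous_on_fold_halfplane pc] by simp
    next
      case False
      then have "ball c r - cball c \<rho> \<subseteq> halfplane" using c by blast
      then show ?thesis using pc by (simp add: Int_absorb2)
    qed
  qed
  have pcDK: "path_connectedin S (?D - K)"
  proof -
    have "path_connectedin (top_of_set (\<phi> ` U)) (\<phi> ` (?D - K))"
      unfolding path_connectedin_subtopology using ann DK DU by auto
    then have "path_connectedin (subtopology S U) (inv_into U \<phi> ` \<phi> ` (?D - K))"
      by (rule path_connectedin_continuous_map_image[OF positive_inverse[OF P]])
    moreover have "inv_into U \<phi> ` \<phi> ` (?D - K) = ?D - K"
      by (rule inv_into_image_cancel[OF positive_inj[OF P]]) (use DU in auto)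
    ultimately show ?thesis by (simp add: path_connectedin_subtopology)
  qed
  show "torsion_free_at K" unfolding torsion_free_at_def
  proof (intro allI impI)
    fix z assume z: "singular_chain 1 S z" "chain_in 0 S (- K) (chain_boundary 1 z)"
    obtain z1 z2 d where d: "chain_in 1 S ?D z1" "chain_in 1 S (- K) z2" "singular_chain 2 S d"
      "z = z1 + z2 + chain_boundary 2 d" "chain_in 0 S (- K) (chain_boundary 1 z1)"
      using chain_split_closed[OF D K KD, of 1 z] z by (auto simp: numeral_2_eq_2)
    have "chain_in 0 S (?D \<inter> - K) (chain_boundary 1 z1)"
      using chain_in_Int[OF _ d(5), of ?D] singular_chain_boundary[OF d(1)] by simp
    then have "chain_in 0 S (?D - K) (chain_boundary 1 z1)" by (simp add: Diff_eq)
    then obtain y where y: "chain_in 1 S (?D - K) y" "chain_boundary 1 y = chain_boundary 1 z1"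
      using path_connected_fill_boundary[OF pcDK chain_in_imp_chain[OF d(1)]] by blast
    have "chain_in 1 S (preimage U \<phi> (ball c r \<inter> halfplane)) (z1 - y)"
      unfolding D_half[symmetric] using d(1) singular_chain_mono[OF y(1), of ?D] by (auto intro: singular_chain_diff)
    then obtain e where e: "chain_in 2 S (preimage U \<phi> (ball c r \<inter> halfplane)) e" "chain_boundary 2 e = z1 - y"
      using disc_cycle_is_boundary[OF P conv r(3), of 1 "z1 - y"] y(2)
      by (auto simp: chain_boundary_diff numeral_2_eq_2)
    have "chain_boundary 2 (e + d) - z = - (y + z2)"
      unfolding chain_boundary_add e(2) d(4) by simp
    moreover have "chain_in 1 S (- K) (y + z2)"
      by (rule singular_chain_add[OF singular_chain_mono[OF y(1)] d(2)]) auto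
    ultimately have "chain_in 1 S (- K) (chain_boundary 2 (e + d) - z)" by (simp only: singular_chain_minus)
    moreover have "singular_chain 2 S (e + d)" using chain_in_imp_chain[OF e(1)] d(3) by (rule singular_chain_add)
    ultimately show "relatively_null K z" unfolding relatively_null_def by blast
  qed
qed

definition disc_piece :: "'a set \<Rightarrow> bool" where
  "disc_piece K \<longleftrightarrow> closedin S K \<and> degrees_realizable K \<and> torsion_free_at K \<and>
     (\<exists>U \<phi> c r. positive U \<phi> \<and> ball c r \<inter> halfplane \<subseteq> \<phi> ` U \<and> K \<subseteq> preimage U \<phi> (ball c r))"

lemma closed_disc_cover: "\<exists>F. finite F \<and> \<Union>F = topspace S \<and> (\<forall>K\<in>F. disc_piece K)"
proof -
  have "\<exists>K V. openin S V \<and> x \<in> V \<and> V \<subseteq> K \<and> disc_piece K" if x: "x \<in> topspace S" for x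
  proof -
    obtain U \<phi> where U: "(U, \<phi>) \<in> A" "x \<in> U" using atlas_chart_at[OF x] by blast
    have P: "positive U \<phi>" using U(1) by (rule positive_atlas)
    have Im: "0 \<le> Im (\<phi> x)" using positive_halfplane[OF P] U(2) by auto
    obtain r0 where r0: "r0 > 0" "ball (\<phi> x) r0 \<inter> halfplane \<subseteq> \<phi> ` U"
      by (rule small_discs[OF P positive_openin[OF P] U(2) subset_refl])
    define r where "r = (if Im (\<phi> x) = 0 then r0 else min r0 (Im (\<phi> x)))"
    have r: "r > 0" "r \<le> r0" using r0(1) Im by (auto simp: r_def)
    have rH: "Im (\<phi> x) = 0 \<or> ball (\<phi> x) r \<subseteq> halfplane"
    proof (rule disjCI)
      assume n: "\<not> ball (\<phi> x) r \<subseteq> halfplane"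
      show "Im (\<phi> x) = 0"
      proof (rule ccontr)
        assume "Im (\<phi> x) \<noteq> 0"
        then have "r \<le> Im (\<phi> x)" by (simp add: r_def)
        then have "z \<in> halfplane" if "z \<in> ball (\<phi> x) r" for z
          using that abs_Im_le_cmod[of "\<phi> x - z"] by (auto simp: dist_norm)
        then show False using n by blast
      qed
    qed
    have rU: "ball (\<phi> x) r \<inter> halfplane \<subseteq> \<phi> ` U"
    proof -
      have "ball (\<phi> x) r \<subseteq> ball (\<phi> x) r0" using r(2) by (rule subset_ball)
      then show ?thesis using r0(2) by blast
    qed
    let ?K = "preimage U \<phi> (cball (\<phi> x) (r / 2) \<inter> halfplane)"
    let ?V = "preimage U \<phi> (ball (\<phi> x) (r / 2))"
    note K = disc_properties[OF U(1) _ _ rU Im rH, of "r / 2"]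
    have "disc_piece ?K" unfolding disc_piece_def using K r(1) P rU by auto
    moreover have "openin S ?V" by (rule openin_preimage[OF P]) simp
    moreover have "x \<in> ?V" using U(2) r(1) by (simp add: preimage_def)
    moreover have "?V \<subseteq> ?K" using positive_halfplane[OF P] by (auto simp: preimage_def)
    ultimately show ?thesis by blast
  qed
  then obtain K V where KV: "\<And>x. x \<in> topspace S \<Longrightarrow> openin S (V x) \<and> x \<in> V x \<and> V x \<subseteq> K x \<and> disc_piece (K x)"
    by metis
  have "(\<forall>W \<in> V ` topspace S. openin S W) \<and> topspace S \<subseteq> \<Union> (V ` topspace S)" using KV by blast
  then obtain F where F: "finite F" "F \<subseteq> V ` topspace S" "topspace S \<subseteq> \<Union> F"
    using compact unfolding compact_space_alt by meson
  obtain X where X: "finite X" "X \<subseteq> topspace S" "F = V ` X" using finite_subset_image[OF F(1,2)] by blast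
  have piece: "disc_piece M" if "M \<in> K ` X" for M using that KV X(2) by blast
  then have "M \<subseteq> topspace S" if "M \<in> K ` X" for M
    using that closedin_subset unfolding disc_piece_def by blast
  moreover have "topspace S \<subseteq> \<Union> (K ` X)" using F(3) KV X by blast
  ultimately have "\<Union> (K ` X) = topspace S" by blast
  then show ?thesis using X(1) piece by (intro exI[of _ "K ` X"]) simp
qed

text \<open>The surface is a finite union of small discs, so that the two properties extend piece by piece to
  \<open>K = S\<close>, where \<open>H\<^sub>1(S, S - K) = H\<^sub>1(S)\<close>.\<close>

theorem H1_torsion_free:
  assumes n: "n > 0" and z: "singular_chain 1 S z" "chain_boundary 1 z = 0"
    and nz: "singular_relboundary 1 S {} (frag_cmul n z)"
  shows "singular_relboundary 1 S {} z"
proof -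
  obtain F where F: "finite F" "\<Union>F = topspace S" "\<forall>K\<in>F. disc_piece K"
    using closed_disc_cover by blast
  have "closedin S (\<Union>F) \<and> degrees_realizable (\<Union>F) \<and> torsion_free_at (\<Union>F)"
    using F(1,3)
  proof (induction F rule: finite_induct)
    case empty
    have "relatively_null {} z" if "singular_chain 1 S z" for z
      using that unfolding relatively_null_def by (intro exI[of _ 0]) (simp add: singular_chain_minus)
    moreover have "relative_cycle {} 0" by (simp add: relative_cycle_def)
    ultimately show ?case by (auto simp: degrees_realizable_def torsion_free_at_def)
  next
    case (insert K F)
    let ?M = "\<Union>F"
    have M: "closedin S ?M" "degrees_realizable ?M" "torsion_free_at ?M" and K: "disc_piece K"
      using insert by auto
    from K obtain U \<phi> c r where U: "positive U \<phi>" "ball c r \<inter> halfplane \<subseteq> \<phi> ` U" "K \<subseteq> preimage U \<phi> (ball c r)"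
      unfolding disc_piece_def by blast
    have eq: "\<Union> (insert K F) = ?M \<union> K" by auto
    have K': "closedin S K" "degrees_realizable K" "torsion_free_at K" using K by (auto simp: disc_piece_def)
    show ?case unfolding eq
      using degrees_realizable_Un[OF U(1,2) M(1) _ U(3) M(2)] torsion_free_at_Un[OF U(1,2) M(1) _ U(3) M(2) _ M(3)] K' closedin_Un[OF M(1) K'(1)]
      by simp
  qed
  then have T: "torsion_free_at (topspace S)" using F(2) by simp
  have empty: "subtopology S (- topspace S) = subtopology S {}"
    using subtopology_restrict[of S "- topspace S"] by simp
  have null: "relatively_null (topspace S) a \<longleftrightarrow> singular_relboundary 1 S {} a" for a
    unfolding relatively_null_def singular_boundary empty
    by (auto simp: singular_chain_empty numeral_2_eq_2)
  show ?thesis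
    using T n z nz unfolding torsion_free_at_def null empty by (simp add: singular_chain_empty)
qed

end

section \<open>Arcs in the plane\<close>

lemma interior_arc_empty:
  fixes h :: "real \<Rightarrow> complex"
  assumes "arc h" shows "interior (path_image h) = {}"
proof -
  obtain g where g: "homeomorphism {0..1} (path_image h) h g"
    using homeomorphism_arc[OF assms] by blast
  let ?B = "interior (path_image h)" and ?f = "\<lambda>z. complex_of_real (g z)"
  have sub: "?B \<subseteq> path_image h" by (rule interior_subset)
  have "continuous_on ?B ?f"
    using g sub unfolding homeomorphism_def by (intro continuous_intros) (auto elim: continuous_on_subset)
  moreover have "inj_on g (path_image h)"
    using g unfolding homeomorphism_def by (metis inj_on_inverseI)
  then have "inj_on ?f ?B" using sub by (auto simp: inj_on_def)
  ultimately have "open (?f ` ?B)" by (intro invariance_of_domain) auto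
  then have "?f ` ?B \<subseteq> interior \<real>" by (intro interior_maximal) auto
  also have "interior (\<real> :: complex set) = {}"
  proof -
    have "\<not> ball z e \<subseteq> \<real>" if "e > 0" for z :: complex and e
    proof
      assume "ball z e \<subseteq> \<real>"
      moreover have "z \<in> ball z e" "z + \<i> * of_real (e / 2) \<in> ball z e" using that by (auto simp: dist_norm norm_mult)
      ultimately have "z \<in> \<real>" "z + \<i> * of_real (e / 2) \<in> \<real>" by blast+
      then have "Im z = 0" "Im (z + \<i> * of_real (e / 2)) = 0" unfolding complex_is_Real_iff by blast+
      then show False using that by simp
    qed
    then show ?thesis by (auto simp: mem_interior)
  qed
  finally show ?thesis by simp
qed

text \<open>Accessible points are dense on an arc: a point of the arc that is nearest to a given
  point of the complement is reached by the straight segment.\<close>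

lemma arc_accessible_point:
  fixes h :: "real \<Rightarrow> complex"
  assumes h: "arc h" and im: "path_image h \<subseteq> W" "open W" and ab: "0 \<le> \<alpha>" "\<alpha> < \<beta>" "\<beta> \<le> 1"
  obtains \<sigma> x where "\<alpha> < \<sigma>" "\<sigma> < \<beta>" "x \<in> W - path_image h" "closed_segment x (h \<sigma>) \<subseteq> W"
    "closed_segment x (h \<sigma>) \<inter> path_image h = {h \<sigma>}"
proof -
  define m where "m = (\<alpha> + \<beta>) / 2"
  have m: "\<alpha> < m" "m < \<beta>" "m \<in> {0..1}" using ab by (auto simp: m_def)
  have ch: "continuous_on {0..1} h" and ih: "inj_on h {0..1}" using h by (auto simp: arc_def path_def)
  let ?R = "h ` ({0..\<alpha>} \<union> {\<beta>..1})"
  have "closed ?R"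
    using ab by (intro compact_imp_closed compact_continuous_image continuous_on_subset[OF ch]) auto
  moreover have "h m \<notin> ?R"
  proof
    assume "h m \<in> ?R"
    then obtain u where u: "u \<in> {0..\<alpha>} \<union> {\<beta>..1}" "h m = h u" by blast
    then have "m = u" using inj_onD[OF ih u(2) m(3)] ab by auto
    then show False using u(1) m by auto
  qed
  ultimately have "open (W - ?R)" "h m \<in> W - ?R" using im m(3) by (auto simp: path_image_def)
  then obtain e where e: "e > 0" "ball (h m) e \<subseteq> W - ?R" using open_contains_ball by blast
  have "\<not> ball (h m) (e / 2) \<subseteq> path_image h"
    using interior_maximal[of "ball (h m) (e / 2)" "path_image h"] interior_arc_empty[OF h] e(1) by auto
  then obtain x where "x \<in> ball (h m) (e / 2)" and x2: "x \<notin> path_image h" by blast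
  then have x: "dist (h m) x < e / 2" "x \<notin> path_image h" by auto
  have "closed (path_image h)" using h by (simp add: arc_imp_path closed_path_image)
  moreover have "path_image h \<noteq> {}" by simp
  ultimately obtain y where y: "y \<in> path_image h" "\<And>z. z \<in> path_image h \<Longrightarrow> dist x y \<le> dist x z"
    using distance_attains_inf by blast
  then obtain \<sigma> where s: "\<sigma> \<in> {0..1}" "y = h \<sigma>" by (auto simp: path_image_def)
  have "h m \<in> path_image h" using m(3) by (auto simp: path_image_def)
  then have xy: "dist x y < e / 2" using y(2)[of "h m"] x(1) by (simp add: dist_commute)
  have seg: "closed_segment x y \<subseteq> ball (h m) e"
  proof (rule closed_segment_subset)
    show "x \<in> ball (h m) e" using x(1) e(1) by auto
    show "y \<in> ball (h m) e" using x(1) xy dist_triangle[of "h m" y x] by auto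
  qed auto
  have "y \<notin> ?R" using seg e(2) by auto
  then have "\<alpha> < \<sigma>" "\<sigma> < \<beta>" using s by auto
  moreover have "closed_segment x y \<inter> path_image h = {y}"
  proof
    show "closed_segment x y \<inter> path_image h \<subseteq> {y}"
    proof
      fix z assume z: "z \<in> closed_segment x y \<inter> path_image h"
      then have "dist x y = dist x z + dist z y" by (metis IntD1 between between_mem_segment)
      moreover have "dist x y \<le> dist x z" using z y(2) by blast
      ultimately show "z \<in> {y}" by simp
    qed
  qed (use y(1) in auto)
  moreover have "x \<in> W" using seg e(2) by auto
  moreover have "closed_segment x y \<subseteq> W" using seg e(2) by blast
  ultimately show thesis using that x(2) s(2) by blast
qed

text \<open>Around every interior point, an arc in a disc can be closed up to a simple closed curve in
  the disc.\<close>

lemma arc_bypass: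
  fixes h :: "real \<Rightarrow> complex"
  assumes h: "arc h" and im: "path_image h \<subseteq> ball c r" and \<tau>: "0 < \<tau>" "\<tau> < 1"
  obtains s t \<gamma> where "0 < s" "s < \<tau>" "\<tau> < t" "t < 1" "arc \<gamma>" "path_image \<gamma> \<subseteq> ball c r"
    "pathstart \<gamma> = h s" "pathfinish \<gamma> = h t" "path_image \<gamma> \<inter> h ` {s..t} = {h s, h t}"
proof -
  let ?B = "ball c r"
  obtain s x where s: "0 < s" "s < \<tau>" "x \<in> ?B - path_image h" "closed_segment x (h s) \<subseteq> ?B"
    "closed_segment x (h s) \<inter> path_image h = {h s}"
    by (rule arc_accessible_point[OF h im, of 0 \<tau>]) (use \<tau> in auto)
  obtain t y where t: "\<tau> < t" "t < 1" "y \<in> ?B - path_image h" "closed_segment y (h t) \<subseteq> ?B"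
    "closed_segment y (h t) \<inter> path_image h = {h t}"
    by (rule arc_accessible_point[OF h im, of \<tau> 1]) (use \<tau> in auto)
  have r: "r > 0" using s(3) by (auto simp: ball_def dist_norm) (smt (verit) norm_ge_zero)
  obtain F G where FG: "homeomorphism ?B (UNIV :: complex set) F G"
    using homeomorphic_ball_UNIV[OF r, of c] by (auto simp: homeomorphic_def)
  have inv: "G (F z) = z" if "z \<in> ?B" for z using FG that by (simp add: homeomorphism_def)
  have "arc (F \<circ> h)"
  proof -
    have "continuous_on (path_image h) F" using FG im by (auto simp: homeomorphism_def elim: continuous_on_subset)
    moreover have "inj_on F (h ` {0..1})" using inv im by (metis inj_on_inverseI subsetD path_image_def)
    ultimately show ?thesis using h by (auto simp: arc_def path_continuous_image comp_inj_on)
  qed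
  then have "path_connected (- path_image (F \<circ> h))" by (rule path_connected_arc_complement) simp
  moreover have "continuous_on (- path_image (F \<circ> h)) G"
    using FG by (auto simp: homeomorphism_def elim: continuous_on_subset)
  ultimately have "path_connected (G ` (- path_image (F \<circ> h)))" by (rule path_connected_continuous_image[rotated])
  moreover have "G ` (- path_image (F \<circ> h)) = ?B - path_image h"
  proof
    show "G ` (- path_image (F \<circ> h)) \<subseteq> ?B - path_image h"
      using FG by (force simp: homeomorphism_def path_image_compose image_iff)
    show "?B - path_image h \<subseteq> G ` (- path_image (F \<circ> h))"
    proof
      fix z assume z: "z \<in> ?B - path_image h"
      have "F z \<notin> path_image (F \<circ> h)"
      proof
        assume "F z \<in> path_image (F \<circ> h)"
        then obtain w where "w \<in> path_image h" "F z = F w" by (auto simp: path_image_compose)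
        then show False using inv[of z] inv[of w] z im by auto
      qed
      then show "z \<in> G ` (- path_image (F \<circ> h))" using inv[of z] z by (metis ComplI DiffD1 image_eqI)
    qed
  qed
  ultimately obtain \<rho> where \<rho>: "path \<rho>" "path_image \<rho> \<subseteq> ?B - path_image h" "pathstart \<rho> = x" "pathfinish \<rho> = y"
    using s(3) t(3) unfolding path_connected_def by metis
  let ?p = "linepath (h s) x +++ \<rho> +++ linepath y (h t)"
  have p: "path ?p" "pathstart ?p = h s" "pathfinish ?p = h t" using \<rho> by auto
  have "path_image ?p = closed_segment (h s) x \<union> path_image \<rho> \<union> closed_segment y (h t)"
    using \<rho> by (simp add: path_image_join Un_assoc)
  then have pB: "path_image ?p \<subseteq> ?B" and ph: "path_image ?p \<inter> path_image h \<subseteq> {h s, h t}"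
    using s(4,5) t(4,5) \<rho>(2) closed_segment_commute[of "h s" x] by auto
  have st: "s < t" "s \<in> {0..1}" "t \<in> {0..1}" using s t by auto
  moreover have "inj_on h {0..1}" using h by (simp add: arc_def)
  ultimately have "h s \<noteq> h t" using inj_onD[of h "{0..1}" s t] by auto
  then obtain \<gamma> where \<gamma>: "arc \<gamma>" "path_image \<gamma> \<subseteq> path_image ?p" "pathstart \<gamma> = h s" "pathfinish \<gamma> = h t"
    using path_contains_arc[OF p] by blast
  have "path_image \<gamma> \<inter> h ` {s..t} \<subseteq> {h s, h t}"
  proof -
    have "h ` {s..t} \<subseteq> path_image h" using st by (auto simp: path_image_def)
    then show ?thesis using \<gamma>(2) ph by blast
  qed
  moreover have "h s \<in> path_image \<gamma>" "h t \<in> path_image \<gamma>"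
    using \<gamma>(3,4) pathstart_in_path_image[of \<gamma>] pathfinish_in_path_image[of \<gamma>] by auto
  ultimately have "path_image \<gamma> \<inter> h ` {s..t} = {h s, h t}" using st by auto
  then show thesis using that s(1,2) t(1,2) \<gamma> pB by blast
qed

section \<open>The two sides of an edge\<close>

locale surface_network = surface S A for S :: "'a topology" and A :: "'a chart set" +
  fixes N :: "('a, 'e) network"
  assumes network: "oriented_network S A N"
begin

abbreviation trace :: "'e \<Rightarrow> 'a set" where
  "trace e \<equiv> curve N e ` {0..1}"

abbreviation traces :: "'a set" where
  "traces \<equiv> \<Union> (trace ` edges N)"

lemma finite_edges: "finite (edges N)"
  using network by (simp add: oriented_network_def)

lemma arc_or_loop: "e \<in> edges N \<Longrightarrow> arc_edge S A N e \<or> loop_edge S A N e"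
  using network by (simp add: oriented_network_def)

lemma pathin_curve: "e \<in> edges N \<Longrightarrow> pathin S (curve N e)"
  using arc_or_loop by (auto simp: arc_edge_def loop_edge_def)

lemma closedin_curve_image:
  assumes e: "e \<in> edges N" and I: "I \<subseteq> {0..1}" "compact I"
  shows "closedin S (curve N e ` I)"
proof -
  have "compactin (top_of_set {0..1}) I" using I by (simp add: compactin_subtopology)
  then have "compactin S (curve N e ` I)"
    using image_compactin pathin_curve[OF e] unfolding pathin_def by blast
  then show ?thesis using Hausdorff compactin_imp_closedin by blast
qed

lemma closedin_trace: "e \<in> edges N \<Longrightarrow> closedin S (trace e)"
  by (rule closedin_curve_image) auto

lemma closedin_traces: "E \<subseteq> edges N \<Longrightarrow> closedin S (\<Union> (trace ` E))"
  using closedin_trace finite_edges by (intro closedin_Union) (auto intro: finite_subset)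

lemma arc_edge_facts:
  assumes "arc_edge S A N e"
  shows arc_edge_inj: "inj_on (curve N e) {0<..<1}"
    and arc_edge_ends: "tail N e \<in> verts N" "head N e \<in> verts N"
    and arc_edge_interior: "\<And>t. 0 < t \<Longrightarrow> t < 1 \<Longrightarrow> curve N e t \<notin> verts N \<and> curve N e t \<notin> surface_boundary S A"
    and arc_edge_disjoint: "\<And>t e'. 0 < t \<Longrightarrow> t < 1 \<Longrightarrow> e' \<in> edges N \<Longrightarrow> e' \<noteq> e \<Longrightarrow> curve N e t \<notin> trace e'"
  using assms unfolding arc_edge_def by (auto simp: disjoint_iff)

lemma arc_edge_eq:
  assumes e: "arc_edge S A N e" and t: "0 < t" "t < 1" "0 \<le> u" "u \<le> 1" "curve N e u = curve N e t"
  shows "u = t"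
proof (cases "0 < u \<and> u < 1")
  case True
  then show ?thesis using arc_edge_inj[OF e] t by (auto simp: inj_on_def)
next
  case False
  then have "u = 0 \<or> u = 1" using t by auto
  then have "curve N e u \<in> verts N" using arc_edge_ends[OF e] by auto
  then show ?thesis using arc_edge_interior[OF e t(1,2)] t(5) by simp
qed

end

text \<open>A relation \<open>\<partial> B = \<Sum> a\<^sub>e e\<close> between the edges, with a two-chain \<open>B\<close>. The degree of \<open>B\<close> is then a
  function on the complement of the network, and it jumps by \<open>a\<^sub>e\<close> across the edge \<open>e\<close>.\<close>

locale null_homologous_edges = surface_network S A N
  for S :: "'a topology" and A :: "'a chart set" and N :: "('a, 'e) network" +
  fixes a :: "'e \<Rightarrow> int" and B :: "'a chain"
  assumes B: "singular_chain 2 S B"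
    and boundary_B: "chain_boundary 2 B = (\<Sum>e\<in>edges N. frag_cmul (a e) (frag_of (path_simplex (curve N e))))"
begin

lemma edge_chain:
  assumes "e \<in> edges N" shows "chain_in 1 S (trace e) (frag_of (path_simplex (curve N e)))"
  unfolding singular_chain_of singular_simplex_subtopology image_path_simplex
  using singular_simplex_path_simplex[OF pathin_curve[OF assms]] by blast

lemma relative_cycle_B:
  assumes "\<And>e. e \<in> edges N \<Longrightarrow> a e \<noteq> 0 \<Longrightarrow> K \<inter> trace e = {}"
  shows "relative_cycle K B"
  unfolding relative_cycle_def boundary_B
proof (intro conjI B singular_chain_sum)
  fix e assume e: "e \<in> edges N"
  show "chain_in 1 S (- K) (frag_cmul (a e) (frag_of (path_simplex (curve N e))))"
  proof (cases "a e = 0")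
    case False
    then have "trace e \<subseteq> - K" using assms[OF e] by blast
    then show ?thesis using singular_chain_mono[OF edge_chain[OF e]] by (intro singular_chain_cmul)
  qed simp
qed

text \<open>Replacing a piece of an edge inside a chart by a path \<open>\<gamma>\<close> changes \<open>B\<close> by a chain in the
  chart, whose degree is a winding number. The degree of the modified chain is constant near
  the removed piece.\<close>

lemma degree_near_edge:
  assumes e: "e \<in> edges N" "arc_edge S A N e" and st: "0 < s" "s < t" "t < 1"
    and U: "positive U \<phi>" and W: "ball c r \<inter> halfplane \<subseteq> \<phi> ` U"
    and eW: "curve N e ` {s..t} \<subseteq> preimage U \<phi> (ball c r)"
    and \<gamma>: "path \<gamma>" "path_image \<gamma> \<subseteq> ball c r \<inter> halfplane" "pathstart \<gamma> = \<phi> (curve N e s)"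
      "pathfinish \<gamma> = \<phi> (curve N e t)" "\<And>\<tau>. s < \<tau> \<Longrightarrow> \<tau> < t \<Longrightarrow> \<phi> (curve N e \<tau>) \<notin> path_image \<gamma>"
  obtains k where "\<And>\<tau>. s < \<tau> \<Longrightarrow> \<tau> < t \<Longrightarrow> \<exists>V. openin S V \<and> curve N e \<tau> \<in> V \<and> V \<subseteq> preimage U \<phi> (ball c r) \<and>
     V \<inter> traces \<subseteq> curve N e ` {s<..<t} \<and> (\<forall>x\<in>V. \<phi> x \<notin> path_image \<gamma>) \<and>
     (\<forall>x\<in>V - traces. of_int (degree x B) = of_int k + of_int (a e) *
        (winding_number (\<lambda>u. \<phi> (curve N e (s + (t - s) * u))) (\<phi> x) - winding_number \<gamma> (\<phi> x)))"
proof -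
  let ?g = "curve N e" and ?\<psi> = "inv_into U \<phi>"
  let ?sub = "\<lambda>u v. frag_of (subarc_simplex ?g u v)"
  let ?D = "preimage U \<phi> (ball c r)"
  let ?J = "\<lambda>u. ?g (s + (t - s) * u)" and ?G = "?\<psi> \<circ> \<gamma>"
  have DU: "?D \<subseteq> U" by (rule preimage_subset)
  have imD: "\<phi> ` ?D = ball c r \<inter> halfplane" by (rule image_preimage[OF U W])
  have g: "pathin S ?g" using pathin_curve e(1) .
  have Jpar: "(\<lambda>u. s + (t - s) * u) ` {0..1} = {s..t}"
  proof -
    have "(\<lambda>u. (t - s) * u + s) ` {0..1} = {s..t}"
      using image_affinity_atLeastAtMost[of "t - s" s 0 1] st by simp
    then show ?thesis by (simp add: add.commute)
  qed
  have Jim: "?J ` {0..1} = ?g ` {s..t}" unfolding Jpar[symmetric] by (simp add: image_image)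
  have subarc: "chain_in 1 S (?g ` {u..v}) (?sub u v)" if uv: "0 \<le> u" "u \<le> v" "v \<le> 1" for u v
  proof -
    have sub: "(\<lambda>w. u + (v - u) * w) ` {0..1} \<subseteq> {u..v}"
    proof
      fix y assume "y \<in> (\<lambda>w. u + (v - u) * w) ` {0..1}"
      then obtain w where w: "0 \<le> w" "w \<le> 1" "y = u + (v - u) * w" by auto
      then have "(v - u) * w \<le> v - u" "0 \<le> (v - u) * w" using uv by (auto intro: mult_left_le)
      then show "y \<in> {u..v}" using w(3) by auto
    qed
    have "continuous_map (top_of_set {0..1}) (top_of_set {0..1}) (\<lambda>w. u + (v - u) * w)"
      using sub uv by (force simp: continuous_map_in_subtopology intro!: continuous_intros)
    from continuous_map_compose[OF this g[unfolded pathin_def]]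
    have "pathin S (\<lambda>w. ?g (u + (v - u) * w))" by (simp add: pathin_def o_def)
    then have "singular_simplex 1 S (subarc_simplex ?g u v)"
      unfolding subarc_simplex_def by (rule singular_simplex_path_simplex)
    moreover have "(\<lambda>w. ?g (u + (v - u) * w)) ` {0..1} \<subseteq> ?g ` {u..v}" using sub by auto
    ultimately show ?thesis
      by (simp only: singular_chain_of singular_simplex_subtopology subarc_simplex_def image_path_simplex)
  qed
  obtain T1 where T1: "chain_in 2 S (trace e) T1" "chain_boundary 2 T1 = ?sub 0 s + ?sub s 1 - ?sub 0 1"
    by (rule subarc_simplex_split[OF g, of 0 s 1]) (use st in auto)
  obtain T2 where T2: "chain_in 2 S (trace e) T2" "chain_boundary 2 T2 = ?sub s t + ?sub t 1 - ?sub s 1"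
    by (rule subarc_simplex_split[OF g, of s t 1]) (use st in auto)
  have whole: "subarc_simplex ?g 0 1 = path_simplex ?g" by (simp add: subarc_simplex_def)
  have \<gamma>D: "path_image \<gamma> \<subseteq> \<phi> ` ?D" using \<gamma>(2) imD by simp
  have Gchain: "chain_in 1 S (?\<psi> ` path_image \<gamma>) (frag_of (path_simplex ?G))"
    and GD: "chain_in 1 S ?D (frag_of (path_simplex ?G))"
  proof -
    have "continuous_map (top_of_set {0..1}) (top_of_set (\<phi> ` U)) \<gamma>"
      using \<gamma>(1) \<gamma>D DU by (auto simp: path_def path_image_def continuous_map_in_subtopology)
    from continuous_map_compose[OF this positive_inverse[OF U]]
    have "pathin S ?G" by (simp add: pathin_def continuous_map_in_subtopology)
    then have s1: "singular_simplex 1 S (path_simplex ?G)" by (rule singular_simplex_path_simplex)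
    have im: "?G ` {0..1} = ?\<psi> ` path_image \<gamma>" by (simp add: path_image_def image_comp)
    show "chain_in 1 S (?\<psi> ` path_image \<gamma>) (frag_of (path_simplex ?G))"
      using s1 im by (simp only: singular_chain_of singular_simplex_subtopology image_path_simplex subset_refl simp_thms)
    moreover have "?\<psi> ` path_image \<gamma> \<subseteq> ?D"
      using \<gamma>D positive_inj[OF U] DU by (force simp: subset_iff image_iff)
    ultimately show "chain_in 1 S ?D (frag_of (path_simplex ?G))" by (rule singular_chain_mono)
  qed
  have \<psi>\<phi>: "?\<psi> (\<phi> x) = x" if "x \<in> U" for x using positive_inj[OF U] that by simp
  have in_st: "?g \<tau> \<in> ?D" if "\<tau> \<in> {s..t}" for \<tau> using eW that by blast
  have D_half: "?D = preimage U \<phi> (ball c r \<inter> halfplane)"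
    using positive_halfplane[OF U] by (auto simp: preimage_def)
  have JD: "chain_in 1 S ?D (?sub s t)"
    by (rule singular_chain_mono[OF subarc]) (use st eW in auto)
  have "chain_boundary 1 (?sub s t - frag_of (path_simplex ?G)) = 0"
    unfolding subarc_simplex_def chain_boundary_diff boundary_path_simplex
    using \<gamma>(3,4) \<psi>\<phi> in_st DU st by (auto simp: pathstart_def pathfinish_def subset_iff)
  moreover have "chain_in 1 S (preimage U \<phi> (ball c r \<inter> halfplane)) (?sub s t - frag_of (path_simplex ?G))"
    unfolding D_half[symmetric] using JD GD by (rule singular_chain_diff)
  ultimately obtain F where F: "chain_in 2 S ?D F" "chain_boundary 2 F = ?sub s t - frag_of (path_simplex ?G)"
    using disc_cycle_is_boundary[OF U _ W, of 1 "?sub s t - frag_of (path_simplex ?G)"] D_half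
    by (auto simp: convex_Int convex_halfspace_Im_ge numeral_2_eq_2)
  let ?M = "?g ` {s<..<t}"
  define T where "T = T1 + T2 - F"
  define B' where "B' = B + frag_cmul (a e) T"
  have Tb: "chain_boundary 2 T = ?sub 0 s + ?sub t 1 + frag_of (path_simplex ?G) - frag_of (path_simplex ?g)"
    unfolding T_def chain_boundary_diff chain_boundary_add T1(2) T2(2) F(2) whole by (simp add: algebra_simps)
  have M_disj: "?M \<inter> trace e' = {}" if "e' \<in> edges N" "e' \<noteq> e" for e'
  proof -
    have "curve N e \<tau> \<notin> trace e'" if "\<tau> \<in> {s<..<t}" for \<tau>
      using arc_edge_disjoint[OF e(2) _ _ \<open>e' \<in> edges N\<close> \<open>e' \<noteq> e\<close>, of \<tau>] that st by simp
    then show ?thesis by blast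
  qed
  have M_sub: "?M \<inter> ?g ` {0..s} = {}" "?M \<inter> ?g ` {t..1} = {}"
  proof -
    have inj: "\<tau> = u" if "\<tau> \<in> {s<..<t}" "0 \<le> u" "u \<le> 1" "?g \<tau> = ?g u" for \<tau> u
      using arc_edge_eq[OF e(2), of \<tau> u] that st by simp
    have "?g \<tau> \<noteq> ?g u" if \<tau>: "\<tau> \<in> {s<..<t}" and u: "u \<in> {0..s} \<union> {t..1}" for \<tau> u
    proof
      assume "?g \<tau> = ?g u"
      moreover have "0 \<le> u" "u \<le> 1" using u st by auto
      ultimately have "\<tau> = u" using inj[OF \<tau>] by blast
      then show False using \<tau> u by auto
    qed
    then have "?M \<inter> ?g ` ({0..s} \<union> {t..1}) = {}" by blast
    then show "?M \<inter> ?g ` {0..s} = {}" "?M \<inter> ?g ` {t..1} = {}" by blast+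
  qed
  have M\<gamma>: "?M \<inter> ?\<psi> ` path_image \<gamma> = {}"
  proof -
    have "False" if "s < \<tau>" "\<tau> < t" "?g \<tau> = ?\<psi> p" "p \<in> path_image \<gamma>" for \<tau> p
    proof -
      have "\<phi> (?g \<tau>) = p" using that(3,4) \<gamma>D DU by (auto simp: f_inv_into_f subset_iff)
      then show False using \<gamma>(5)[OF that(1,2)] that(4) by simp
    qed
    then show ?thesis by auto
  qed
  have B': "relative_cycle ?M B'"
    unfolding relative_cycle_def
  proof
    have "singular_chain 2 S T" unfolding T_def
      using T1(1) T2(1) F(1) by (intro singular_chain_diff singular_chain_add) (auto intro: chain_in_imp_chain)
    then show "singular_chain 2 S B'" unfolding B'_def by (intro singular_chain_add singular_chain_cmul B)
    have "(\<Sum>e'\<in>edges N. frag_cmul (a e') (frag_of (path_simplex (curve N e')))) =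
        frag_cmul (a e) (frag_of (path_simplex ?g)) + (\<Sum>e'\<in>edges N - {e}. frag_cmul (a e') (frag_of (path_simplex (curve N e'))))"
      using e(1) finite_edges by (rule sum.remove[rotated])
    then have eq: "chain_boundary 2 B' = (\<Sum>e'\<in>edges N - {e}. frag_cmul (a e') (frag_of (path_simplex (curve N e'))))
        + frag_cmul (a e) (?sub 0 s + ?sub t 1 + frag_of (path_simplex ?G))"
      unfolding B'_def chain_boundary_add chain_boundary_cmul boundary_B Tb frag_cmul_diff_right by simp
    have other: "chain_in 1 S (- ?M) (frag_of (path_simplex (curve N e')))" if "e' \<in> edges N - {e}" for e'
      by (rule singular_chain_mono[OF edge_chain]) (use that M_disj[of e'] in auto)
    have "chain_in 1 S (- ?M) (?sub 0 s)" by (rule singular_chain_mono[OF subarc]) (use st M_sub in auto)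
    moreover have "chain_in 1 S (- ?M) (?sub t 1)" by (rule singular_chain_mono[OF subarc]) (use st M_sub in auto)
    moreover have "chain_in 1 S (- ?M) (frag_of (path_simplex ?G))"
      by (rule singular_chain_mono[OF Gchain]) (use M\<gamma> in auto)
    ultimately show "chain_in 1 S (- ?M) (chain_boundary 2 B')" unfolding eq
      using other by (intro singular_chain_add singular_chain_sum singular_chain_cmul) auto
  qed
  have conn: "connectedin S ?M"
  proof -
    have "connectedin (top_of_set {0..1}) {s<..<t}"
      using st by (auto simp: connectedin_subtopology)
    then show ?thesis using connectedin_continuous_map_image g unfolding pathin_def by blast
  qed
  define m where "m = (s + t) / 2"
  have m: "s < m" "m < t" using st by (auto simp: m_def)
  define k where "k = degree (?g m) B'"
  show thesis
  proof (rule that[of k])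
    fix \<tau> assume \<tau>: "s < \<tau>" "\<tau> < t"
    let ?x = "?g \<tau>"
    have xM: "?x \<in> ?M" using \<tau> by auto
    have xS: "?x \<in> topspace S" using conn xM connectedin_subset_topspace by blast
    have kx: "degree ?x B' = k" unfolding k_def
      by (rule degree_constant[OF conn B' xM]) (use m in auto)
    obtain V0 where V0: "openin S V0" "?x \<in> V0" "relative_cycle V0 B'" "\<And>y. y \<in> V0 \<Longrightarrow> degree y B' = degree ?x B'"
      using degree_locally_constant[OF relative_cycle_mono[OF B'] xS] xM by auto
    let ?Z = "\<Union> (trace ` (edges N - {e})) \<union> ?g ` {0..s} \<union> ?g ` {t..1} \<union> ?\<psi> ` path_image \<gamma>"
    have "closedin S (?\<psi> ` path_image \<gamma>)"
    proof -
      have "compactin (top_of_set (\<phi> ` U)) (path_image \<gamma>)"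
        using compact_path_image[OF \<gamma>(1)] \<gamma>D DU by (auto simp: compactin_subtopology)
      then have "compactin (subtopology S U) (?\<psi> ` path_image \<gamma>)"
        using image_compactin positive_inverse[OF U] by blast
      then show ?thesis using Hausdorff compactin_imp_closedin by (auto simp: compactin_subtopology)
    qed
    then have Z: "closedin S ?Z"
      using st closedin_traces[of "edges N - {e}"] closedin_curve_image[OF e(1), of "{0..s}"] closedin_curve_image[OF e(1), of "{t..1}"]
      by (intro closedin_Un) auto
    let ?V = "(V0 \<inter> ?D) - ?Z"
    have D: "openin S ?D" by (rule openin_preimage[OF U]) simp
    have Vo: "openin S ?V" using V0(1) D Z by blast
    have xV: "?x \<in> ?V"
      using V0(2) in_st[of \<tau>] \<tau> xM M_disj M_sub M\<gamma> by (simp add: disjoint_iff)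
    have VM: "?V \<inter> traces \<subseteq> ?M"
    proof
      fix y assume y: "y \<in> ?V \<inter> traces"
      then obtain e' u where u: "e' \<in> edges N" "u \<in> {0..1}" "y = curve N e' u" by blast
      have "e' = e" using y u by blast
      then have "u \<notin> {0..s}" "u \<notin> {t..1}" using y u by blast+
      then show "y \<in> ?M" using u \<open>e' = e\<close> by auto
    qed
    have V\<gamma>: "\<phi> x \<notin> path_image \<gamma>" if x: "x \<in> ?V" for x
    proof
      assume "\<phi> x \<in> path_image \<gamma>"
      moreover have "?\<psi> (\<phi> x) = x" using x DU \<psi>\<phi> by blast
      ultimately have "x \<in> ?\<psi> ` path_image \<gamma>" by force
      then show False using x by blast
    qed
    have VB: "of_int (degree x B) = of_int k + of_int (a e) *
        (winding_number (\<lambda>u. \<phi> (?g (s + (t - s) * u))) (\<phi> x) - winding_number \<gamma> (\<phi> x))" if x: "x \<in> ?V - traces" for x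
    proof -
      have xD: "x \<in> ?D" "x \<in> U" and xT: "x \<notin> traces" using x DU by auto
      have xS: "x \<in> topspace S" using xD D openin_subset by blast
      have xB: "relative_cycle {x} B" by (rule relative_cycle_B) (use xT in auto)
      have T12: "chain_in 2 S (- {x}) (T1 + T2)"
        using T1(1) T2(1) xT e(1) by (auto intro!: singular_chain_add elim!: singular_chain_mono)
      then have T0: "degree x (T1 + T2) = 0" by (rule degree_eq_0[OF xS])
      have T12c: "relative_cycle {x} (T1 + T2)" using T12 singular_chain_boundary[OF T12]
        by (auto simp: relative_cycle_def intro: chain_in_imp_chain)
      have "chain_in 1 S (- {x}) (?sub s t)"
        by (rule singular_chain_mono[OF subarc]) (use st xT e(1) in auto)
      moreover have "x \<notin> ?\<psi> ` path_image \<gamma>" using x by blast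
      then have "chain_in 1 S (- {x}) (frag_of (path_simplex ?G))" by (intro singular_chain_mono[OF Gchain]) auto
      ultimately have Fb: "chain_in 1 S (- {x}) (chain_boundary 2 F)" unfolding F(2) by (rule singular_chain_diff)
      have Fc: "relative_cycle {x} F" using Fb chain_in_imp_chain[OF F(1)] by (simp add: relative_cycle_def)
      have "of_int (degree x F) = chart_winding \<phi> F x"
        using degree_chart[OF U xD(2) singular_chain_mono[OF F(1) DU] Fb] by simp
      also have "\<dots> = winding_number (\<phi> \<circ> ?J) (\<phi> x) - winding_number (\<phi> \<circ> ?G) (\<phi> x)"
        unfolding chart_winding_def F(2) subarc_simplex_def chain_map_diff chain_map_of
          simplex_map_path_simplex winding_diff winding_path_simplex ..
      also have "winding_number (\<phi> \<circ> ?G) (\<phi> x) = winding_number \<gamma> (\<phi> x)"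
      proof (rule winding_number_cong)
        fix u :: real assume "0 \<le> u" "u \<le> 1"
        then have "\<gamma> u \<in> path_image \<gamma>" by (simp add: path_image_def)
        then have "\<gamma> u \<in> \<phi> ` U" using \<gamma>D DU by blast
        then show "(\<phi> \<circ> ?G) u = \<gamma> u" by (simp add: f_inv_into_f)
      qed
      also have "\<phi> \<circ> ?J = (\<lambda>u. \<phi> (?g (s + (t - s) * u)))" by (simp add: o_def)
      finally have dF: "of_int (degree x F) = winding_number (\<lambda>u. \<phi> (?g (s + (t - s) * u))) (\<phi> x) - winding_number \<gamma> (\<phi> x)" .
      have "degree x B' = k" using V0(4)[of x] x kx by auto
      moreover have "degree x B' = degree x B + a e * (degree x (T1 + T2) - degree x F)"
        unfolding B'_def T_def
        using degree_add[OF xS xB relative_cycle_cmul[OF relative_cycle_diff[OF T12c Fc]], of "a e"]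
          degree_cmul[OF xS relative_cycle_diff[OF T12c Fc], of "a e"] degree_diff[OF xS T12c Fc] by simp
      ultimately have "degree x B = k + a e * degree x F" using T0 by simp
      then show ?thesis by (simp add: dF[symmetric])
    qed
    have VD: "?V \<subseteq> ?D" by blast
    show "\<exists>V. openin S V \<and> ?x \<in> V \<and> V \<subseteq> ?D \<and> V \<inter> traces \<subseteq> ?M \<and> (\<forall>x\<in>V. \<phi> x \<notin> path_image \<gamma>) \<and>
     (\<forall>x\<in>V - traces. of_int (degree x B) = of_int k + of_int (a e) *
        (winding_number (\<lambda>u. \<phi> (?g (s + (t - s) * u))) (\<phi> x) - winding_number \<gamma> (\<phi> x)))"
      by (intro exI[of _ ?V] conjI ballI Vo xV VD VM V\<gamma> VB)
  qed
qed

end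

context null_homologous_edges
begin

text \<open>On an edge the degree of \<open>B\<close> is undefined, because \<open>\<partial> B\<close> passes there; what remains are the values
  that it takes arbitrarily close by.\<close>

definition limit_degrees :: "'a \<Rightarrow> int set" where
  "limit_degrees x = {k. \<forall>V. openin S V \<longrightarrow> x \<in> V \<longrightarrow> (\<exists>y\<in>V - traces. degree y B = k)}"

lemma curve_near:
  assumes e: "e \<in> edges N" and V: "openin S V" "curve N e \<tau> \<in> V" "0 \<le> \<tau>" "\<tau> \<le> 1"
  obtains \<delta> where "\<delta> > 0" "\<And>u. 0 \<le> u \<Longrightarrow> u \<le> 1 \<Longrightarrow> \<bar>u - \<tau>\<bar> \<le> \<delta> \<Longrightarrow> curve N e u \<in> V"
proof -
  have "continuous_map (top_of_set {0..1}) S (curve N e)" using pathin_curve[OF e] by (simp add: pathin_def)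
  from openin_continuous_map_preimage[OF this V(1)]
  have op: "openin (top_of_set {0..1}) {u \<in> {0..1}. curve N e u \<in> V}" by simp
  have "\<tau> \<in> {u \<in> {0..1}. curve N e u \<in> V}" using V by simp
  then obtain d where d: "d > 0" "\<forall>u\<in>{0..1}. dist u \<tau> < d \<longrightarrow> u \<in> {u \<in> {0..1}. curve N e u \<in> V}"
    using op unfolding openin_euclidean_subtopology_iff by meson
  show thesis
    by (rule that[of "d / 2"]) (use d in \<open>auto simp: dist_real_def\<close>)
qed

lemma interior_disc:
  assumes U: "positive U \<phi>" and V: "openin S V" "V \<subseteq> U" "x \<in> V" and x: "0 < Im (\<phi> x)"
  obtains r where "r > 0" "ball (\<phi> x) r \<subseteq> halfplane" "ball (\<phi> x) r \<subseteq> \<phi> ` V"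
proof -
  obtain r0 where r0: "r0 > 0" "ball (\<phi> x) r0 \<inter> halfplane \<subseteq> \<phi> ` V"
    by (rule small_discs[OF U V(1,3,2)])
  define r where "r = min r0 (Im (\<phi> x))"
  have H: "ball (\<phi> x) r \<subseteq> halfplane"
  proof
    fix z assume "z \<in> ball (\<phi> x) r"
    then show "z \<in> halfplane" using abs_Im_le_cmod[of "\<phi> x - z"] by (auto simp: r_def dist_norm)
  qed
  moreover have "ball (\<phi> x) r \<subseteq> ball (\<phi> x) r0" by (rule subset_ball) (simp add: r_def)
  ultimately have "ball (\<phi> x) r \<subseteq> \<phi> ` V" using r0(2) by blast
  then show thesis using that[of r] H r0(1) x by (simp add: r_def)
qed

lemma continuous_on_chart_curve:
  assumes e: "e \<in> edges N" and U: "positive U \<phi>" and I: "I \<subseteq> {0..1}" "curve N e ` I \<subseteq> U"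
  shows "continuous_on I (\<lambda>u. \<phi> (curve N e u))"
proof -
  have "continuous_map (top_of_set {0..1}) S (curve N e)" using pathin_curve[OF e] by (simp add: pathin_def)
  then have "continuous_map (top_of_set I) (subtopology S U) (curve N e)"
    using I continuous_map_from_subtopology_mono by (fastforce simp: continuous_map_in_subtopology)
  from continuous_map_compose[OF this positive_continuous[OF U]] show ?thesis
    by (simp add: o_def continuous_map_in_subtopology)
qed

text \<open>Near an interior point of an edge the complement of the network has exactly two sides,
  namely the inside and the outside of a Jordan curve that contains the edge near the point.
  The degree takes one value on each side.\<close>

lemma limit_degrees_near:
  assumes e: "e \<in> edges N" "arc_edge S A N e" and \<tau>: "0 < \<tau>" "\<tau> < 1"
  shows "\<exists>p q s t. p - q = a e \<and> 0 < s \<and> s < \<tau> \<and> \<tau> < t \<and> t < 1 \<and>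
    (\<forall>u\<in>{s<..<t}. limit_degrees (curve N e u) = {p, q})"
proof -
  let ?g = "curve N e"
  have xS: "?g \<tau> \<in> topspace S"
    using closedin_subset[OF closedin_trace[OF e(1)]] \<tau> by (auto simp: subset_iff)
  obtain U \<phi> where UA: "(U, \<phi>) \<in> A" "?g \<tau> \<in> U" using atlas_chart_at[OF xS] by blast
  have U: "positive U \<phi>" using UA(1) by (rule positive_atlas)
  have "Im (\<phi> (?g \<tau>)) \<noteq> 0"
    using arc_edge_interior[OF e(2) \<tau>] UA xS by (auto simp: surface_boundary_def)
  then have Im: "0 < Im (\<phi> (?g \<tau>))" using positive_halfplane[OF U] UA(2) by (fastforce simp: image_subset_iff)
  define c where "c = \<phi> (?g \<tau>)"
  obtain r where r: "r > 0" "ball c r \<subseteq> halfplane" "ball c r \<subseteq> \<phi> ` U"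
    unfolding c_def by (rule interior_disc[OF U positive_openin[OF U] subset_refl UA(2) Im])
  let ?D = "preimage U \<phi> (ball c r)"
  have D: "openin S ?D" by (rule openin_preimage[OF U]) simp
  have "?g \<tau> \<in> ?D" using UA(2) r(1) by (simp add: preimage_def c_def)
  then obtain \<delta>0 where \<delta>0: "\<delta>0 > 0" "\<And>u. 0 \<le> u \<Longrightarrow> u \<le> 1 \<Longrightarrow> \<bar>u - \<tau>\<bar> \<le> \<delta>0 \<Longrightarrow> ?g u \<in> ?D"
    using curve_near[OF e(1) D] \<tau> by (metis less_eq_real_def)
  define \<delta> where "\<delta> = min \<delta>0 (min (\<tau> / 2) ((1 - \<tau>) / 2))"
  have \<delta>: "\<delta> > 0" "\<delta> \<le> \<tau> / 2" "\<delta> \<le> (1 - \<tau>) / 2" "\<delta> \<le> \<delta>0" using \<delta>0(1) \<tau> by (auto simp: \<delta>_def min_def)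
  define s0 where "s0 = \<tau> - \<delta>"
  define l where "l = 2 * \<delta>"
  have par: "0 < s0 + l * u \<and> s0 + l * u < 1 \<and> ?g (s0 + l * u) \<in> ?D" if "u \<in> {0..1}" for u
  proof -
    define w where "w = l * u"
    have w: "0 \<le> w" "w \<le> 2 * \<delta>"
      using that \<delta>(1) mult_left_le[of u "2 * \<delta>"] by (auto simp: w_def l_def)
    have "s0 + w \<le> \<tau> + \<delta>" "\<tau> - \<delta> \<le> s0 + w" using w unfolding s0_def by simp_all
    moreover have "\<tau> + \<delta> < 1" "0 < \<tau> - \<delta>" using \<delta>(2,3) \<tau> by simp_all
    ultimately have "0 < s0 + w" "s0 + w < 1" "\<bar>s0 + w - \<tau>\<bar> \<le> \<delta>0"
      using \<delta>(4) by simp_all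
    then show ?thesis using \<delta>0(2) by (simp add: w_def)
  qed
  define h where "h u = \<phi> (?g (s0 + l * u))" for u
  have inj\<phi>: "u = v" if "u \<in> {0<..<1}" "v \<in> {0<..<1}" "?g u \<in> U" "?g v \<in> U" "\<phi> (?g u) = \<phi> (?g v)" for u v
  proof -
    have "?g u = ?g v" using inj_on_eq_iff[OF positive_inj[OF U] that(3,4)] that(5) by blast
    then show ?thesis using inj_on_eq_iff[OF arc_edge_inj[OF e(2)] that(1,2)] by blast
  qed
  have l: "l > 0" using \<delta>(1) by (simp add: l_def)
  have DU: "?D \<subseteq> U" by (rule preimage_subset)
  have arc_h: "arc h"
    unfolding arc_def path_def
  proof
    have cont: "continuous_on ((\<lambda>u. s0 + l * u) ` {0..1}) (\<lambda>u. \<phi> (?g u))"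
      using par DU by (intro continuous_on_chart_curve[OF e(1) U]) (auto simp: less_imp_le)
    have "continuous_on {0..1} (\<lambda>u. s0 + l * u)" by (intro continuous_intros)
    from continuous_on_compose2[OF cont this] show "continuous_on {0..1} h" unfolding h_def by blast
    show "inj_on h {0..1}"
    proof (rule inj_onI)
      fix u v assume uv: "u \<in> {0..1}" "v \<in> {0..1}" "h u = h v"
      then have "s0 + l * u = s0 + l * v"
        using par[OF uv(1)] par[OF uv(2)] DU by (intro inj\<phi>) (auto simp: h_def)
      then show "u = v" using l by simp
    qed
  qed
  have im_h: "path_image h \<subseteq> ball c r" using par by (auto simp: path_image_def h_def preimage_def)
  obtain s' t' \<gamma> where \<gamma>: "0 < s'" "s' < 1 / 2" "1 / 2 < t'" "t' < 1" "arc \<gamma>" "path_image \<gamma> \<subseteq> ball c r"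
    "pathstart \<gamma> = h s'" "pathfinish \<gamma> = h t'" "path_image \<gamma> \<inter> h ` {s'..t'} = {h s', h t'}"
    by (rule arc_bypass[OF arc_h im_h, of "1 / 2"]) auto
  define s where "s = s0 + l * s'"
  define t where "t = s0 + l * t'"
  have st: "0 < s" "s < t" "t < 1" using par[of s'] par[of t'] \<gamma>(1-4) l by (auto simp: s_def t_def)
  have s\<tau>: "s < \<tau>" and \<tau>t: "\<tau> < t"
  proof -
    have "l * s' < l * (1 / 2)" "l * (1 / 2) < l * t'" using \<gamma>(2,3) l by (simp_all only: mult_less_cancel_left_pos)
    then show "s < \<tau>" "\<tau> < t" by (auto simp: s_def t_def s0_def l_def)
  qed
  have hpar: "\<exists>u'\<in>{s'..t'}. u = s0 + l * u'" if "u \<in> {s..t}" for u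
    using that l by (intro bexI[of _ "(u - s0) / l"]) (auto simp: s_def t_def field_simps)
  have stD: "?g u \<in> ?D" if "u \<in> {s..t}" for u
    using hpar[OF that] par \<gamma>(1,4) by force
  define J where "J u = \<phi> (?g (s + (t - s) * u))" for u
  have J_eq: "J u = h (s' + (t' - s') * u)" for u
    by (simp add: J_def h_def s_def t_def algebra_simps)
  have pathJ: "path_image J = h ` {s'..t'}"
  proof -
    have "(\<lambda>u. s' + (t' - s') * u) ` {0..1} = {s'..t'}"
      using image_affinity_atLeastAtMost[of "t' - s'" s' 0 1] \<gamma>(2,3) by (simp add: add.commute)
    then show ?thesis unfolding path_image_def J_eq[abs_def] by (metis image_image)
  qed
  have arcJ: "arc J"
  proof -
    have "arc (subpath s' t' h)" using arc_subpath_arc[OF arc_h] \<gamma>(1-4) by auto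
    moreover have "subpath s' t' h = J" by (simp add: subpath_def J_eq[abs_def] fun_eq_iff algebra_simps)
    ultimately show ?thesis by simp
  qed
  have ends: "pathstart J = h s'" "pathfinish J = h t'" by (simp_all add: pathstart_def pathfinish_def J_eq)
  have \<gamma>avoid: "\<phi> (?g u) \<notin> path_image \<gamma>" if "s < u" "u < t" for u
  proof
    assume *: "\<phi> (?g u) \<in> path_image \<gamma>"
    have "u \<in> {s..t}" using that by simp
    from hpar[OF this] obtain u' where u': "u' \<in> {s'..t'}" "u = s0 + l * u'" by blast
    then have "h u' \<in> path_image \<gamma> \<inter> h ` {s'..t'}" using * by (auto simp: h_def)
    then have "h u' = h s' \<or> h u' = h t'" using \<gamma>(9) by auto
    moreover have "inj_on h {0..1}" using arc_h by (simp add: arc_def)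
    moreover have "u' \<in> {0..1}" "s' \<in> {0..1}" "t' \<in> {0..1}" using u'(1) \<gamma>(1-4) by auto
    ultimately have "u' = s' \<or> u' = t'" using inj_on_eq_iff by metis
    then show False using u'(2) that by (auto simp: s_def t_def)
  qed
  obtain k where k: "\<And>u. s < u \<Longrightarrow> u < t \<Longrightarrow> \<exists>V. openin S V \<and> ?g u \<in> V \<and> V \<subseteq> ?D \<and>
     V \<inter> traces \<subseteq> ?g ` {s<..<t} \<and> (\<forall>x\<in>V. \<phi> x \<notin> path_image \<gamma>) \<and>
     (\<forall>x\<in>V - traces. of_int (degree x B) = of_int k + of_int (a e) *
        (winding_number (\<lambda>u. \<phi> (?g (s + (t - s) * u))) (\<phi> x) - winding_number \<gamma> (\<phi> x)))"
  proof (rule degree_near_edge[OF e st U])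
    show "ball c r \<inter> halfplane \<subseteq> \<phi> ` U" using r(3) by blast
    show "?g ` {s..t} \<subseteq> ?D" using stD by blast
    show "path \<gamma>" using \<gamma>(5) by (rule arc_imp_path)
    show "path_image \<gamma> \<subseteq> ball c r \<inter> halfplane" using \<gamma>(6) r(2) by blast
    show "pathstart \<gamma> = \<phi> (?g s)" "pathfinish \<gamma> = \<phi> (?g t)" using \<gamma>(7,8) by (simp_all add: h_def s_def t_def)
  qed (use \<gamma>avoid in auto)
  let ?C = "J +++ reversepath \<gamma>"
  have C: "simple_path ?C" "pathfinish ?C = pathstart ?C"
    using arcJ \<gamma>(5) ends \<gamma>(7-9) pathJ
    by (auto intro!: simple_path_join_loop simp: arc_reversepath)
  have imC: "path_image ?C = path_image J \<union> path_image \<gamma>"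
    using ends \<gamma>(7,8) by (subst path_image_join) auto
  have wn: "winding_number J z - winding_number \<gamma> z = winding_number ?C z" if "z \<notin> path_image ?C" for z
    using that arcJ \<gamma>(5) ends \<gamma>(7,8) unfolding imC
    by (subst winding_number_join) (auto simp: arc_imp_path winding_number_reversepath)
  have out: "winding_number ?C z = 0" if "z \<in> outside (path_image ?C)" for z
    using winding_number_zero_in_outside[OF simple_path_imp_path[OF C(1)] C(2) that] .
  obtain \<epsilon> :: int where \<epsilon>: "\<epsilon> = 1 \<or> \<epsilon> = -1" "\<And>z. z \<in> inside (path_image ?C) \<Longrightarrow> winding_number ?C z = of_int \<epsilon>"
  proof -
    show thesis
    proof (rule simple_closed_path_winding_number_inside[OF C(1)])
      assume "\<And>z. z \<in> inside (path_image ?C) \<Longrightarrow> winding_number ?C z = 1"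
      then show thesis by (intro that[of 1]) simp_all
    next
      assume "\<And>z. z \<in> inside (path_image ?C) \<Longrightarrow> winding_number ?C z = - 1"
      then show thesis by (intro that[of "-1"]) simp_all
    qed
  qed
  note Jordan = Jordan_inside_outside[OF C]
  have lim: "limit_degrees (?g u) = {k + a e * \<epsilon>, k}" if u: "s < u" "u < t" for u
  proof -
    obtain V where V: "openin S V" "?g u \<in> V" "V \<subseteq> ?D" "V \<inter> traces \<subseteq> ?g ` {s<..<t}" "\<forall>x\<in>V. \<phi> x \<notin> path_image \<gamma>"
      and VB: "\<forall>x\<in>V - traces. of_int (degree x B) = of_int k + of_int (a e) * (winding_number (\<lambda>u. \<phi> (?g (s + (t - s) * u))) (\<phi> x) - winding_number \<gamma> (\<phi> x))"
      using k[OF u] by (elim exE conjE) (rule that; assumption)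
    have V6: "of_int (degree x B) = of_int k + of_int (a e) * (winding_number J (\<phi> x) - winding_number \<gamma> (\<phi> x))"
      if "x \<in> V - traces" for x
      using VB[rule_format, OF that] unfolding J_def[abs_def] .
    have offC: "\<phi> y \<notin> path_image ?C" if y: "y \<in> V - traces" for y
    proof
      assume "\<phi> y \<in> path_image ?C"
      then have "\<phi> y \<in> h ` {s'..t'}" using V(5) y pathJ imC by blast
      then obtain u' where u': "u' \<in> {s'..t'}" "\<phi> y = h u'" by blast
      have "u' \<in> {0..1}" using u'(1) \<gamma>(1,4) by auto
      then have p: "0 < s0 + l * u'" "s0 + l * u' < 1" "?g (s0 + l * u') \<in> ?D" using par by auto
      have "y = ?g (s0 + l * u')"
      proof -
        have "y \<in> U" "?g (s0 + l * u') \<in> U" using y V(3) p(3) DU by blast+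
        then show ?thesis using inj_on_eq_iff[OF positive_inj[OF U], of y "?g (s0 + l * u')"] u'(2) by (simp add: h_def)
      qed
      then have "y \<in> trace e" using p by auto
      then show False using y e(1) by blast
    qed
    have deg: "degree y B = k + a e * \<epsilon>" if "y \<in> V - traces" "\<phi> y \<in> inside (path_image ?C)" for y
    proof -
      have "of_int (degree y B) = (of_int (k + a e * \<epsilon>) :: complex)"
        using V6[OF that(1)] wn[OF offC[OF that(1)]] \<epsilon>(2)[OF that(2)] by simp
      then show ?thesis by (simp only: of_int_eq_iff)
    qed
    have deg': "degree y B = k" if "y \<in> V - traces" "\<phi> y \<in> outside (path_image ?C)" for y
    proof -
      have "of_int (degree y B) = (of_int k :: complex)"
        using V6[OF that(1)] wn[OF offC[OF that(1)]] out[OF that(2)] by simp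
      then show ?thesis by (simp only: of_int_eq_iff)
    qed
    have gu: "?g u \<in> ?D" "?g u \<in> U" using stD[of u] u DU by auto
    have \<phi>D: "\<phi> (?g u) \<in> ball c r" using gu by (simp add: preimage_def)
    have gC: "\<phi> (?g u) \<in> path_image ?C"
      using hpar[of u] u pathJ imC by (auto simp: h_def)
    have approach: "\<exists>y\<in>V' - traces. y \<in> V \<and> \<phi> y \<in> X"
      if X: "path_image ?C \<subseteq> closure X" "X \<inter> path_image ?C = {}" and V': "openin S V'" "?g u \<in> V'" for X V'
    proof -
      have VV: "openin S (V \<inter> V')" "V \<inter> V' \<subseteq> U" "?g u \<in> V \<inter> V'"
        using V(1-3) V' DU by blast+
      have Im_u: "0 < Im (\<phi> (?g u))"
      proof -
        have "?g u \<notin> surface_boundary S A" using arc_edge_interior[OF e(2), of u] u st by simp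
        moreover have "?g u \<in> topspace S" using openin_subset[OF V(1)] V(2) by blast
        ultimately have "Im (\<phi> (?g u)) \<noteq> 0" using UA(1) gu(2) unfolding surface_boundary_def by blast
        moreover have "0 \<le> Im (\<phi> (?g u))" using \<phi>D r(2) by blast
        ultimately show ?thesis by simp
      qed
      obtain r' where r': "r' > 0" "ball (\<phi> (?g u)) r' \<subseteq> halfplane" "ball (\<phi> (?g u)) r' \<subseteq> \<phi> ` (V \<inter> V')"
        by (rule interior_disc[OF U VV Im_u])
      obtain z where z: "z \<in> X" "dist z (\<phi> (?g u)) < r'"
        using subsetD[OF X(1) gC] r'(1) unfolding closure_approachable by blast
      then have "z \<in> ball (\<phi> (?g u)) r'" by (simp add: dist_commute)
      then obtain y where y: "y \<in> V" "y \<in> V'" "z = \<phi> y" using r'(3) by blast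
      have "y \<notin> traces"
      proof
        assume "y \<in> traces"
        then obtain u2 where "u2 \<in> {s<..<t}" "y = ?g u2" using V(4) y(1) by blast
        then have "\<phi> y \<in> path_image ?C" using hpar[of u2] pathJ imC by (auto simp: h_def)
        then show False using z(1) y(3) X(2) by blast
      qed
      then show ?thesis using y z(1) by blast
    qed
    have fr: "path_image ?C \<subseteq> closure (inside (path_image ?C))" "path_image ?C \<subseteq> closure (outside (path_image ?C))"
      using Jordan unfolding frontier_def by blast+
    have disj: "inside (path_image ?C) \<inter> path_image ?C = {}" "outside (path_image ?C) \<inter> path_image ?C = {}"
      using Jordan by blast+
    show ?thesis
    proof
      show "limit_degrees (?g u) \<subseteq> {k + a e * \<epsilon>, k}"
      proof
        fix m assume "m \<in> limit_degrees (?g u)"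
        then obtain y where y: "y \<in> V - traces" "degree y B = m" using V(1,2) unfolding limit_degrees_def by blast
        have "\<phi> y \<in> inside (path_image ?C) \<or> \<phi> y \<in> outside (path_image ?C)"
          using offC[OF y(1)] Jordan by blast
        then show "m \<in> {k + a e * \<epsilon>, k}" using deg[OF y(1)] deg'[OF y(1)] y(2) by auto
      qed
      have "k + a e * \<epsilon> \<in> limit_degrees (?g u)" unfolding limit_degrees_def
        using approach[OF fr(1) disj(1)] deg by blast
      moreover have "k \<in> limit_degrees (?g u)" unfolding limit_degrees_def
        using approach[OF fr(2) disj(2)] deg' by blast
      ultimately show "{k + a e * \<epsilon>, k} \<subseteq> limit_degrees (?g u)" by blast
    qed
  qed
  show ?thesis
  proof (cases "\<epsilon> = 1")
    case True
    then show ?thesis using lim st s\<tau> \<tau>t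
      by (intro exI[of _ "k + a e"] exI[of _ k] exI[of _ s] exI[of _ t]) auto
  next
    case False
    then have "\<epsilon> = -1" using \<epsilon>(1) by blast
    then show ?thesis using lim st s\<tau> \<tau>t
      by (intro exI[of _ k] exI[of _ "k - a e"] exI[of _ s] exI[of _ t]) (auto simp: insert_commute)
  qed
qed

text \<open>The unordered pair of the two values is locally constant along the edge.\<close>

lemma edge_has_sides:
  assumes e: "e \<in> edges N" "arc_edge S A N e"
  shows "\<exists>l r. l - r = a e \<and> (\<forall>\<tau>\<in>{0<..<1}. limit_degrees (curve N e \<tau>) = {l, r})"
proof -
  let ?f = "\<lambda>\<tau>. limit_degrees (curve N e \<tau>)"
  have "?f constant_on {0<..<1}"
  proof (rule locally_constant_imp_constant)
    fix \<tau> :: real assume \<tau>: "\<tau> \<in> {0<..<1}"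
    then obtain p q s t where st: "0 < s" "s < \<tau>" "\<tau> < t" "t < 1" "\<forall>u\<in>{s<..<t}. ?f u = {p, q}"
      using limit_degrees_near[OF e, of \<tau>] unfolding greaterThanLessThan_iff by blast
    have "openin (top_of_set {0<..<1}) {s<..<t}" by (rule open_subset) (use st in auto)
    then show "\<exists>T. openin (top_of_set {0<..<1}) T \<and> \<tau> \<in> T \<and> (\<forall>u\<in>T. ?f u = ?f \<tau>)"
      using st by (intro exI[of _ "{s<..<t}"]) auto
  qed simp
  then obtain L where L: "\<forall>\<tau>\<in>{0<..<1}. ?f \<tau> = L" by (auto simp: constant_on_def)
  have "(0::real) < 1 / 2" "(1::real) / 2 < 1" by simp_all
  from limit_degrees_near[OF e this]
  obtain p q s t where pq: "p - q = a e" and st: "s < 1 / 2" "1 / 2 < t" "\<forall>u\<in>{s<..<t}. ?f u = {p, q}"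
    by blast
  have "1 / 2 \<in> {s<..<t}" using st(1,2) by simp
  then have "?f (1 / 2) = {p, q}" using st(3) by blast
  moreover have "?f (1 / 2) = L" by (rule bspec[OF L]) simp
  ultimately have "\<forall>\<tau>\<in>{0<..<1}. ?f \<tau> = {p, q}" using L by metis
  then show ?thesis using pq by (intro exI[of _ p] exI[of _ q] conjI)
qed

text \<open>The two values are told apart by their difference \<open>a\<^sub>e\<close>. That this agrees with the geometric left and
  right is needed only where the edge is straight.\<close>

definition left :: "'e \<Rightarrow> int" where
  "left e = (SOME l. \<forall>\<tau>\<in>{0<..<1}. limit_degrees (curve N e \<tau>) = {l, l - a e})"

definition right :: "'e \<Rightarrow> int" where "right e = left e - a e"

lemma left_right:
  assumes e: "e \<in> edges N" "arc_edge S A N e"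
  shows "left e - right e = a e" "0 < \<tau> \<Longrightarrow> \<tau> < 1 \<Longrightarrow> limit_degrees (curve N e \<tau>) = {left e, right e}"
proof -
  obtain l r where lr: "l - r = a e" "\<forall>\<tau>\<in>{0<..<1}. limit_degrees (curve N e \<tau>) = {l, r}"
    using edge_has_sides[OF e] by (elim exE conjE) (rule that)
  have "r = l - a e" using lr(1) by simp
  then have "\<exists>l. \<forall>\<tau>\<in>{0<..<1}. limit_degrees (curve N e \<tau>) = {l, l - a e}" using lr(2) by (intro exI[of _ l]) (simp only:)
  then have *: "\<forall>\<tau>\<in>{0<..<1}. limit_degrees (curve N e \<tau>) = {left e, left e - a e}"
    unfolding left_def by (rule someI_ex)
  show "left e - right e = a e" by (simp add: right_def)
  show "limit_degrees (curve N e \<tau>) = {left e, right e}" if "0 < \<tau>" "\<tau> < 1"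
    unfolding right_def by (rule bspec[OF *]) (use that in simp)
qed

lemma left_right_unique:
  assumes e: "e \<in> edges N" "arc_edge S A N e" and \<tau>: "0 < \<tau>" "\<tau> < 1"
    and lr: "limit_degrees (curve N e \<tau>) = {l, r}" "l - r = a e"
  shows "left e = l" "right e = r"
proof -
  have "{left e, right e} = {l, r}" using left_right(2)[OF e \<tau>] lr(1) by simp
  then show "left e = l" "right e = r" using left_right(1)[OF e] lr(2) by (auto simp: doubleton_eq_iff)
qed

end

context null_homologous_edges
begin

section \<open>The sides of the edges at a vertex\<close>

text \<open>Where an edge is a straight ray in a chart, the values on its two sides differ by \<open>a\<^sub>e\<close> with
  the sign given by the orientation: a piece of the ray is replaced by two sides of a triangle that
  lies to the left of the ray. The coordinates \<open>(z - c) / u\<close> turn the direction of travel \<open>u\<close> into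
  the positive real direction.\<close>

lemma sides_at_ray:
  fixes c u :: complex and \<epsilon> :: real
  defines "fr \<equiv> \<lambda>z. (z - c) * cnj u"
  assumes e: "e \<in> edges N" "arc_edge S A N e" and U: "positive U \<phi>" and W: "ball c \<rho> \<subseteq> \<phi> ` U"
    and u: "cmod u = 1" and \<epsilon>: "\<epsilon> = 1 \<or> \<epsilon> = -1" and st: "0 < s" "s < t" "t < 1"
    and ray: "\<And>\<sigma>. \<sigma> \<in> {s..t} \<Longrightarrow> curve N e \<sigma> \<in> preimage U \<phi> (ball c \<rho>) \<and>
      Im (fr (\<phi> (curve N e \<sigma>))) = 0 \<and> 0 < \<epsilon> * Re (fr (\<phi> (curve N e \<sigma>)))"
    and dir: "Re (fr (\<phi> (curve N e s))) < Re (fr (\<phi> (curve N e t)))"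
    and L: "\<And>x. x \<in> preimage U \<phi> (ball c \<rho>) \<Longrightarrow> 0 < \<epsilon> * Re (fr (\<phi> x)) \<Longrightarrow> 0 < Im (fr (\<phi> x)) \<Longrightarrow>
      x \<notin> traces \<and> degree x B = kl"
    and R: "\<And>x. x \<in> preimage U \<phi> (ball c \<rho>) \<Longrightarrow> 0 < \<epsilon> * Re (fr (\<phi> x)) \<Longrightarrow> Im (fr (\<phi> x)) < 0 \<Longrightarrow>
      x \<notin> traces \<and> degree x B = kr"
  shows "left e = kl" "right e = kr"
proof -
  let ?g = "curve N e" and ?D = "preimage U \<phi> (ball c \<rho>)"
  define P where "P = \<phi> (?g s)"
  define Q where "Q = \<phi> (?g t)"
  define X0 where "X0 = Re (fr P)"
  define X1 where "X1 = Re (fr Q)"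
  have uu: "u * cnj u = 1" using u complex_norm_square[of u] by simp
  have uu': "cnj u * u = 1" using uu by (simp add: mult.commute)
  have z_fr: "z = c + u * fr z" for z
  proof -
    have "u * fr z = (z - c) * (u * cnj u)" by (simp add: fr_def mult_ac)
    then show ?thesis by (simp add: uu)
  qed
  have fr_inj: "fr z = fr w \<Longrightarrow> z = w" for z w using z_fr[of z] z_fr[of w] by simp
  have fr_comb: "fr ((1 - \<theta>) *\<^sub>R z + \<theta> *\<^sub>R w) = (1 - \<theta>) *\<^sub>R fr z + \<theta> *\<^sub>R fr w" for z w \<theta>
    by (simp add: fr_def scaleR_conv_of_real algebra_simps)
  have fr_add: "fr (z + w * u) = fr z + w" for z w
  proof -
    have "fr (z + w * u) = fr z + w * (cnj u * u)" by (simp add: fr_def algebra_simps)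
    then show ?thesis by (simp add: uu')
  qed
  have ray_s: "Im (fr P) = 0" "0 < \<epsilon> * X0" "?g s \<in> ?D" and ray_t: "Im (fr Q) = 0" "0 < \<epsilon> * X1" "?g t \<in> ?D"
    using ray[of s] ray[of t] st by (auto simp: P_def Q_def X0_def X1_def)
  have X: "X0 < X1" using dir by (simp add: X0_def X1_def P_def Q_def)
  have frP: "fr P = of_real X0" and frQ: "fr Q = of_real X1"
    using ray_s(1) ray_t(1) by (simp_all add: complex_eq_iff X0_def X1_def)
  have DU: "?D \<subseteq> U" by (rule preimage_subset)
  have WH: "ball c \<rho> \<inter> halfplane \<subseteq> \<phi> ` U" using W by blast
  have BH: "ball c \<rho> \<subseteq> halfplane" using W positive_halfplane[OF U] by blast
  have PB: "P \<in> ball c \<rho>" and QB: "Q \<in> ball c \<rho>"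
    using ray_s(3) ray_t(3) by (simp_all add: preimage_def P_def Q_def)
  define m where "m = (1 - 1/2) *\<^sub>R P + (1/2) *\<^sub>R Q"
  have mB: "m \<in> ball c \<rho>"
    unfolding m_def by (rule convexD_alt[OF convex_ball PB QB]) auto
  have frm: "fr m = of_real ((X0 + X1) / 2)"
    unfolding m_def fr_comb frP frQ by (simp add: scaleR_conv_of_real field_simps)
  obtain \<eta>0 where \<eta>0: "\<eta>0 > 0" "ball m \<eta>0 \<subseteq> ball c \<rho>"
    using mB open_contains_ball[of "ball c \<rho>"] by blast
  define \<eta> where "\<eta> = \<eta>0 / 2"
  have \<eta>: "\<eta> > 0" "\<eta> < \<eta>0" using \<eta>0(1) by (simp_all add: \<eta>_def)
  define T where "T \<theta> = m + (of_real (\<theta> * \<eta>) * \<i>) * u" for \<theta> :: real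
  have frT: "fr (T \<theta>) = of_real ((X0 + X1) / 2) + of_real (\<theta> * \<eta>) * \<i>" for \<theta>
    unfolding T_def fr_add frm ..
  have distT: "dist m (T \<theta>) = \<bar>\<theta>\<bar> * \<eta>" for \<theta>
    using \<eta>(1) u by (simp add: T_def dist_norm norm_mult)
  define R0 where "R0 = T 1"
  have RB: "R0 \<in> ball c \<rho>" using \<eta>0(2) distT[of 1] \<eta> by (auto simp: R0_def)
  have frR: "fr R0 = of_real ((X0 + X1) / 2) + of_real \<eta> * \<i>" using frT[of 1] by (simp add: R0_def)
  let ?\<gamma> = "linepath P R0 +++ linepath R0 Q"
  have seg: "closed_segment z w \<subseteq> ball c \<rho>" if "z \<in> ball c \<rho>" "w \<in> ball c \<rho>" for z w
    using that by (simp add: closed_segment_subset)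
  have im\<gamma>: "path_image ?\<gamma> = closed_segment P R0 \<union> closed_segment R0 Q" by (simp add: path_image_join)
  let ?f = "\<lambda>\<sigma>. Re (fr (\<phi> (?g \<sigma>)))"
  have cont_\<phi>g: "continuous_on {s..t} (\<lambda>\<sigma>. \<phi> (?g \<sigma>))"
    by (rule continuous_on_chart_curve[OF e(1) U]) (use st ray DU in auto)
  then have cont_f: "continuous_on {s..t} ?f" unfolding fr_def by (intro continuous_intros)
  have gU: "?g \<sigma> \<in> U" if "\<sigma> \<in> {s..t}" for \<sigma> using ray[OF that] DU by blast
  have g_inj: "\<sigma> = \<sigma>'" if "\<sigma> \<in> {s..t}" "\<sigma>' \<in> {s..t}" "\<phi> (?g \<sigma>) = \<phi> (?g \<sigma>')" for \<sigma> \<sigma>'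
  proof -
    have "?g \<sigma> = ?g \<sigma>'" using inj_on_eq_iff[OF positive_inj[OF U] gU[OF that(1)] gU[OF that(2)]] that(3) by blast
    moreover have "\<sigma> \<in> {0<..<1}" "\<sigma>' \<in> {0<..<1}" using that st by auto
    ultimately show ?thesis using inj_on_eq_iff[OF arc_edge_inj[OF e(2)]] by blast
  qed
  have avoid: "\<phi> (?g \<sigma>) \<notin> path_image ?\<gamma>" if \<sigma>: "s < \<sigma>" "\<sigma> < t" for \<sigma>
  proof
    assume "\<phi> (?g \<sigma>) \<in> path_image ?\<gamma>"
    moreover have Im0: "Im (fr (\<phi> (?g \<sigma>))) = 0" using ray[of \<sigma>] \<sigma> by simp
    ultimately consider \<theta> where "\<phi> (?g \<sigma>) = (1 - \<theta>) *\<^sub>R P + \<theta> *\<^sub>R R0" | \<theta> where "\<phi> (?g \<sigma>) = (1 - \<theta>) *\<^sub>R R0 + \<theta> *\<^sub>R Q"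
      unfolding im\<gamma> closed_segment_def by blast
    then show False
    proof cases
      case (1 \<theta>)
      then have "\<theta> * \<eta> = 0" using Im0 by (simp add: fr_comb frP frR)
      then have "\<phi> (?g \<sigma>) = \<phi> (?g s)" using 1 \<eta>(1) by (simp add: P_def)
      then show False using g_inj[of \<sigma> s] \<sigma> by auto
    next
      case (2 \<theta>)
      then have "(1 - \<theta>) * \<eta> = 0" using Im0 by (simp add: fr_comb frQ frR)
      then have "\<phi> (?g \<sigma>) = \<phi> (?g t)" using 2 \<eta>(1) by (simp add: Q_def)
      then show False using g_inj[of \<sigma> t] \<sigma> by auto
    qed
  qed
  obtain k where k: "\<And>\<tau>. s < \<tau> \<Longrightarrow> \<tau> < t \<Longrightarrow> \<exists>V. openin S V \<and> ?g \<tau> \<in> V \<and> V \<subseteq> ?D \<and>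
     V \<inter> traces \<subseteq> ?g ` {s<..<t} \<and> (\<forall>x\<in>V. \<phi> x \<notin> path_image ?\<gamma>) \<and>
     (\<forall>x\<in>V - traces. of_int (degree x B) = of_int k + of_int (a e) *
        (winding_number (\<lambda>u. \<phi> (?g (s + (t - s) * u))) (\<phi> x) - winding_number ?\<gamma> (\<phi> x)))"
  proof (rule degree_near_edge[OF e st U WH])
    show "?g ` {s..t} \<subseteq> ?D" using ray by blast
    show "path_image ?\<gamma> \<subseteq> ball c \<rho> \<inter> halfplane" using seg[OF PB RB] seg[OF RB QB] BH unfolding im\<gamma> by blast
    show "pathstart ?\<gamma> = \<phi> (?g s)" "pathfinish ?\<gamma> = \<phi> (?g t)" by (simp_all add: P_def Q_def)
  qed (use avoid in auto)
  have ivt: "\<exists>\<sigma>\<in>{s..t}. ?f \<sigma> = y" if "X0 \<le> y" "y \<le> X1" for y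
    using IVT'[of ?f s y t, OF _ _ _ cont_f] that st(2) by (auto simp: X0_def X1_def P_def Q_def)
  have on_ray: "\<exists>\<sigma>\<in>{s..t}. z = \<phi> (?g \<sigma>)" if z: "Im (fr z) = 0" "X0 \<le> Re (fr z)" "Re (fr z) \<le> X1" for z
  proof -
    obtain \<sigma> where \<sigma>: "\<sigma> \<in> {s..t}" "?f \<sigma> = Re (fr z)" using ivt[OF z(2,3)] by blast
    then have "fr z = fr (\<phi> (?g \<sigma>))" using ray[OF \<sigma>(1)] z(1) by (simp add: complex_eq_iff)
    then show ?thesis using fr_inj \<sigma>(1) by blast
  qed
  obtain \<tau> where \<tau>0: "\<tau> \<in> {s..t}" "m = \<phi> (?g \<tau>)"
    using on_ray[of m] X by (auto simp: frm)
  have "m \<noteq> P" "m \<noteq> Q" using frm frP frQ X by auto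
  then have "\<tau> \<noteq> s" "\<tau> \<noteq> t" using \<tau>0 by (auto simp: P_def Q_def)
  then have \<tau>: "s < \<tau>" "\<tau> < t" using \<tau>0(1) by auto
  obtain V where V: "openin S V" "?g \<tau> \<in> V" "V \<subseteq> ?D" "\<forall>x\<in>V. \<phi> x \<notin> path_image ?\<gamma>"
    and VB: "\<forall>x\<in>V - traces. of_int (degree x B) = of_int k + of_int (a e) *
        (winding_number (\<lambda>u. \<phi> (?g (s + (t - s) * u))) (\<phi> x) - winding_number ?\<gamma> (\<phi> x))"
    using k[OF \<tau>] by (elim exE conjE) (rule that; assumption)
  define J where "J = (\<lambda>u. \<phi> (?g (s + (t - s) * u)))"
  have pathJ: "path J"
  proof -
    have "continuous_on {0..1} (\<lambda>u. s + (t - s) * u)" by (intro continuous_intros)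
    moreover have "(\<lambda>u. s + (t - s) * u) ` {0..1} \<subseteq> {s..t}"
    proof (intro image_subsetI)
      fix w :: real assume "w \<in> {0..1}"
      then have "(t - s) * w \<le> t - s" "0 \<le> (t - s) * w" using st mult_left_le[of w "t - s"] by auto
      then show "s + (t - s) * w \<in> {s..t}" by auto
    qed
    ultimately show ?thesis unfolding path_def J_def
      using continuous_on_compose2[OF cont_\<phi>g] by blast
  qed
  have J_ray: "Im (fr (J w)) = 0" if "w \<in> {0..1}" for w
  proof -
    have "(t - s) * w \<le> t - s" "0 \<le> (t - s) * w" using that st mult_left_le[of w "t - s"] by auto
    then have "s + (t - s) * w \<in> {s..t}" by auto
    then show ?thesis using ray unfolding J_def by blast
  qed
  have wnJ: "winding_number J z = winding_number (linepath P Q) z" if z: "Im (fr z) \<noteq> 0" for z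
  proof (rule winding_number_paths_linear_eq)
    show "pathstart J = pathstart (linepath P Q)" "pathfinish J = pathfinish (linepath P Q)"
      by (simp_all add: pathstart_def pathfinish_def J_def P_def Q_def linepath_def)
    fix w :: real assume w: "w \<in> {0..1}"
    have "Im (fr (linepath P Q w)) = 0" unfolding linepath_def fr_comb frP frQ by simp
    then have "Im (fr y) = 0" if "y \<in> closed_segment (linepath P Q w) (J w)" for y
      using that J_ray[OF w] unfolding closed_segment_def by (auto simp: fr_comb)
    then show "z \<notin> closed_segment (linepath P Q w) (J w)" using z by blast
  qed (use pathJ in auto)
  let ?T = "linepath P Q +++ linepath Q R0 +++ linepath R0 P"
  have wnT: "winding_number J z - winding_number ?\<gamma> z = winding_number ?T z"
    if z: "Im (fr z) \<noteq> 0" "z \<notin> path_image ?\<gamma>" for z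
  proof -
    have "Im (fr y) = 0" if "y \<in> closed_segment P Q" for y
      using that frP frQ unfolding closed_segment_def by (auto simp: fr_comb)
    then have PQ: "z \<notin> closed_segment P Q" using z(1) by blast
    have PR: "z \<notin> closed_segment P R0" "z \<notin> closed_segment R0 Q" using z(2) unfolding im\<gamma> by blast+
    then have RP: "z \<notin> closed_segment R0 P" "z \<notin> closed_segment Q R0" by (simp_all add: closed_segment_commute)
    have 1: "winding_number ?T z = winding_number (linepath P Q) z + (winding_number (linepath Q R0) z + winding_number (linepath R0 P) z)"
      using PQ RP by (simp add: winding_number_join path_image_join)
    have 2: "winding_number ?\<gamma> z = winding_number (linepath P R0) z + winding_number (linepath R0 Q) z"
      using PR by (simp add: winding_number_join)
    have 3: "winding_number (linepath Q R0) z = - winding_number (linepath R0 Q) z"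
      "winding_number (linepath R0 P) z = - winding_number (linepath P R0) z"
      using winding_number_reversepath[of "linepath R0 Q" z] winding_number_reversepath[of "linepath P R0" z] PR by simp_all
    show ?thesis unfolding 1 2 3 wnJ[OF z(1)] by simp
  qed
  have wn_left: "winding_number ?T (T \<theta>) = 1" if \<theta>: "0 < \<theta>" "\<theta> < 1" for \<theta>
  proof -
    have ncol: "\<not> collinear {P, Q, R0}"
    proof
      assume "collinear {P, Q, R0}"
      then obtain w where w: "\<forall>x\<in>{P, Q, R0}. \<forall>y\<in>{P, Q, R0}. \<exists>b. x - y = b *\<^sub>R w"
        unfolding collinear_def by blast
      obtain b1 where b1: "Q - P = b1 *\<^sub>R w" using w by blast
      obtain b2 where b2: "R0 - P = b2 *\<^sub>R w" using w by blast
      have "b2 *\<^sub>R (Q - P) = b1 *\<^sub>R (R0 - P)" unfolding b1 b2 by simp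
      then have "b2 *\<^sub>R ((Q - P) * cnj u) = b1 *\<^sub>R ((R0 - P) * cnj u)" by (metis mult_scaleR_left)
      moreover have "(Q - P) * cnj u = of_real (X1 - X0)"
        using frP frQ by (simp add: fr_def algebra_simps)
      moreover have "(R0 - P) * cnj u = of_real ((X1 - X0) / 2) + of_real \<eta> * \<i>"
      proof -
        have "(R0 - P) * cnj u = fr R0 - fr P" by (simp add: fr_def algebra_simps)
        then show ?thesis unfolding frR frP by (simp add: complex_eq_iff field_simps)
      qed
      ultimately have "b2 * (X1 - X0) = b1 * ((X1 - X0) / 2)" "b1 * \<eta> = 0"
        by (simp_all add: complex_eq_iff)
      then have "b1 = 0" using \<eta>(1) by simp
      then have "Q = P" using b1 by simp
      then show False using X by (simp add: X0_def X1_def)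
    qed
    have pos: "0 < (1 - \<theta>) / 2" "(1 - \<theta>) / 2 + (1 - \<theta>) / 2 + \<theta> = 1" using \<theta> by (simp_all add: field_simps)
    have "T \<theta> = ((1 - \<theta>) / 2) *\<^sub>R P + ((1 - \<theta>) / 2) *\<^sub>R Q + \<theta> *\<^sub>R R0"
      unfolding R0_def T_def m_def by (simp add: scaleR_conv_of_real field_simps)
    then have "T \<theta> \<in> interior (convex hull {P, Q, R0})"
      unfolding interior_convex_hull_3_minimal[OF ncol, simplified] mem_Collect_eq
      using pos \<theta>(1) by metis
    then have wn: "winding_number ?T (T \<theta>) = (if 0 < Im ((Q - P) * cnj (Q - T \<theta>)) then 1 else -1)"
      by (rule winding_number_triangle)
    have "(Q - P) * cnj (Q - T \<theta>) = ((Q - P) * cnj u) * cnj ((Q - T \<theta>) * cnj u)"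
      using uu' by (simp add: mult_ac)
    also have "(Q - P) * cnj u = of_real (X1 - X0)"
      using frP frQ by (simp add: fr_def algebra_simps)
    also have "(Q - T \<theta>) * cnj u = fr Q - fr (T \<theta>)" by (simp add: fr_def algebra_simps)
    finally have "Im ((Q - P) * cnj (Q - T \<theta>)) = (X1 - X0) * (\<theta> * \<eta>)"
      unfolding frQ frT by simp
    also have "\<dots> > 0" using X \<theta> \<eta>(1) by simp
    finally show ?thesis using wn by simp
  qed
  have wn_right: "winding_number ?T z = 0" if z: "Im (fr z) < 0" for z
  proof -
    let ?C = "{z. 0 \<le> Im (fr z)}"
    have conv: "convex ?C"
    proof (rule convexI)
      fix x y and p q :: real assume xy: "x \<in> ?C" "y \<in> ?C" "0 \<le> p" "0 \<le> q" "p + q = 1"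
      then have p: "p = 1 - q" by simp
      have "fr (p *\<^sub>R x + q *\<^sub>R y) = p *\<^sub>R fr x + q *\<^sub>R fr y" unfolding p by (rule fr_comb)
      then show "p *\<^sub>R x + q *\<^sub>R y \<in> ?C" using xy by simp
    qed
    have "P \<in> ?C" "Q \<in> ?C" "R0 \<in> ?C" using frP frQ frR \<eta>(1) by simp_all
    then have "path_image ?T \<subseteq> ?C"
      using conv closed_segment_subset[OF _ _ conv] by (simp add: path_image_join)
    then show ?thesis by (intro winding_number_zero_outside[OF _ conv]) (use z in auto)
  qed
  have near: "\<exists>\<theta>>0. \<theta> < 1 \<and> (\<exists>x\<in>V \<inter> V'. \<phi> x = T \<theta>) \<and> (\<exists>x\<in>V \<inter> V'. \<phi> x = T (- \<theta>))"
    if V': "openin S V'" "?g \<tau> \<in> V'" for V'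
  proof -
    have 1: "openin S (V \<inter> V')" "?g \<tau> \<in> V \<inter> V'" "V \<inter> V' \<subseteq> U" using V(1-3) V' DU by blast+
    obtain \<delta> where \<delta>: "\<delta> > 0" "ball (\<phi> (?g \<tau>)) \<delta> \<inter> halfplane \<subseteq> \<phi> ` (V \<inter> V')"
      by (rule small_discs[OF U 1])
    define \<theta> where "\<theta> = min (1/2) (\<delta> / (2 * \<eta>))"
    have \<theta>: "0 < \<theta>" "\<theta> < 1" using \<delta>(1) \<eta>(1) by (auto simp: \<theta>_def)
    have "\<theta> * \<eta> \<le> (\<delta> / (2 * \<eta>)) * \<eta>" using \<eta>(1) by (intro mult_right_mono) (auto simp: \<theta>_def)
    then have d: "\<theta> * \<eta> < \<delta>" using \<eta>(1) \<delta>(1) by simp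
    have d': "\<theta> * \<eta> < \<eta>0" using mult_strict_right_mono[OF \<theta>(2) \<eta>(1)] \<eta>(2) by simp
    have "T \<theta>' \<in> \<phi> ` (V \<inter> V')" if "\<bar>\<theta>'\<bar> = \<theta>" for \<theta>'
    proof -
      have "dist m (T \<theta>') = \<theta> * \<eta>" using distT[of \<theta>'] that by simp
      then have "T \<theta>' \<in> ball m \<delta>" "T \<theta>' \<in> ball m \<eta>0" using d d' by simp_all
      then show ?thesis using \<delta>(2) \<eta>0(2) BH unfolding \<tau>0(2)[symmetric] by blast
    qed
    from this[of \<theta>] this[of "- \<theta>"] have "T \<theta> \<in> \<phi> ` (V \<inter> V')" "T (- \<theta>) \<in> \<phi> ` (V \<inter> V')" using \<theta> by simp_all
    then show ?thesis using \<theta> by (metis (no_types, lifting) imageE)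
  qed
  have mid: "0 < \<epsilon> * ((X0 + X1) / 2)" using ray_s(2) ray_t(2) by (simp add: algebra_simps)
  have left_pt: "x \<notin> traces \<and> degree x B = kl" and left_deg: "degree x B = k + a e"
    if x: "x \<in> V" "\<phi> x = T \<theta>" and \<theta>: "0 < \<theta>" "\<theta> < 1" for x \<theta>
  proof -
    have fr: "Re (fr (\<phi> x)) = (X0 + X1) / 2" "Im (fr (\<phi> x)) = \<theta> * \<eta>" unfolding x(2) frT by simp_all
    have "0 < \<theta> * \<eta>" using \<theta>(1) \<eta>(1) by simp
    then show *: "x \<notin> traces \<and> degree x B = kl" using L[of x] subsetD[OF V(3) x(1)] mid unfolding fr by blast
    have ne: "Im (fr (\<phi> x)) \<noteq> 0" using \<open>0 < \<theta> * \<eta>\<close> unfolding fr(2) by linarith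
    have "x \<in> V - traces" using * x(1) by blast
    then have "of_int (degree x B) = of_int k + of_int (a e) * (winding_number J (\<phi> x) - winding_number ?\<gamma> (\<phi> x))"
      using VB unfolding J_def by blast
    also have "\<dots> = of_int (k + a e)"
    proof -
      have "\<phi> x \<notin> path_image ?\<gamma>" using V(4) x(1) by blast
      from wnT[OF ne this] wn_left[OF \<theta>] show ?thesis unfolding x(2) by simp
    qed
    finally show "degree x B = k + a e" by (simp only: of_int_eq_iff)
  qed
  have right_pt: "x \<notin> traces \<and> degree x B = kr" and right_deg: "degree x B = k"
    if x: "x \<in> V" "\<phi> x = T (- \<theta>)" and \<theta>: "0 < \<theta>" for x \<theta>
  proof -
    have fr: "Re (fr (\<phi> x)) = (X0 + X1) / 2" "Im (fr (\<phi> x)) = - (\<theta> * \<eta>)" unfolding x(2) frT by simp_all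
    have pos: "0 < \<theta> * \<eta>" using \<theta>(1) \<eta>(1) by simp
    then show *: "x \<notin> traces \<and> degree x B = kr" using R[of x] subsetD[OF V(3) x(1)] mid pos unfolding fr by simp
    have ne: "Im (fr (\<phi> x)) \<noteq> 0" "Im (fr (\<phi> x)) < 0" using pos unfolding fr(2) by linarith+
    have "x \<in> V - traces" using * x(1) by blast
    then have "of_int (degree x B) = of_int k + of_int (a e) * (winding_number J (\<phi> x) - winding_number ?\<gamma> (\<phi> x))"
      using VB unfolding J_def by blast
    also have "\<dots> = of_int k"
    proof -
      have "\<phi> x \<notin> path_image ?\<gamma>" using V(4) x(1) by blast
      from wnT[OF ne(1) this] wn_right[OF ne(2)] show ?thesis by simp
    qed
    finally show "degree x B = k" by (simp only: of_int_eq_iff)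
  qed
  obtain \<theta> xl xr where x: "0 < \<theta>" "\<theta> < 1" "xl \<in> V" "\<phi> xl = T \<theta>" "xr \<in> V" "\<phi> xr = T (- \<theta>)"
    using near[OF V(1,2)] by blast
  have diff: "kl - kr = a e"
    using left_pt[OF x(3,4,1,2)] left_deg[OF x(3,4,1,2)] right_pt[OF x(5,6,1)] right_deg[OF x(5,6,1)] by simp
  have lim: "limit_degrees (?g \<tau>) = {kl, kr}"
  proof
    have "\<exists>y\<in>V' - traces. degree y B = kl" "\<exists>y\<in>V' - traces. degree y B = kr"
      if V': "openin S V'" "?g \<tau> \<in> V'" for V'
    proof -
      obtain \<theta> yl yr where y: "0 < \<theta>" "\<theta> < 1" "yl \<in> V" "yl \<in> V'" "\<phi> yl = T \<theta>" "yr \<in> V" "yr \<in> V'" "\<phi> yr = T (- \<theta>)"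
        using near[OF V'] by blast
      show "\<exists>y\<in>V' - traces. degree y B = kl" using left_pt[OF y(3,5,1,2)] y(4) by blast
      show "\<exists>y\<in>V' - traces. degree y B = kr" using right_pt[OF y(6,8,1)] y(7) by blast
    qed
    then show "{kl, kr} \<subseteq> limit_degrees (?g \<tau>)" unfolding limit_degrees_def by blast
    show "limit_degrees (?g \<tau>) \<subseteq> {kl, kr}"
    proof
      fix n assume n: "n \<in> limit_degrees (?g \<tau>)"
      let ?O = "{z. X0 < Re (fr z)} \<inter> {z. Re (fr z) < X1} \<inter> ball c \<rho>"
      have "open ?O" unfolding fr_def by (intro open_Int open_Collect_less continuous_intros) auto
      then have "openin S (preimage U \<phi> ?O)" by (rule openin_preimage[OF U])
      moreover have "?g \<tau> \<in> preimage U \<phi> ?O"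
      proof -
        have "m \<in> ?O" using mB X by (simp add: frm)
        then show ?thesis using gU[OF \<tau>0(1)] unfolding preimage_def \<tau>0(2) by simp
      qed
      ultimately obtain y where y: "y \<in> preimage U \<phi> ?O" "y \<notin> traces" "degree y B = n"
        using n unfolding limit_degrees_def by blast
      have yU: "y \<in> U" "y \<in> ?D" and yX: "X0 < Re (fr (\<phi> y))" "Re (fr (\<phi> y)) < X1" using y(1) by (simp_all add: preimage_def)
      have "Im (fr (\<phi> y)) \<noteq> 0"
      proof
        assume "Im (fr (\<phi> y)) = 0"
        then obtain \<sigma> where \<sigma>: "\<sigma> \<in> {s..t}" "\<phi> y = \<phi> (?g \<sigma>)" using on_ray[of "\<phi> y"] yX by auto
        then have "y = ?g \<sigma>" using inj_on_eq_iff[OF positive_inj[OF U] yU(1) gU[OF \<sigma>(1)]] by blast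
        moreover have "\<sigma> \<in> {0..1}" using \<sigma>(1) st by auto
        ultimately show False using y(2) e(1) by blast
      qed
      moreover have "0 < \<epsilon> * Re (fr (\<phi> y))" using \<epsilon> ray_s(2) ray_t(2) yX by auto
      ultimately show "n \<in> {kl, kr}" using L[OF yU(2)] R[OF yU(2)] y(3) by (cases "0 < Im (fr (\<phi> y))") auto
    qed
  qed
  show "left e = kl" "right e = kr"
    using left_right_unique[OF e _ _ lim diff] \<tau> st by auto
qed

text \<open>The last part of an incoming edge lies on the negative half of its line of travel (\<open>\<epsilon> = -1\<close>), the first
  part of an outgoing edge on the positive half (\<open>\<epsilon> = 1\<close>).\<close>

lemma sides_entering:
  assumes e: "e \<in> edges N" "arc_edge S A N e" "head N e = v" and U: "positive U \<phi>" "v \<in> U"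
    and \<rho>: "0 < \<rho>" "ball (\<phi> v) \<rho> \<subseteq> \<phi> ` U" and u: "cmod u = 1" and ent: "enters_along \<phi> (curve N e) (- u)"
    and L: "\<And>x. x \<in> preimage U \<phi> (ball (\<phi> v) \<rho>) \<Longrightarrow> Re ((\<phi> x - \<phi> v) * cnj u) < 0 \<Longrightarrow> 0 < Im ((\<phi> x - \<phi> v) * cnj u) \<Longrightarrow>
      x \<notin> traces \<and> degree x B = kl"
    and R: "\<And>x. x \<in> preimage U \<phi> (ball (\<phi> v) \<rho>) \<Longrightarrow> Re ((\<phi> x - \<phi> v) * cnj u) < 0 \<Longrightarrow> Im ((\<phi> x - \<phi> v) * cnj u) < 0 \<Longrightarrow>
      x \<notin> traces \<and> degree x B = kr"
  shows "left e = kl" "right e = kr"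
proof -
  let ?g = "curve N e" and ?c = "\<phi> v"
  have uu: "u * cnj u = 1" using u complex_norm_square[of u] by simp
  obtain b where b: "b < 1" "\<And>t. b < t \<Longrightarrow> t < 1 \<Longrightarrow> \<exists>f>0. \<phi> (?g t) = ?c + of_real f * (- u)"
    using ent e(3) unfolding enters_along_def eventually_at_left_field by metis
  have open_disc: "openin S (preimage U \<phi> (ball ?c r))" for r by (rule openin_preimage[OF U(1)]) simp
  have v_disc: "?g 1 \<in> preimage U \<phi> (ball ?c r)" if "r > 0" for r using that U(2) e(3) by (simp add: preimage_def)
  obtain \<delta> where \<delta>: "\<delta> > 0" "\<And>t. 0 \<le> t \<Longrightarrow> t \<le> 1 \<Longrightarrow> \<bar>t - 1\<bar> \<le> \<delta> \<Longrightarrow> ?g t \<in> preimage U \<phi> (ball ?c \<rho>)"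
    using curve_near[OF e(1) open_disc v_disc[OF \<rho>(1)]] by (metis order_refl zero_le_one)
  define s where "s = max ((b + 1) / 2) (max (1 - \<delta>) (1 / 2))"
  have s: "b < s" "1 - \<delta> \<le> s" "1 / 2 \<le> s" "s < 1" using b(1) \<delta>(1) by (auto simp: s_def less_max_iff_disj le_max_iff_disj field_simps)
  obtain f where f: "f > 0" "\<phi> (?g s) = ?c + of_real f * (- u)" using b(2)[OF s(1,4)] by blast
  obtain \<delta>' where \<delta>': "\<delta>' > 0" "\<And>t. 0 \<le> t \<Longrightarrow> t \<le> 1 \<Longrightarrow> \<bar>t - 1\<bar> \<le> \<delta>' \<Longrightarrow> ?g t \<in> preimage U \<phi> (ball ?c f)"
    using curve_near[OF e(1) open_disc v_disc[OF f(1)]] by (metis order_refl zero_le_one)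
  define t where "t = max ((s + 1) / 2) (1 - \<delta>')"
  have t: "s < t" "t < 1" "1 - \<delta>' \<le> t" using s(4) \<delta>'(1) by (auto simp: t_def less_max_iff_disj le_max_iff_disj)
  obtain f' where f': "f' > 0" "\<phi> (?g t) = ?c + of_real f' * (- u)" using b(2)[of t] s t by auto
  have "?g t \<in> preimage U \<phi> (ball ?c f)" using \<delta>'(2)[of t] t s by auto
  then have "f' < f" using f' u by (simp add: preimage_def dist_norm norm_mult)
  have fr: "(\<phi> (?g r) - ?c) * cnj u = - of_real h" if "\<phi> (?g r) = ?c + of_real h * (- u)" for r h
  proof -
    have "(\<phi> (?g r) - ?c) * cnj u = - of_real h * (u * cnj u)" unfolding that by simp
    then show ?thesis by (simp add: uu)
  qed
  have st: "0 < s" using s by simp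
  have ray: "?g \<sigma> \<in> preimage U \<phi> (ball ?c \<rho>) \<and> Im ((\<phi> (?g \<sigma>) - ?c) * cnj u) = 0 \<and> 0 < -1 * Re ((\<phi> (?g \<sigma>) - ?c) * cnj u)"
    if \<sigma>: "\<sigma> \<in> {s..t}" for \<sigma>
  proof -
    have "b < \<sigma>" "\<sigma> < 1" using \<sigma> s t by auto
    then obtain h where h: "h > 0" "\<phi> (?g \<sigma>) = ?c + of_real h * (- u)" using b(2) by blast
    have "?g \<sigma> \<in> preimage U \<phi> (ball ?c \<rho>)" using \<delta>(2)[of \<sigma>] \<sigma> s t by auto
    then show ?thesis unfolding fr[OF h(2)] using h(1) by simp
  qed
  have dir: "Re ((\<phi> (?g s) - ?c) * cnj u) < Re ((\<phi> (?g t) - ?c) * cnj u)"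
    unfolding fr[OF f(2)] fr[OF f'(2)] using \<open>f' < f\<close> by simp
  have L': "x \<notin> traces \<and> degree x B = kl"
    if "x \<in> preimage U \<phi> (ball ?c \<rho>)" "0 < -1 * Re ((\<phi> x - ?c) * cnj u)" "0 < Im ((\<phi> x - ?c) * cnj u)" for x
    using L[of x] that by simp
  have R': "x \<notin> traces \<and> degree x B = kr"
    if "x \<in> preimage U \<phi> (ball ?c \<rho>)" "0 < -1 * Re ((\<phi> x - ?c) * cnj u)" "Im ((\<phi> x - ?c) * cnj u) < 0" for x
    using R[of x] that by simp
  note sides = sides_at_ray[OF e(1,2) U(1) \<rho>(2) u disjI2[OF refl] st t(1,2) ray dir L' R']
  show "left e = kl" "right e = kr" by (rule sides; assumption)+
qed

lemma sides_leaving: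
  assumes e: "e \<in> edges N" "arc_edge S A N e" "tail N e = v" and U: "positive U \<phi>" "v \<in> U"
    and \<rho>: "0 < \<rho>" "ball (\<phi> v) \<rho> \<subseteq> \<phi> ` U" and u: "cmod u = 1" and ent: "leaves_along \<phi> (curve N e) u"
    and L: "\<And>x. x \<in> preimage U \<phi> (ball (\<phi> v) \<rho>) \<Longrightarrow> 0 < Re ((\<phi> x - \<phi> v) * cnj u) \<Longrightarrow> 0 < Im ((\<phi> x - \<phi> v) * cnj u) \<Longrightarrow>
      x \<notin> traces \<and> degree x B = kl"
    and R: "\<And>x. x \<in> preimage U \<phi> (ball (\<phi> v) \<rho>) \<Longrightarrow> 0 < Re ((\<phi> x - \<phi> v) * cnj u) \<Longrightarrow> Im ((\<phi> x - \<phi> v) * cnj u) < 0 \<Longrightarrow>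
      x \<notin> traces \<and> degree x B = kr"
  shows "left e = kl" "right e = kr"
proof -
  let ?g = "curve N e" and ?c = "\<phi> v"
  have uu: "u * cnj u = 1" using u complex_norm_square[of u] by simp
  obtain b where b: "0 < b" "\<And>t. 0 < t \<Longrightarrow> t < b \<Longrightarrow> \<exists>f>0. \<phi> (?g t) = ?c + of_real f * u"
    using ent e(3) unfolding leaves_along_def eventually_at_right_field by metis
  have open_disc: "openin S (preimage U \<phi> (ball ?c r))" for r by (rule openin_preimage[OF U(1)]) simp
  have v_disc: "?g 0 \<in> preimage U \<phi> (ball ?c r)" if "r > 0" for r using that U(2) e(3) by (simp add: preimage_def)
  obtain \<delta> where \<delta>: "\<delta> > 0" "\<And>t. 0 \<le> t \<Longrightarrow> t \<le> 1 \<Longrightarrow> \<bar>t - 0\<bar> \<le> \<delta> \<Longrightarrow> ?g t \<in> preimage U \<phi> (ball ?c \<rho>)"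
    using curve_near[OF e(1) open_disc v_disc[OF \<rho>(1)]] by (metis order_refl zero_le_one)
  define t where "t = min (b / 2) (min \<delta> (1 / 2))"
  have t: "t < b" "t \<le> \<delta>" "t \<le> 1 / 2" "0 < t" using b(1) \<delta>(1) by (auto simp: t_def min_less_iff_disj min_le_iff_disj)
  obtain f where f: "f > 0" "\<phi> (?g t) = ?c + of_real f * u" using b(2)[OF t(4,1)] by blast
  obtain \<delta>' where \<delta>': "\<delta>' > 0" "\<And>t. 0 \<le> t \<Longrightarrow> t \<le> 1 \<Longrightarrow> \<bar>t - 0\<bar> \<le> \<delta>' \<Longrightarrow> ?g t \<in> preimage U \<phi> (ball ?c f)"
    using curve_near[OF e(1) open_disc v_disc[OF f(1)]] by (metis order_refl zero_le_one)
  define s where "s = min (t / 2) \<delta>'"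
  have s: "s < t" "0 < s" "s \<le> \<delta>'" using t(4) \<delta>'(1) by (auto simp: s_def)
  obtain f' where f': "f' > 0" "\<phi> (?g s) = ?c + of_real f' * u" using b(2)[of s] s t by auto
  have "?g s \<in> preimage U \<phi> (ball ?c f)" using \<delta>'(2)[of s] t s by auto
  then have "f' < f" using f' u by (simp add: preimage_def dist_norm norm_mult)
  have fr: "(\<phi> (?g r) - ?c) * cnj u = of_real h" if "\<phi> (?g r) = ?c + of_real h * u" for r h
  proof -
    have "(\<phi> (?g r) - ?c) * cnj u = of_real h * (u * cnj u)" unfolding that by simp
    then show ?thesis by (simp add: uu)
  qed
  have st: "t < 1" using t by simp
  have ray: "?g \<sigma> \<in> preimage U \<phi> (ball ?c \<rho>) \<and> Im ((\<phi> (?g \<sigma>) - ?c) * cnj u) = 0 \<and> 0 < 1 * Re ((\<phi> (?g \<sigma>) - ?c) * cnj u)"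
    if \<sigma>: "\<sigma> \<in> {s..t}" for \<sigma>
  proof -
    have "0 < \<sigma>" "\<sigma> < b" using \<sigma> s t by auto
    then obtain h where h: "h > 0" "\<phi> (?g \<sigma>) = ?c + of_real h * u" using b(2) by blast
    have "?g \<sigma> \<in> preimage U \<phi> (ball ?c \<rho>)" using \<delta>(2)[of \<sigma>] \<sigma> s t by auto
    then show ?thesis unfolding fr[OF h(2)] using h(1) by simp
  qed
  have dir: "Re ((\<phi> (?g s) - ?c) * cnj u) < Re ((\<phi> (?g t) - ?c) * cnj u)"
    unfolding fr[OF f(2)] fr[OF f'(2)] using \<open>f' < f\<close> by simp
  have L': "x \<notin> traces \<and> degree x B = kl"
    if "x \<in> preimage U \<phi> (ball ?c \<rho>)" "0 < 1 * Re ((\<phi> x - ?c) * cnj u)" "0 < Im ((\<phi> x - ?c) * cnj u)" for x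
    using L[of x] that by simp
  have R': "x \<notin> traces \<and> degree x B = kr"
    if "x \<in> preimage U \<phi> (ball ?c \<rho>)" "0 < 1 * Re ((\<phi> x - ?c) * cnj u)" "Im ((\<phi> x - ?c) * cnj u) < 0" for x
    using R[of x] that by simp
  note sides = sides_at_ray[OF e(1,2) U(1) \<rho>(2) u disjI1[OF refl] s(2,1) st ray dir L' R']
  show "left e = kl" "right e = kr" by (rule sides; assumption)+
qed

lemma arc_edge_at_vertex:
  assumes e: "e \<in> edges N" and v: "v \<in> verts N" "v \<in> trace e"
  shows "arc_edge S A N e" "tail N e = v \<or> head N e = v"
proof -
  show arc: "arc_edge S A N e" using arc_or_loop[OF e] v unfolding loop_edge_def by blast
  obtain t where t: "0 \<le> t" "t \<le> 1" "v = curve N e t" using v(2) by auto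
  then have "\<not> (0 < t \<and> t < 1)" using arc_edge_interior[OF arc, of t] v(1) by blast
  then have "t = 0 \<or> t = 1" using t by auto
  then show "tail N e = v \<or> head N e = v" using t(3) by auto
qed

text \<open>At most one edge \<open>e\<close> ends at a boundary vertex, so the coefficient of this vertex in \<open>\<partial> \<partial> B = 0\<close>
  is \<open>\<plusminus> a\<^sub>e\<close> and therefore \<open>a\<^sub>e = 0\<close>. Hence the degree of \<open>B\<close> is defined at the vertex; it is zero
  there, as at every boundary point, and therefore also nearby.\<close>

lemma sides_at_boundary:
  assumes e: "e \<in> edges N" and v: "v \<in> boundary_verts S A N" "tail N e = v \<or> head N e = v"
  shows "left e = 0" "right e = 0"
proof -
  have vv: "v \<in> verts N" "v \<in> surface_boundary S A" using v(1) by (auto simp: boundary_verts_def)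
  have "v \<in> trace e" using v(2) by force
  then have arc: "arc_edge S A N e" using arc_edge_at_vertex[OF e vv(1)] by blast
  have fin: "finite (in_edges N v)" "finite (out_edges N v)"
    using finite_edges by (auto simp: in_edges_def out_edges_def)
  have deg: "card (in_edges N v) + card (out_edges N v) \<le> 1"
    using network v(1) by (simp add: oriented_network_def)
  have ends: "(in_edges N v = {e} \<and> out_edges N v = {}) \<or> (in_edges N v = {} \<and> out_edges N v = {e})"
  proof (cases "e \<in> in_edges N v")
    case True
    then have "card (in_edges N v) > 0" using fin(1) card_gt_0_iff by blast
    then have "card (in_edges N v) = 1" "card (out_edges N v) = 0" using deg by auto
    then show ?thesis using True fin by (auto simp: card_1_singleton_iff)
  next
    case False
    then have "e \<in> out_edges N v" using v(2) e by (auto simp: in_edges_def out_edges_def)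
    then have "card (out_edges N v) > 0" using fin(2) card_gt_0_iff by blast
    then have "card (out_edges N v) = 1" "card (in_edges N v) = 0" using deg by auto
    then show ?thesis using \<open>e \<in> out_edges N v\<close> fin by (auto simp: card_1_singleton_iff)
  qed
  let ?w = "\<lambda>f. if f = point_simplex v then 1 else (0::int)"
  have "chain_boundary 1 (chain_boundary 2 B) = 0" using chain_boundary_boundary[OF B] by simp
  then have "0 = frag_eval ?w (chain_boundary 1 (chain_boundary 2 B))" by simp
  also have "\<dots> = (\<Sum>e'\<in>edges N. a e' * ((if head N e' = v then 1 else 0) - (if tail N e' = v then 1 else 0)))"
    unfolding boundary_B chain_boundary_sum o_def chain_boundary_cmul boundary_path_simplex
    by (simp add: frag_eval_sum frag_eval_cmul frag_eval_diff)
  also have "\<dots> = (\<Sum>e'\<in>edges N. if e' = e then (if e \<in> in_edges N v then a e else - a e) else 0)"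
  proof (rule sum.cong[OF refl])
    fix e' assume e': "e' \<in> edges N"
    then have "head N e' = v \<longleftrightarrow> e' \<in> in_edges N v" "tail N e' = v \<longleftrightarrow> e' \<in> out_edges N v"
      by (simp_all add: in_edges_def out_edges_def)
    then show "a e' * ((if head N e' = v then 1 else 0) - (if tail N e' = v then 1 else 0)) =
      (if e' = e then (if e \<in> in_edges N v then a e else - a e) else 0)" using ends by auto
  qed
  also have "\<dots> = (if e \<in> in_edges N v then a e else - a e)" using e finite_edges by simp
  finally have ae: "a e = 0" by (simp split: if_splits)
  have rel: "relative_cycle {v} B"
  proof (rule relative_cycle_B)
    fix e' assume e': "e' \<in> edges N" "a e' \<noteq> 0"
    have "e' = e" if "v \<in> trace e'"
      using arc_edge_at_vertex(2)[OF e'(1) vv(1) that] e'(1) ends by (auto simp: in_edges_def out_edges_def)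
    then show "{v} \<inter> trace e' = {}" using e'(2) ae by blast
  qed
  have vS: "v \<in> topspace S" using vv(2) by (simp add: surface_boundary_def)
  obtain W where W: "openin S W" "v \<in> W" "relative_cycle W B" "\<And>y. y \<in> W \<Longrightarrow> degree y B = degree v B"
    using degree_locally_constant[OF rel vS] by metis
  have 0: "degree v B = 0" by (rule degree_boundary_point[OF vv(2) rel])
  obtain \<tau> where \<tau>: "0 < \<tau>" "\<tau> < 1" "curve N e \<tau> \<in> W"
  proof -
    obtain t0 where t0: "t0 \<in> {0, 1}" "curve N e t0 = v" using v(2) by auto
    then have "curve N e t0 \<in> W" "0 \<le> t0" "t0 \<le> 1" using W(2) by auto
    from curve_near[OF e W(1) this] obtain \<delta> where
      \<delta>: "\<delta> > 0" "\<And>u. 0 \<le> u \<Longrightarrow> u \<le> 1 \<Longrightarrow> \<bar>u - t0\<bar> \<le> \<delta> \<Longrightarrow> curve N e u \<in> W" by metis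
    define \<tau> where "\<tau> = (if t0 = 0 then min (1/2) \<delta> else max (1/2) (1 - \<delta>))"
    have "0 < \<tau>" "\<tau> < 1" "\<bar>\<tau> - t0\<bar> \<le> \<delta>" using t0(1) \<delta>(1) by (auto simp: \<tau>_def)
    then show thesis using that \<delta>(2)[of \<tau>] by simp
  qed
  have "n = 0" if "n \<in> limit_degrees (curve N e \<tau>)" for n
  proof -
    have "\<exists>y\<in>W - traces. degree y B = n" using that W(1) \<tau>(3) by (simp add: limit_degrees_def)
    then obtain y where y: "y \<in> W" "degree y B = n" by (elim bexE) (rule that; simp)
    show ?thesis using W(4)[OF y(1)] y(2) 0 by simp
  qed
  then show "left e = 0" "right e = 0" using left_right(2)[OF e arc \<tau>(1,2)] by simp_all
qed

text \<open>Near a vertex whose incident edges are straight, the network is contained in the union of the two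
  coordinate axes.\<close>

lemma network_near_vertex:
  assumes v: "v \<in> verts N" and U: "positive U \<phi>" "v \<in> U" "0 < Im (\<phi> v)"
    and ent: "\<And>e. e \<in> edges N \<Longrightarrow> head N e = v \<Longrightarrow> \<exists>d\<in>{-1, -\<i>}. enters_along \<phi> (curve N e) d"
    and lea: "\<And>e. e \<in> edges N \<Longrightarrow> tail N e = v \<Longrightarrow> \<exists>d\<in>{1, \<i>}. leaves_along \<phi> (curve N e) d"
  obtains \<rho> where "0 < \<rho>" "ball (\<phi> v) \<rho> \<subseteq> \<phi> ` U"
    "\<And>x. x \<in> preimage U \<phi> (ball (\<phi> v) \<rho>) \<Longrightarrow> x \<in> traces \<Longrightarrow> Re (\<phi> x - \<phi> v) = 0 \<or> Im (\<phi> x - \<phi> v) = 0"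
proof -
  let ?X = "\<lambda>z. Re (z - \<phi> v) = 0 \<or> Im (z - \<phi> v) = 0"
  have "\<exists>I. I \<subseteq> {0..1} \<and> compact I \<and> v \<notin> curve N e ` I \<and> (\<forall>t\<in>{0..1} - I. ?X (\<phi> (curve N e t)))" if e: "e \<in> edges N" for e
  proof -
    obtain lo where lo: "0 \<le> lo" "tail N e = v \<Longrightarrow> 0 < lo" "\<forall>t. 0 \<le> t \<longrightarrow> t < lo \<longrightarrow> ?X (\<phi> (curve N e t))"
    proof (cases "tail N e = v")
      case True
      then obtain d where d: "d \<in> {1, \<i>}" "leaves_along \<phi> (curve N e) d" using lea[OF e] by blast
      then obtain b where b: "0 < b" "\<And>t. 0 < t \<Longrightarrow> t < b \<Longrightarrow> \<exists>f>0. \<phi> (curve N e t) = \<phi> v + of_real f * d"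
        using True unfolding leaves_along_def eventually_at_right_field by metis
      have "?X (\<phi> (curve N e t))" if tb: "0 \<le> t" "t < b" for t
      proof (cases "t = 0")
        case False
        then obtain f where "\<phi> (curve N e t) = \<phi> v + of_real f * d" using b(2)[of t] tb by auto
        then show ?thesis using d(1) by auto
      qed (use True in simp)
      then show thesis using that[of b] b(1) by simp
    qed (use that[of 0] in simp)
    obtain hi where hi: "hi \<le> 1" "head N e = v \<Longrightarrow> hi < 1" "\<forall>t. hi < t \<longrightarrow> t \<le> 1 \<longrightarrow> ?X (\<phi> (curve N e t))"
    proof (cases "head N e = v")
      case True
      then obtain d where d: "d \<in> {-1, -\<i>}" "enters_along \<phi> (curve N e) d" using ent[OF e] by blast
      then obtain b where b: "b < 1" "\<And>t. b < t \<Longrightarrow> t < 1 \<Longrightarrow> \<exists>f>0. \<phi> (curve N e t) = \<phi> v + of_real f * d"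
        using True unfolding enters_along_def eventually_at_left_field by metis
      have "?X (\<phi> (curve N e t))" if tb: "b < t" "t \<le> 1" for t
      proof (cases "t = 1")
        case False
        then obtain f where "\<phi> (curve N e t) = \<phi> v + of_real f * d" using b(2)[of t] tb by auto
        then show ?thesis using d(1) by auto
      qed (use True in simp)
      then show thesis using that[of b] b(1) by simp
    qed (use that[of 1] in simp)
    let ?I = "{lo..hi} \<inter> {0..1}"
    have "v \<notin> curve N e ` ?I"
    proof
      assume "v \<in> curve N e ` ?I"
      then obtain t where t: "lo \<le> t" "t \<le> hi" "0 \<le> t" "t \<le> 1" "v = curve N e t" by auto
      then have "v \<in> trace e" by auto
      then have arc: "arc_edge S A N e" using arc_edge_at_vertex[OF e v] by blast
      have "\<not> (0 < t \<and> t < 1)" using arc_edge_interior[OF arc, of t] v t(5) by blast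
      then have "t = 0 \<or> t = 1" using t by auto
      then show False using t lo(2) hi(2) by auto
    qed
    moreover have "\<forall>t\<in>{0..1} - ?I. ?X (\<phi> (curve N e t))"
    proof
      fix t assume "t \<in> {0..1} - ?I"
      then have "0 \<le> t" "t \<le> 1" "t < lo \<or> hi < t" by auto
      then show "?X (\<phi> (curve N e t))" using lo(3) hi(3) by blast
    qed
    ultimately show ?thesis by (intro exI[of _ ?I] conjI) auto
  qed
  then obtain I where I: "\<And>e. e \<in> edges N \<Longrightarrow> I e \<subseteq> {0..1} \<and> compact (I e) \<and> v \<notin> curve N e ` I e \<and>
      (\<forall>t\<in>{0..1} - I e. ?X (\<phi> (curve N e t)))" by metis
  let ?Z = "\<Union>e\<in>edges N. curve N e ` I e"
  have "closedin S ?Z" using finite_edges closedin_curve_image I by (intro closedin_Union) auto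
  then have "openin S (U - ?Z)" using positive_openin[OF U(1)] by blast
  moreover have "U - ?Z \<subseteq> U" by blast
  moreover have "v \<in> U - ?Z" using I U(2) by blast
  ultimately obtain \<rho> where \<rho>: "\<rho> > 0" "ball (\<phi> v) \<rho> \<subseteq> halfplane" "ball (\<phi> v) \<rho> \<subseteq> \<phi> ` (U - ?Z)"
    by (rule interior_disc[OF U(1) _ _ _ U(3)])
  show thesis
  proof (rule that[OF \<rho>(1)])
    show "ball (\<phi> v) \<rho> \<subseteq> \<phi> ` U" using \<rho>(3) by blast
    fix x assume x: "x \<in> preimage U \<phi> (ball (\<phi> v) \<rho>)" "x \<in> traces"
    have "preimage U \<phi> (ball (\<phi> v) \<rho>) \<subseteq> U - ?Z" by (rule preimage_image[OF U(1)]) (use \<rho>(3) in auto)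
    then have "x \<notin> ?Z" using x(1) by blast
    obtain e t where e: "e \<in> edges N" "t \<in> {0..1}" "x = curve N e t" using x(2) by blast
    then have "t \<in> {0..1} - I e" using \<open>x \<notin> ?Z\<close> by blast
    then show "?X (\<phi> x)" using I[OF e(1)] e(3) by blast
  qed
qed

text \<open>Each of the four quadrants at a vertex lies in a single face, so the values of the degree on the
  sides of the four edge ends match up around the vertex.\<close>

lemma sides_at_crossing:
  assumes v: "v \<in> verts N" and e: "in_edges N v = {e1, e2}" "out_edges N v = {f1, f2}"
    and ccw: "counterclockwise_at S A N v e1 e2 f1 f2"
  shows "right e1 = left e2" "right e2 = right f1" "left f1 = right f2" "left f2 = left e1"
proof -
  obtain U \<phi> where U: "positive U \<phi>" "v \<in> U" "0 < Im (\<phi> v)"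
    and rays: "enters_along \<phi> (curve N e1) (-1)" "enters_along \<phi> (curve N e2) (-\<i>)"
      "leaves_along \<phi> (curve N f1) 1" "leaves_along \<phi> (curve N f2) \<i>"
    using ccw unfolding counterclockwise_at_def by blast
  have in_e: "e' \<in> edges N \<Longrightarrow> head N e' = v \<Longrightarrow> e' = e1 \<or> e' = e2" for e' using e(1) by (auto simp: in_edges_def)
  have out_e: "e' \<in> edges N \<Longrightarrow> tail N e' = v \<Longrightarrow> e' = f1 \<or> e' = f2" for e' using e(2) by (auto simp: out_edges_def)
  have E: "e1 \<in> edges N" "head N e1 = v" "e2 \<in> edges N" "head N e2 = v" "f1 \<in> edges N" "tail N f1 = v" "f2 \<in> edges N" "tail N f2 = v"
    using e by (auto simp: in_edges_def out_edges_def)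
  have tr: "v \<in> trace e'" if "tail N e' = v \<or> head N e' = v" for e' using that by force
  have arcs: "arc_edge S A N e1" "arc_edge S A N e2" "arc_edge S A N f1" "arc_edge S A N f2"
    using arc_edge_at_vertex(1)[OF _ v tr] E by blast+
  have ent: "\<exists>d\<in>{-1, -\<i>}. enters_along \<phi> (curve N e') d" if "e' \<in> edges N" "head N e' = v" for e'
    using in_e[OF that] rays by blast
  have lea: "\<exists>d\<in>{1, \<i>}. leaves_along \<phi> (curve N e') d" if "e' \<in> edges N" "tail N e' = v" for e'
    using out_e[OF that] rays by blast
  obtain \<rho> where \<rho>: "0 < \<rho>" "ball (\<phi> v) \<rho> \<subseteq> \<phi> ` U"
    and cross: "\<And>x. x \<in> preimage U \<phi> (ball (\<phi> v) \<rho>) \<Longrightarrow> x \<in> traces \<Longrightarrow> Re (\<phi> x - \<phi> v) = 0 \<or> Im (\<phi> x - \<phi> v) = 0"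
    using network_near_vertex[OF v U ent lea] by metis
  let ?D = "preimage U \<phi> (ball (\<phi> v) \<rho>)"
  let ?Q = "\<lambda>p q. {z. 0 < p * Re (z - \<phi> v)} \<inter> {z. 0 < q * Im (z - \<phi> v)} \<inter> ball (\<phi> v) \<rho>"
  define K where "K p q = degree (SOME x. x \<in> preimage U \<phi> (?Q p q)) B" for p q :: real
  have K: "x \<notin> traces \<and> degree x B = K p q"
    if x: "x \<in> ?D" "0 < p * Re (\<phi> x - \<phi> v)" "0 < q * Im (\<phi> x - \<phi> v)" for x p q
  proof -
    let ?P = "preimage U \<phi> (?Q p q)"
    have xP: "x \<in> ?P" using x by (simp add: preimage_def)
    have off: "y \<notin> traces" if "y \<in> ?P" for y
    proof
      assume "y \<in> traces"
      moreover have "y \<in> ?D" using that by (simp add: preimage_def)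
      ultimately have "Re (\<phi> y - \<phi> v) = 0 \<or> Im (\<phi> y - \<phi> v) = 0" by (rule cross[rotated])
      then show False using that by (auto simp: preimage_def)
    qed
    have conv: "convex (?Q p q)"
    proof -
      have "{z. 0 < p * Re (z - \<phi> v)} = {z. inner (complex_of_real p) z > p * Re (\<phi> v)}"
        "{z. 0 < q * Im (z - \<phi> v)} = {z. inner (of_real q * \<i>) z > q * Im (\<phi> v)}"
        by (auto simp: inner_complex_def algebra_simps)
      then show ?thesis by (simp only:) (intro convex_Int convex_halfspace_gt convex_ball)
    qed
    have QU: "?Q p q \<subseteq> \<phi> ` U" using \<rho>(2) by blast
    have "?P = inv_into U \<phi> ` (?Q p q)"
    proof
      show "?P \<subseteq> inv_into U \<phi> ` (?Q p q)"
      proof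
        fix y assume "y \<in> ?P"
        then have "y \<in> U" "\<phi> y \<in> ?Q p q" by (simp_all add: preimage_def)
        moreover have "inv_into U \<phi> (\<phi> y) = y" using positive_inj[OF U(1)] \<open>y \<in> U\<close> by simp
        ultimately show "y \<in> inv_into U \<phi> ` (?Q p q)" by (metis imageI)
      qed
      show "inv_into U \<phi> ` (?Q p q) \<subseteq> ?P"
      proof
        fix y assume "y \<in> inv_into U \<phi> ` (?Q p q)"
        then obtain z where z: "z \<in> ?Q p q" "y = inv_into U \<phi> z" by blast
        then have zU: "z \<in> \<phi> ` U" using QU by blast
        have "y \<in> U" "\<phi> y = z" using z(2) inv_into_into[OF zU] f_inv_into_f[OF zU] by simp_all
        then show "y \<in> ?P" using z(1) by (simp add: preimage_def)
      qed
    qed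
    moreover have "connectedin (top_of_set (\<phi> ` U)) (?Q p q)"
      using convex_connected[OF conv] QU by (simp add: connectedin_subtopology)
    ultimately have "connectedin (subtopology S U) ?P"
      using connectedin_continuous_map_image[OF positive_inverse[OF U(1)]] by metis
    then have "connectedin S ?P" by (simp add: connectedin_subtopology)
    moreover have "relative_cycle ?P B" by (rule relative_cycle_B) (use off in blast)
    moreover have "(SOME x. x \<in> ?P) \<in> ?P" using xP by (rule someI)
    ultimately have "degree x B = K p q" unfolding K_def by (rule degree_constant[OF _ _ xP])
    then show ?thesis using off[OF xP] by blast
  qed
  have "left e1 = K (-1) 1" "right e1 = K (-1) (-1)"
  proof -
    have L: "x \<notin> traces \<and> degree x B = K (-1) 1"
      if "x \<in> ?D" "Re ((\<phi> x - \<phi> v) * cnj 1) < 0" "0 < Im ((\<phi> x - \<phi> v) * cnj 1)" for x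
      using K[of x "(-1)" "1"] that by simp
    have R: "x \<notin> traces \<and> degree x B = K (-1) (-1)"
      if "x \<in> ?D" "Re ((\<phi> x - \<phi> v) * cnj 1) < 0" "Im ((\<phi> x - \<phi> v) * cnj 1) < 0" for x
      using K[of x "(-1)" "(-1)"] that by simp
    show "left e1 = K (-1) 1" "right e1 = K (-1) (-1)"
      by (rule sides_entering[OF E(1) arcs(1) E(2) U(1,2) \<rho> _ rays(1) L R]; simp)+
  qed
  moreover have "left e2 = K (-1) (-1)" "right e2 = K 1 (-1)"
  proof -
    have L: "x \<notin> traces \<and> degree x B = K (-1) (-1)"
      if "x \<in> ?D" "Re ((\<phi> x - \<phi> v) * cnj \<i>) < 0" "0 < Im ((\<phi> x - \<phi> v) * cnj \<i>)" for x
      using K[of x "(-1)" "(-1)"] that by simp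
    have R: "x \<notin> traces \<and> degree x B = K 1 (-1)"
      if "x \<in> ?D" "Re ((\<phi> x - \<phi> v) * cnj \<i>) < 0" "Im ((\<phi> x - \<phi> v) * cnj \<i>) < 0" for x
      using K[of x "1" "(-1)"] that by simp
    show "left e2 = K (-1) (-1)" "right e2 = K 1 (-1)"
      by (rule sides_entering[OF E(3) arcs(2) E(4) U(1,2) \<rho> _ rays(2) L R]; simp)+
  qed
  moreover have "left f1 = K 1 1" "right f1 = K 1 (-1)"
  proof -
    have L: "x \<notin> traces \<and> degree x B = K 1 1"
      if "x \<in> ?D" "0 < Re ((\<phi> x - \<phi> v) * cnj 1)" "0 < Im ((\<phi> x - \<phi> v) * cnj 1)" for x
      using K[of x "1" "1"] that by simp
    have R: "x \<notin> traces \<and> degree x B = K 1 (-1)"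
      if "x \<in> ?D" "0 < Re ((\<phi> x - \<phi> v) * cnj 1)" "Im ((\<phi> x - \<phi> v) * cnj 1) < 0" for x
      using K[of x "1" "(-1)"] that by simp
    show "left f1 = K 1 1" "right f1 = K 1 (-1)"
      by (rule sides_leaving[OF E(5) arcs(3) E(6) U(1,2) \<rho> _ rays(3) L R]; simp)+
  qed
  moreover have "left f2 = K (-1) 1" "right f2 = K 1 1"
  proof -
    have L: "x \<notin> traces \<and> degree x B = K (-1) 1"
      if "x \<in> ?D" "0 < Re ((\<phi> x - \<phi> v) * cnj \<i>)" "0 < Im ((\<phi> x - \<phi> v) * cnj \<i>)" for x
      using K[of x "(-1)" "1"] that by simp
    have R: "x \<notin> traces \<and> degree x B = K 1 1"
      if "x \<in> ?D" "0 < Re ((\<phi> x - \<phi> v) * cnj \<i>)" "Im ((\<phi> x - \<phi> v) * cnj \<i>) < 0" for x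
      using K[of x "1" "1"] that by simp
    show "left f2 = K (-1) 1" "right f2 = K 1 1"
      by (rule sides_leaving[OF E(7) arcs(4) E(8) U(1,2) \<rho> _ rays(4) L R]; simp)+
  qed
  ultimately show "right e1 = left e2" "right e2 = right f1" "left f1 = right f2" "left f2 = left e1"
    by simp_all
qed

end

section \<open>Dickson's lemma for multisets\<close>

lemma nat_sequence_incseq_subsequence:
  fixes s :: "nat \<Rightarrow> nat"
  shows "\<exists>r. strict_mono r \<and> incseq (\<lambda>n. s (r n))"
proof -
  obtain f where f: "strict_mono f" "monoseq (\<lambda>n. s (f n))" using seq_monosub[of s] by blast
  from f(2) consider "incseq (\<lambda>n. s (f n))" | "decseq (\<lambda>n. s (f n))" unfolding monoseq_iff by blast
  then show ?thesis
  proof cases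
    case 1
    then show ?thesis using f(1) by blast
  next
    case 2
    obtain n0 where n0: "\<And>n. s (f n0) \<le> s (f n)"
      using ex_has_least_nat[of "\<lambda>_. True" 0 "\<lambda>n. s (f n)"] by auto
    have const: "s (f (n0 + n)) = s (f n0)" for n
      using n0[of "n0 + n"] decseqD[OF 2, of n0 "n0 + n"] by simp
    have "strict_mono (\<lambda>n. f (n0 + n))" using f(1) by (simp add: strict_mono_def)
    moreover have "incseq (\<lambda>n. s (f (n0 + n)))" unfolding const by simp
    ultimately show ?thesis by blast
  qed
qed

lemma infinite_multisets_comparable:
  fixes X :: "'b multiset set"
  assumes inf: "infinite X" and E: "finite E" "\<And>M. M \<in> X \<Longrightarrow> set_mset M \<subseteq> E"
  shows "\<exists>M\<in>X. \<exists>M'\<in>X. M \<subset># M'"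
proof -
  obtain g :: "nat \<Rightarrow> 'b multiset" where g: "inj g" "range g \<subseteq> X"
    using infinite_countable_subset[OF inf] by blast
  have "\<exists>r. strict_mono r \<and> (\<forall>e\<in>D. incseq (\<lambda>n. count (g (r n)) e))" if "finite D" for D
    using that
  proof (induction D)
    case empty
    show ?case by (rule exI[of _ id]) (simp add: strict_mono_def)
  next
    case (insert e D)
    then obtain r where r: "strict_mono r" "\<forall>e\<in>D. incseq (\<lambda>n. count (g (r n)) e)" by blast
    obtain r' where r': "strict_mono r'" "incseq (\<lambda>n. count (g (r (r' n))) e)"
      using nat_sequence_incseq_subsequence[of "\<lambda>n. count (g (r n)) e"] by blast
    have "incseq (\<lambda>n. count (g (r (r' n))) x)" if "x \<in> D" for x
      using r(2) that strict_mono_mono[OF r'(1)] unfolding incseq_def mono_def by blast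
    then have "\<forall>x\<in>insert e D. incseq (\<lambda>n. count (g (r (r' n))) x)" using r'(2) by blast
    moreover have "strict_mono (\<lambda>n. r (r' n))" using strict_mono_o[OF r(1) r'(1)] by (simp only: o_def)
    ultimately show ?case by blast
  qed
  from this[OF E(1)] obtain r where r: "strict_mono r" "\<forall>e\<in>E. incseq (\<lambda>n. count (g (r n)) e)" by blast
  have "g (r 0) \<subseteq># g (r 1)"
  proof (rule mset_subset_eqI)
    fix e
    show "count (g (r 0)) e \<le> count (g (r 1)) e"
    proof (cases "e \<in> E")
      case True
      then have "incseq (\<lambda>n. count (g (r n)) e)" using r(2) by blast
      then show ?thesis by (rule incseqD) simp
    next
      case False
      then have "e \<notin># g (r 0)" using E(2) g(2) by blast
      then show ?thesis by (simp add: not_in_iff)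
    qed
  qed
  moreover have "r 0 \<noteq> r 1" using r(1) by (simp add: strict_mono_eq)
  then have "g (r 0) \<noteq> g (r 1)" using g(1) by (simp add: inj_eq)
  ultimately have "g (r 0) \<subset># g (r 1)" by (simp add: subset_mset_def)
  then show ?thesis using g(2) by blast
qed

section \<open>Passages of walks\<close>

lemma path_passages_Cons [simp]: "path_passages (x # y # zs) = (x, y) # path_passages (y # zs)"
  by (simp add: path_passages_def)

lemma path_passages_trivial [simp]: "path_passages [] = []" "path_passages [x] = []"
  by (simp_all add: path_passages_def)

lemma mset_fst_path_passages: "image_mset fst (mset (path_passages es)) = mset (butlast es)"
  unfolding path_passages_def mset_map[symmetric] by (simp add: map_fst_zip_take butlast_conv_take)

lemma mset_snd_path_passages: "image_mset snd (mset (path_passages es)) = mset (tl es)"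
  unfolding path_passages_def mset_map[symmetric] by (simp add: map_snd_zip_take)

lemma mset_fst_cyclic_passages: "image_mset fst (mset (cyclic_passages es)) = mset es"
  unfolding cyclic_passages_def mset_map[symmetric] by simp

lemma mset_snd_cyclic_passages: "image_mset snd (mset (cyclic_passages es)) = mset es"
  unfolding cyclic_passages_def mset_map[symmetric] by (cases es) simp_all

lemma cyclic_passages_unroll: "es \<noteq> [] \<Longrightarrow> cyclic_passages es = path_passages (es @ [hd es])"
proof -
  assume "es \<noteq> []"
  then obtain x xs where es: "es = x # xs" by (cases es) auto
  have "path_passages (es @ [hd es]) = zip ((x # xs) @ [x]) ((xs @ [x]) @ [])"
    by (simp add: path_passages_def es)
  also have "\<dots> = zip (x # xs) (xs @ [x]) @ zip [x] []" by (rule zip_append) simp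
  finally show ?thesis by (simp add: cyclic_passages_def es)
qed

text \<open>A quantity that never increases along a walk and has the same value at both ends is constant.\<close>

lemma constant_along_passages:
  fixes h :: "'e \<Rightarrow> int"
  assumes dec: "\<And>x y. (x, y) \<in> set (path_passages es) \<Longrightarrow> h y \<le> h x"
    and ends: "h (last es) = h (hd es)" and x: "x \<in> set es"
  shows "h x = h (hd es)"
proof -
  have "\<forall>x\<in>set es. h (last es) \<le> h x \<and> h x \<le> h (hd es)" using dec
  proof (induction es rule: induct_list012)
    case (3 a b es)
    have *: "\<forall>x\<in>set (b # es). h (last (b # es)) \<le> h x \<and> h x \<le> h (hd (b # es))"
      by (rule 3(2)) (use 3(3) in simp)
    have "h b \<le> h a" by (rule 3(3)) simp
    moreover have "h (last (b # es)) \<le> h b" using * by simp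
    ultimately show ?case using * by force
  qed simp_all
  then show ?thesis using ends x by force
qed

lemma H1_class_eq_iff: "H1_class S c = H1_class S d \<longleftrightarrow> singular_relboundary 1 S {} (c - d)"
  by (simp only: H1_class_def homologous_rel_set_eq) (simp only: homologous_rel_def)

lemma H1_class_eq_one_iff: "H1_class S c = \<one>\<^bsub>homology_group 1 S\<^esub> \<longleftrightarrow> singular_relboundary 1 S {} c"
  using one_relative_homology_group[of 1 S "{}"] homologous_rel_set_eq_relboundary[of 1 S "{}" c]
  by (simp add: H1_class_def del: One_nat_def)

lemma homologous_paths_diff:
  assumes "homologous_paths S N q p" "homologous_paths S N q' p"
  shows "singular_relboundary 1 S {} (walk_chain N q - walk_chain N q')"
  using singular_relboundary_diff[OF assms[unfolded homologous_paths_def H1_class_eq_one_iff]] by simp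

lemma monomial_degree_single: "monomial_degree (Poly_Mapping.single v n) = n"
  by (simp add: monomial_degree_def)

lemma monomial_degree_zero: "monomial_degree 0 = 0"
  by (simp add: monomial_degree_def)

lemma monomial_degree_add: "monomial_degree (m + n) = monomial_degree m + monomial_degree n"
proof -
  let ?K = "Poly_Mapping.keys m \<union> Poly_Mapping.keys n"
  have deg: "monomial_degree k = (\<Sum>v\<in>?K. Poly_Mapping.lookup k v)" if "Poly_Mapping.keys k \<subseteq> ?K" for k
    unfolding monomial_degree_def using that by (intro sum.mono_neutral_left) (auto simp: in_keys_iff)
  have "Poly_Mapping.keys (m + n) \<subseteq> ?K" by (rule Poly_Mapping.keys_add)
  from deg[OF this] show ?thesis using deg[of m] deg[of n] by (simp add: lookup_add sum.distrib)
qed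

lemma monomial_degree_passages_weight:
  "monomial_degree (passages_weight N ps) = size (filter_mset (highway_passage N) (mset ps))"
proof (induction ps)
  case Nil
  show ?case by (simp add: passages_weight_def monomial_degree_def)
next
  case (Cons p ps)
  obtain e f where p: "p = (e, f)" by (cases p)
  have "passages_weight N (p # ps) =
      (if highway_passage N p then Poly_Mapping.single (head N e) 1 else 0) + passages_weight N ps"
    by (simp add: passages_weight_def p)
  then show ?case using Cons by (simp add: monomial_degree_add monomial_degree_single monomial_degree_zero)
qed

lemma walk_chain_count:
  assumes "finite E" "set es \<subseteq> E"
  shows "walk_chain N es = (\<Sum>e\<in>E. frag_cmul (int (count (mset es) e)) (frag_of (edge_simplex N e)))"
  using assms(2)
proof (induction es)
  case Nil
  show ?case by (simp add: walk_chain_def)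
next
  case (Cons x es)
  have "(\<Sum>e\<in>E. frag_cmul (int (count (mset (x # es)) e)) (frag_of (edge_simplex N e))) =
     (\<Sum>e\<in>E. (if e = x then frag_of (edge_simplex N e) else 0) +
        frag_cmul (int (count (mset es) e)) (frag_of (edge_simplex N e)))"
    by (rule sum.cong[OF refl]) (simp add: frag_cmul_distrib)
  also have "\<dots> = frag_of (edge_simplex N x) + walk_chain N es"
    using Cons assms(1) by (simp add: sum.distrib)
  finally show ?case by (simp add: walk_chain_def)
qed

text \<open>By Dickson's lemma, among infinitely many walks there are two such that every passage occurs at
  most as often in the first as in the second, and some passage less often.\<close>

lemma walks_with_more_passages:
  assumes inf: "infinite Q" and E: "finite E"
    and Q: "\<And>q. q \<in> Q \<Longrightarrow> set q \<subseteq> E \<and> set (ps q) \<subseteq> E \<times> E \<and> length q \<le> Suc (length (ps q))"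
  shows "\<exists>q\<in>Q. \<exists>q'\<in>Q. mset (ps q) \<subset># mset (ps q')"
proof -
  let ?X = "(\<lambda>q. mset (ps q)) ` Q"
  have "infinite ?X"
  proof
    assume fin: "finite ?X"
    have "Q \<subseteq> (\<Union>P\<in>?X. {q. set q \<subseteq> E \<and> length q \<le> Suc (size P)})" using Q by fastforce
    moreover have "finite (\<Union>P\<in>?X. {q. set q \<subseteq> E \<and> length q \<le> Suc (size P)})"
      using fin finite_lists_length_le[OF E] by blast
    ultimately show False using inf finite_subset by blast
  qed
  moreover have "finite (E \<times> E)" using E by blast
  moreover have "\<And>M. M \<in> ?X \<Longrightarrow> set_mset M \<subseteq> E \<times> E" using Q by fastforce
  ultimately have "\<exists>M\<in>?X. \<exists>M'\<in>?X. M \<subset># M'" by (rule infinite_multisets_comparable)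
  then show ?thesis by blast
qed

section \<open>Homologous highway walks\<close>

locale crossing_network = surface_network S A N
  for S :: "'a topology" and A :: "'a chart set" and N :: "('a, 'e) network" +
  assumes simple_crossing: "simple_crossing_network S A N"
begin

abbreviation "iverts \<equiv> interior_verts S A N"
abbreviation "bverts \<equiv> boundary_verts S A N"

lemma verts_cases: "v \<in> verts N \<longleftrightarrow> v \<in> iverts \<or> v \<in> bverts"
  by (auto simp: interior_verts_def boundary_verts_def)

lemma interior_not_boundary: "v \<in> iverts \<Longrightarrow> v \<notin> bverts"
  by (simp add: interior_verts_def boundary_verts_def)

lemma edges_at_interior:
  assumes "v \<in> iverts"
  shows "in_edges N v = {highway_in N v, underway_in N v}"
    "out_edges N v = {highway_out N v, underway_out N v}"
    "highway_in N v \<noteq> underway_in N v" "highway_out N v \<noteq> underway_out N v"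
    "counterclockwise_at S A N v (highway_in N v) (underway_in N v) (highway_out N v) (underway_out N v)"
  using simple_crossing assms by (simp_all add: simple_crossing_network_def)

lemma ends_at_interior:
  assumes v: "v \<in> iverts"
  shows "highway_in N v \<in> edges N" "head N (highway_in N v) = v" "underway_in N v \<in> edges N"
    "head N (underway_in N v) = v" "highway_out N v \<in> edges N" "tail N (highway_out N v) = v"
    "underway_out N v \<in> edges N" "tail N (underway_out N v) = v"
  using edges_at_interior(1,2)[OF v] by (auto simp: in_edges_def out_edges_def)

text \<open>The combinatorial content of a vanishing homology class: if the sum of \<open>a(e) e\<close> is the boundary of a
  2-chain, then \<open>l\<close> and \<open>r\<close> are the values of this chain on the faces to the left and to the right of the edges. The four
  corner equations say that two consecutive edge ends at a vertex border on the same face.\<close>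

definition side_values :: "('e \<Rightarrow> int) \<Rightarrow> ('e \<Rightarrow> int) \<Rightarrow> ('e \<Rightarrow> int) \<Rightarrow> bool" where
  "side_values a l r \<longleftrightarrow> (\<forall>e. a e = l e - r e) \<and>
     (\<forall>v\<in>iverts. r (highway_in N v) = l (underway_in N v) \<and> r (underway_in N v) = r (highway_out N v) \<and>
        l (highway_out N v) = r (underway_out N v) \<and> l (underway_out N v) = l (highway_in N v)) \<and>
     (\<forall>e\<in>edges N. tail N e \<in> bverts \<or> head N e \<in> bverts \<longrightarrow> l e = 0 \<and> r e = 0)"

lemma edge_sides:
  assumes "singular_relboundary 1 S {} (\<Sum>e\<in>edges N. frag_cmul (a e) (frag_of (edge_simplex N e)))"
  shows "\<exists>l r. side_values a l r"
proof -
  have es: "edge_simplex N e = path_simplex (curve N e)" for e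
    by (simp add: edge_simplex_def path_simplex_def)
  obtain B where B: "singular_chain 2 S B"
    "chain_boundary 2 B = (\<Sum>e\<in>edges N. frag_cmul (a e) (frag_of (path_simplex (curve N e))))"
    using assms unfolding singular_boundary es numeral_2_eq_2 One_nat_def by blast
  interpret null_homologous_edges S A N a B by unfold_locales (fact B)+
  have "right (highway_in N v) = left (underway_in N v) \<and> right (underway_in N v) = right (highway_out N v) \<and>
      left (highway_out N v) = right (underway_out N v) \<and> left (underway_out N v) = left (highway_in N v)"
    if v: "v \<in> iverts" for v
  proof -
    have "v \<in> verts N" using v by (simp add: interior_verts_def)
    then show ?thesis using sides_at_crossing[OF _ edges_at_interior(1,2,5)[OF v]] by simp
  qed
  moreover have "left e = 0 \<and> right e = 0" if "e \<in> edges N" "tail N e \<in> bverts \<or> head N e \<in> bverts" for e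
    using that sides_at_boundary[of e] by metis
  moreover have "\<forall>e. a e = left e - right e" by (simp add: right_def)
  ultimately have "side_values a left right" unfolding side_values_def by blast
  then show ?thesis by blast
qed

text \<open>Passing the base point of a closed loop counts as a turn from the loop into itself.\<close>

definition turn :: "'e \<times> 'e \<Rightarrow> bool" where
  "turn = (\<lambda>(e, f). (\<exists>v\<in>iverts. e = highway_in N v \<and> f = underway_out N v \<or>
     e = underway_in N v \<and> f = highway_out N v) \<or> e = f \<and> e \<in> edges N \<and> head N e \<notin> verts N)"

definition crossing :: "'e \<times> 'e \<Rightarrow> bool" where
  "crossing = (\<lambda>(e, f). \<exists>v\<in>iverts. e = highway_in N v \<and> f = highway_out N v)"

definition highway_step :: "'e \<times> 'e \<Rightarrow> bool" where
  "highway_step p \<longleftrightarrow> crossing p \<or> turn p"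

lemma passage_is_highway_step:
  assumes ef: "e \<in> edges N" "f \<in> edges N" "head N e = tail N f" and ok: "\<not> forbidden_passage N (e, f)"
  shows "highway_step (e, f)"
proof (cases "head N e \<in> verts N")
  case True
  define v where "v = head N e"
  have io: "e \<in> in_edges N v" "f \<in> out_edges N v" using ef by (auto simp: v_def in_edges_def out_edges_def)
  have "v \<notin> bverts"
  proof
    assume "v \<in> bverts"
    then have "card (in_edges N v) + card (out_edges N v) \<le> 1" using network by (simp add: oriented_network_def)
    moreover have "finite (in_edges N v)" "finite (out_edges N v)"
      using finite_edges by (simp_all add: in_edges_def out_edges_def)
    then have "card (in_edges N v) > 0" "card (out_edges N v) > 0" using io card_gt_0_iff by blast+
    ultimately show False by simp
  qed
  then have v: "v \<in> iverts" using True verts_cases by (simp add: v_def)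
  have "e = highway_in N v \<or> e = underway_in N v" "f = highway_out N v \<or> f = underway_out N v"
    using io edges_at_interior(1,2)[OF v] by auto
  moreover have "\<not> (e = underway_in N v \<and> f = underway_out N v)"
    using ok True by (simp add: forbidden_passage_def v_def)
  ultimately show ?thesis using v by (auto simp: highway_step_def crossing_def turn_def)
next
  case False
  then have "loop_edge S A N e" using arc_or_loop[OF ef(1)] by (auto simp: arc_edge_def)
  moreover have "head N e \<in> curve N e ` {0..1}" "head N e \<in> curve N f ` {0..1}"
    using imageI[of 1 "{0..1}" "curve N e"] imageI[of 0 "{0..1}" "curve N f"] unfolding ef(3) by simp_all
  ultimately have "f = e" using ef(2) unfolding loop_edge_def by blast
  then show ?thesis using False ef(1) by (simp add: highway_step_def turn_def)
qed

lemma crossing_iff_highway_passage: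
  assumes "highway_step p" shows "highway_passage N p \<longleftrightarrow> crossing p"
proof -
  obtain e f where p: "p = (e, f)" by (cases p)
  have "crossing p" if hp: "highway_passage N p"
  proof (rule ccontr)
    assume nc: "\<not> crossing p"
    have h: "head N e \<in> verts N" "e = highway_in N (head N e)" "f = highway_out N (head N e)"
      using hp by (simp_all add: highway_passage_def p)
    obtain v where v: "v \<in> iverts" "e = highway_in N v \<and> f = underway_out N v \<or> e = underway_in N v \<and> f = highway_out N v"
      using assms nc h(1) unfolding highway_step_def turn_def p by auto
    have "head N e = v" using v(2) ends_at_interior[OF v(1)] by auto
    then show False using h(2,3) v(2) edges_at_interior(3,4)[OF v(1)] by auto
  qed
  moreover have "highway_passage N p" if c: "crossing p"
  proof -
    obtain v where v: "v \<in> iverts" "e = highway_in N v" "f = highway_out N v"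
      using c unfolding crossing_def p by auto
    have "head N e = v" using v ends_at_interior by simp
    moreover have "v \<in> verts N" using v(1) by (simp add: interior_verts_def)
    ultimately show ?thesis using v by (simp add: highway_passage_def p)
  qed
  ultimately show ?thesis by blast
qed

text \<open>For paths and cycles alike, all that matters is how often the edges (\<open>M\<close>) and the passages (\<open>P\<close>)
  occur. Away from the boundary each use of an edge is followed and preceded by a passage.\<close>

definition highway_flow :: "'e multiset \<Rightarrow> ('e \<times> 'e) multiset \<Rightarrow> bool" where
  "highway_flow M P \<longleftrightarrow> set_mset M \<subseteq> edges N \<and> (\<forall>p\<in>#P. highway_step p) \<and>
     (\<forall>e\<in>edges N. (head N e \<notin> bverts \<longrightarrow> count M e = count (image_mset fst P) e) \<and>
        (tail N e \<notin> bverts \<longrightarrow> count M e = count (image_mset snd P) e))"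

lemma highway_path_flow:
  assumes q: "highway_path N u q v" and uv: "u \<in> bverts" "v \<in> bverts"
  shows "highway_flow (mset q) (mset (path_passages q))" "set q \<subseteq> edges N"
    "set (path_passages q) \<subseteq> edges N \<times> edges N" "q \<noteq> [] \<Longrightarrow> tail N (hd q) = u \<and> head N (last q) = v"
proof -
  have w: "walk N u q v" and ok: "\<forall>p\<in>set (path_passages q). \<not> forbidden_passage N p"
    using q by (simp_all add: highway_path_def)
  show qe: "set q \<subseteq> edges N" using w by (induction N u q v rule: walk.induct) auto
  show ends: "q \<noteq> [] \<Longrightarrow> tail N (hd q) = u \<and> head N (last q) = v" using w
    by (induction N u q v rule: walk.induct) (auto split: if_splits)
  show pe: "set (path_passages q) \<subseteq> edges N \<times> edges N"
  proof
    fix p assume p: "p \<in> set (path_passages q)"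
    obtain e f where ef1: "p = (e, f)" by (cases p)
    have "(e, f) \<in> set (zip q (tl q))" using p unfolding ef1 path_passages_def .
    note ef = ef1 this
    have "set (tl q) \<subseteq> set q" by (cases q) auto
    then have "e \<in> set q" "f \<in> set q" using set_zip_leftD[OF ef(2)] set_zip_rightD[OF ef(2)] by blast+
    then show "p \<in> edges N \<times> edges N" using qe ef(1) by blast
  qed
  have adj: "head N e = tail N f" if "(e, f) \<in> set (path_passages q)" for e f
    using w that
  proof (induction q arbitrary: u rule: induct_list012)
    case (3 x y zs)
    from 3(4) consider "e = x" "f = y" | "(e, f) \<in> set (path_passages (y # zs))" by auto
    then show ?case
    proof cases
      case 1
      then show ?thesis using 3(3) by simp
    next
      case 2
      then show ?thesis using 3(2)[of "head N x"] 3(3) by simp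
    qed
  qed simp_all
  have "highway_step p" if "p \<in> set (path_passages q)" for p
  proof -
    obtain e f where p: "p = (e, f)" by (cases p)
    have "(e, f) \<in> edges N \<times> edges N" using pe that unfolding p by blast
    then have "e \<in> edges N" "f \<in> edges N" by blast+
    then show ?thesis unfolding p
      by (rule passage_is_highway_step) (use adj ok that in \<open>simp_all add: p\<close>)
  qed
  moreover have "count (mset q) e = count (mset (butlast q)) e" if "head N e \<notin> bverts" for e
  proof (cases "q = []")
    case False
    then have "e \<noteq> last q" using ends that uv by auto
    moreover have "mset q = mset (butlast q) + {#last q#}"
      using False by (metis append_butlast_last_id mset.simps mset_append)
    ultimately show ?thesis by simp
  qed simp
  moreover have "count (mset q) e = count (mset (tl q)) e" if "tail N e \<notin> bverts" for e
  proof (cases q)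
    case (Cons x xs)
    then have "e \<noteq> x" using ends that uv by auto
    then show ?thesis using Cons by simp
  qed simp
  ultimately show "highway_flow (mset q) (mset (path_passages q))"
    unfolding highway_flow_def mset_fst_path_passages mset_snd_path_passages using qe by simp
qed

lemma highway_closed_walk_flow:
  assumes q: "highway_closed_walk N q"
  shows "highway_flow (mset q) (mset (cyclic_passages q))" "set q \<subseteq> edges N"
    "set (cyclic_passages q) \<subseteq> edges N \<times> edges N" "q \<noteq> []"
proof -
  have w: "q \<noteq> []" "set q \<subseteq> edges N" "\<forall>(e, f)\<in>set (cyclic_passages q). head N e = tail N f"
    and ok: "\<forall>p\<in>set (cyclic_passages q). \<not> forbidden_passage N p"
    using q by (simp_all add: highway_closed_walk_def closed_walk_def)
  show "q \<noteq> []" "set q \<subseteq> edges N" by (fact w)+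
  show pe: "set (cyclic_passages q) \<subseteq> edges N \<times> edges N"
  proof
    fix p assume p: "p \<in> set (cyclic_passages q)"
    obtain e f where ef1: "p = (e, f)" by (cases p)
    have "(e, f) \<in> set (zip q (rotate1 q))" using p unfolding ef1 cyclic_passages_def .
    note ef = ef1 this
    have "e \<in> set q" "f \<in> set q" using set_zip_leftD[OF ef(2)] set_zip_rightD[OF ef(2)] by simp_all
    then show "p \<in> edges N \<times> edges N" using w(2) ef(1) by blast
  qed
  have "highway_step p" if "p \<in> set (cyclic_passages q)" for p
  proof -
    obtain e f where p: "p = (e, f)" by (cases p)
    have "(e, f) \<in> edges N \<times> edges N" using pe that unfolding p by blast
    moreover have "head N e = tail N f" using w(3) that unfolding p by blast
    moreover have "\<not> forbidden_passage N (e, f)" using ok that unfolding p by blast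
    ultimately show ?thesis unfolding p by (intro passage_is_highway_step) blast+
  qed
  then show "highway_flow (mset q) (mset (cyclic_passages q))"
    unfolding highway_flow_def mset_fst_cyclic_passages mset_snd_cyclic_passages using w(2) by simp
qed

lemma singular_chain_walk_chain:
  assumes "set es \<subseteq> edges N" shows "singular_chain 1 S (walk_chain N es)"
  using assms unfolding walk_chain_def
proof (induction es)
  case (Cons e es)
  then have "pathin S (curve N e)" by (simp add: pathin_curve)
  then have "singular_chain 1 S (frag_of (edge_simplex N e))"
    by (simp only: singular_chain_of singular_simplex_edge_simplex)
  with Cons show ?case by (simp del: One_nat_def add: singular_chain_add)
qed simp

lemma count_image_mset_eq_sum:
  assumes "finite X" "\<And>p. p \<in># P \<Longrightarrow> g p = x \<Longrightarrow> p \<in> X" "\<And>p. p \<in> X \<Longrightarrow> g p = x"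
  shows "count (image_mset g P) x = sum (count P) X"
proof -
  have "g -` {x} \<inter> set_mset P \<subseteq> X" using assms(2) by blast
  moreover have "\<forall>p\<in>X - g -` {x} \<inter> set_mset P. count P p = 0" using assms(3) by (auto simp: not_in_iff)
  ultimately show ?thesis unfolding count_image_mset by (intro sum.mono_neutral_left assms(1))
qed

text \<open>Every passage at an interior vertex is of one of three types, so the numbers of passages determine
  how often the four edges are used.\<close>

lemma flow_counts:
  assumes flow: "highway_flow M P" and v: "v \<in> iverts"
  defines "e1 \<equiv> highway_in N v" and "e2 \<equiv> underway_in N v" and "f1 \<equiv> highway_out N v" and "f2 \<equiv> underway_out N v"
  shows "count M e1 = count P (e1, f1) + count P (e1, f2)" "count M e2 = count P (e2, f1)"
    "count M f1 = count P (e1, f1) + count P (e2, f1)" "count M f2 = count P (e1, f2)"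
proof -
  have ne: "e1 \<noteq> e2" "f1 \<noteq> f2" using edges_at_interior(3,4)[OF v] by (simp_all add: e1_def e2_def f1_def f2_def)
  have E: "e1 \<in> edges N" "e2 \<in> edges N" "f1 \<in> edges N" "f2 \<in> edges N"
    and h: "head N e1 = v" "head N e2 = v" and t: "tail N f1 = v" "tail N f2 = v"
    using ends_at_interior[OF v] by (simp_all add: e1_def e2_def f1_def f2_def)
  have vV: "v \<in> verts N" using v by (simp add: interior_verts_def)
  have step: "highway_step p" if "p \<in># P" for p using flow that by (simp add: highway_flow_def)
  have through: "p = (e1, f1) \<or> p = (e1, f2) \<or> p = (e2, f1)"
    if p: "p \<in># P" "head N (fst p) = v \<or> tail N (snd p) = v" for p
  proof -
    obtain e f where ef: "p = (e, f)" by (cases p)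
    have st: "highway_step (e, f)" using step[OF p(1)] ef by simp
    have loop: "\<not> (e = f \<and> e \<in> edges N \<and> head N e \<notin> verts N)"
    proof
      assume *: "e = f \<and> e \<in> edges N \<and> head N e \<notin> verts N"
      then have "loop_edge S A N e" using arc_or_loop[of e] by (auto simp: arc_edge_def)
      then have "tail N e = head N e" by (simp add: loop_edge_def)
      then show False using * p(2) vV ef by auto
    qed
    obtain w where w: "w \<in> iverts" "e = highway_in N w \<and> f = highway_out N w \<or>
        e = highway_in N w \<and> f = underway_out N w \<or> e = underway_in N w \<and> f = highway_out N w"
      using st loop unfolding highway_step_def crossing_def turn_def by auto
    have "head N e = w" "tail N f = w" using w ends_at_interior[OF w(1)] by auto
    then have "w = v" using p(2) ef by simp
    then show ?thesis using w(2) ef by (auto simp: e1_def e2_def f1_def f2_def)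
  qed
  have nb: "v \<notin> bverts" by (rule interior_not_boundary[OF v])
  have M: "count M e1 = count (image_mset fst P) e1" "count M e2 = count (image_mset fst P) e2"
    "count M f1 = count (image_mset snd P) f1" "count M f2 = count (image_mset snd P) f2"
    using flow E h t nb by (simp_all add: highway_flow_def)
  have "p \<in> {(e1, f1), (e1, f2)}" if "p \<in># P" "fst p = e1" for p
    using through[OF that(1)] that(2) h(1) ne by auto
  then have "count (image_mset fst P) e1 = sum (count P) {(e1, f1), (e1, f2)}"
    by (intro count_image_mset_eq_sum) auto
  then show "count M e1 = count P (e1, f1) + count P (e1, f2)" using M(1) ne by simp
  have "p \<in> {(e2, f1)}" if "p \<in># P" "fst p = e2" for p
    using through[OF that(1)] that(2) h(2) ne by auto
  then have "count (image_mset fst P) e2 = sum (count P) {(e2, f1)}"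
    by (intro count_image_mset_eq_sum) auto
  then show "count M e2 = count P (e2, f1)" using M(2) by simp
  have "p \<in> {(e1, f1), (e2, f1)}" if "p \<in># P" "snd p = f1" for p
    using through[OF that(1)] that(2) t(1) ne by auto
  then have "count (image_mset snd P) f1 = sum (count P) {(e1, f1), (e2, f1)}"
    by (intro count_image_mset_eq_sum) auto
  then show "count M f1 = count P (e1, f1) + count P (e2, f1)" using M(3) ne by simp
  have "p \<in> {(e1, f2)}" if "p \<in># P" "snd p = f2" for p
    using through[OF that(1)] that(2) t(2) ne by auto
  then have "count (image_mset snd P) f2 = sum (count P) {(e1, f2)}"
    by (intro count_image_mset_eq_sum) auto
  then show "count M f2 = count P (e1, f2)" using M(4) by simp
qed

lemma number_of_crossings:
  assumes flow: "highway_flow M P"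
  shows "size (filter_mset (highway_passage N) P) = (\<Sum>v\<in>iverts. count P (highway_in N v, highway_out N v))"
proof -
  let ?p = "\<lambda>v. (highway_in N v, highway_out N v)"
  let ?F = "filter_mset (highway_passage N) P"
  have step: "highway_step p" if "p \<in># P" for p using flow that by (simp add: highway_flow_def)
  have fin: "finite iverts" using network by (simp add: oriented_network_def interior_verts_def)
  have inj: "inj_on ?p iverts" by (rule inj_onI) (metis ends_at_interior(2) prod.inject)
  have cr: "crossing (?p v)" if "v \<in> iverts" for v using that by (auto simp: crossing_def)
  have "set_mset ?F \<subseteq> ?p ` iverts"
  proof
    fix p assume "p \<in># ?F"
    then have "p \<in># P" "highway_passage N p" by simp_all
    then have "crossing p" using crossing_iff_highway_passage[OF step] by blast
    then show "p \<in> ?p ` iverts" by (auto simp: crossing_def)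
  qed
  then have "size ?F = sum (count ?F) (?p ` iverts)"
    unfolding size_multiset_overloaded_eq using fin by (intro sum.mono_neutral_left) (auto simp: not_in_iff)
  also have "\<dots> = (\<Sum>v\<in>iverts. count ?F (?p v))" by (simp add: sum.reindex[OF inj])
  also have "\<dots> = (\<Sum>v\<in>iverts. count P (?p v))"
  proof (rule sum.cong[OF refl])
    fix v assume "v \<in> iverts"
    then have "highway_step (?p v)" "crossing (?p v)" using cr by (simp_all add: highway_step_def)
    then have "highway_passage N (?p v)" using crossing_iff_highway_passage by blast
    then show "count ?F (?p v) = count P (?p v)" by simp
  qed
  finally show ?thesis .
qed

definition null_homologous :: "('e \<Rightarrow> int) \<Rightarrow> bool" where
  "null_homologous a \<longleftrightarrow>
     singular_relboundary 1 S {} (\<Sum>e\<in>edges N. frag_cmul (a e) (frag_of (edge_simplex N e)))"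

lemma null_homologous_diff:
  assumes q: "set q \<subseteq> edges N" "set q' \<subseteq> edges N"
  shows "null_homologous (\<lambda>e. int (count (mset q') e) - int (count (mset q) e)) \<longleftrightarrow>
    singular_relboundary 1 S {} (walk_chain N q' - walk_chain N q)"
  unfolding null_homologous_def walk_chain_count[OF finite_edges q(1)] walk_chain_count[OF finite_edges q(2)]
  by (simp only: frag_cmul_diff_distrib sum_subtractf)

text \<open>Homologous highway walks have the same number of crossings. If \<open>a\<close> is the difference of the numbers
  of uses of the edges, the numbers of crossings at \<open>v\<close> differ by \<open>a(e1) - a(f2) = r(f2) - r(e1)\<close>, and since
  \<open>r(e2) = r(f1)\<close> this is the sum of \<open>r\<close> over the outgoing edges minus the sum over the incoming edges.
  In the total over all \<open>v\<close> everything cancels, because \<open>r\<close> vanishes on the edges that end at the boundary.\<close>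

lemma homologous_flows_crossings:
  assumes flow: "highway_flow M P" "highway_flow M' P'"
    and null: "null_homologous (\<lambda>e. int (count M' e) - int (count M e))"
  shows "size (filter_mset (highway_passage N) P') = size (filter_mset (highway_passage N) P)"
proof -
  let ?a = "\<lambda>e. int (count M' e) - int (count M e)"
  let ?n = "\<lambda>P v. int (count P (highway_in N v, highway_out N v))"
  obtain l r where lr: "side_values ?a l r"
    using edge_sides[OF null[unfolded null_homologous_def]] by blast
  have fin: "finite iverts" using network by (simp add: oriented_network_def interior_verts_def)
  have diff: "?n P' v - ?n P v = (\<Sum>e\<in>out_edges N v. r e) - (\<Sum>e\<in>in_edges N v. r e)" if v: "v \<in> iverts" for v
  proof -
    have "?n P' v - ?n P v = ?a (highway_in N v) - ?a (underway_out N v)"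
      using flow_counts(1,4)[OF flow(1) v] flow_counts(1,4)[OF flow(2) v] by simp
    also have "\<dots> = r (underway_out N v) - r (highway_in N v)"
      using lr v by (simp add: side_values_def)
    also have "\<dots> = (\<Sum>e\<in>out_edges N v. r e) - (\<Sum>e\<in>in_edges N v. r e)"
      using edges_at_interior(1-4)[OF v] lr v by (simp add: side_values_def)
    finally show ?thesis .
  qed
  have out: "(\<Sum>v\<in>iverts. \<Sum>e\<in>out_edges N v. r e) = (\<Sum>e | e \<in> edges N \<and> tail N e \<in> iverts. r e)"
    and inn: "(\<Sum>v\<in>iverts. \<Sum>e\<in>in_edges N v. r e) = (\<Sum>e | e \<in> edges N \<and> head N e \<in> iverts. r e)"
  proof -
    have g: "(\<Sum>v\<in>iverts. \<Sum>e | e \<in> edges N \<and> g e = v. r e) = (\<Sum>e | e \<in> edges N \<and> g e \<in> iverts. r e)" for g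
    proof -
      have "(\<Sum>v\<in>iverts. \<Sum>e | e \<in> {e \<in> edges N. g e \<in> iverts} \<and> g e = v. r e) = (\<Sum>e | e \<in> edges N \<and> g e \<in> iverts. r e)"
        by (rule sum.group) (use fin finite_edges in auto)
      moreover have "{e. e \<in> {e \<in> edges N. g e \<in> iverts} \<and> g e = v} = {e. e \<in> edges N \<and> g e = v}" if "v \<in> iverts" for v
        using that by auto
      ultimately show ?thesis by simp
    qed
    show "(\<Sum>v\<in>iverts. \<Sum>e\<in>out_edges N v. r e) = (\<Sum>e | e \<in> edges N \<and> tail N e \<in> iverts. r e)"
      "(\<Sum>v\<in>iverts. \<Sum>e\<in>in_edges N v. r e) = (\<Sum>e | e \<in> edges N \<and> head N e \<in> iverts. r e)"
      unfolding out_edges_def in_edges_def by (rule g)+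
  qed
  have swap: "(\<Sum>e | e \<in> edges N \<and> tail N e \<in> iverts. r e) = (\<Sum>e | e \<in> edges N \<and> head N e \<in> iverts. r e)"
  proof -
    have *: "(\<Sum>e | e \<in> edges N \<and> g e \<in> iverts. r e) = (\<Sum>e\<in>edges N. if g e \<in> iverts then r e else 0)" for g
      by (rule sum.inter_filter[OF finite_edges])
    have "(if tail N e \<in> iverts then r e else 0) = (if head N e \<in> iverts then r e else 0)" if e: "e \<in> edges N" for e
    proof (cases "tail N e \<in> bverts \<or> head N e \<in> bverts")
      case True
      then show ?thesis using lr e by (auto simp: side_values_def)
    next
      case False
      have "tail N e \<in> verts N \<longleftrightarrow> head N e \<in> verts N"
        using arc_or_loop[OF e] by (auto simp: arc_edge_def loop_edge_def)
      then show ?thesis using False verts_cases interior_not_boundary by auto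
    qed
    then show ?thesis unfolding * by (intro sum.cong) auto
  qed
  have "int (size (filter_mset (highway_passage N) P')) - int (size (filter_mset (highway_passage N) P)) =
      (\<Sum>v\<in>iverts. ?n P' v - ?n P v)"
    unfolding number_of_crossings[OF flow(1)] number_of_crossings[OF flow(2)] by (simp add: sum_subtractf)
  also have "\<dots> = (\<Sum>v\<in>iverts. (\<Sum>e\<in>out_edges N v. r e) - (\<Sum>e\<in>in_edges N v. r e))"
    by (rule sum.cong[OF refl diff])
  also have "\<dots> = 0" unfolding sum_subtractf out inn swap by simp
  finally show ?thesis by simp
qed

definition balanced_increment :: "('e \<Rightarrow> int) \<Rightarrow> bool" where
  "balanced_increment a \<longleftrightarrow> (\<forall>v\<in>iverts. a (highway_in N v) = a (underway_out N v) \<and>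
     a (underway_in N v) = a (highway_out N v) \<and> 0 \<le> a (highway_in N v) \<and> 0 \<le> a (highway_out N v))"

text \<open>If a flow contains another one with the same number of crossings, then all additional passages
  are turns.\<close>

lemma flow_increment:
  assumes flow: "highway_flow M P" "highway_flow M' P'" and sub: "P \<subset># P'"
    and size: "size (filter_mset (highway_passage N) P') = size (filter_mset (highway_passage N) P)"
  shows "balanced_increment (\<lambda>e. int (count M' e) - int (count M e))"
proof -
  have le: "count P p \<le> count P' p" for p using sub by (simp add: mset_subset_eq_count subset_mset.less_imp_le)
  have fin: "finite iverts" using network by (simp add: oriented_network_def interior_verts_def)
  have same: "count P (highway_in N v, highway_out N v) = count P' (highway_in N v, highway_out N v)"
    if v: "v \<in> iverts" for v
  proof (rule ccontr)
    assume "\<not> ?thesis"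
    then have "count P (highway_in N v, highway_out N v) < count P' (highway_in N v, highway_out N v)"
      using le by (simp add: order_less_le)
    then have "(\<Sum>v\<in>iverts. count P (highway_in N v, highway_out N v)) < (\<Sum>v\<in>iverts. count P' (highway_in N v, highway_out N v))"
      using v le fin by (intro sum_strict_mono_ex1) auto
    then show False using size number_of_crossings[OF flow(1)] number_of_crossings[OF flow(2)] by simp
  qed
  show ?thesis unfolding balanced_increment_def
  proof
    fix v assume v: "v \<in> iverts"
    show "int (count M' (highway_in N v)) - int (count M (highway_in N v)) =
          int (count M' (underway_out N v)) - int (count M (underway_out N v)) \<and>
        int (count M' (underway_in N v)) - int (count M (underway_in N v)) =
          int (count M' (highway_out N v)) - int (count M (highway_out N v)) \<and>
        0 \<le> int (count M' (highway_in N v)) - int (count M (highway_in N v)) \<and>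
        0 \<le> int (count M' (highway_out N v)) - int (count M (highway_out N v))"
      using flow_counts[OF flow(1) v] flow_counts[OF flow(2) v] same[OF v] le by simp
  qed
qed

text \<open>An edge from which a passage starts does not end at the boundary, so its uses are exactly the
  passages that start from it.\<close>

lemma extra_passage:
  assumes flow: "highway_flow M P" "highway_flow M' P'" and sub: "P \<subset># P'"
  shows "\<exists>e f. (e, f) \<in># P' \<and> count M e < count M' e"
proof -
  have "P' - P \<noteq> {#}" using sub by (metis subset_mset.less_le_not_le Diff_eq_empty_iff_mset)
  then obtain e f where ef: "(e, f) \<in># P' - P" by (metis multiset_nonemptyE surj_pair)
  then have ef': "(e, f) \<in># P'" by (rule in_diffD)
  then have st: "highway_step (e, f)" using flow(2) by (simp add: highway_flow_def)
  have e: "e \<in> edges N \<and> head N e \<notin> bverts"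
    using st ends_at_interior interior_not_boundary verts_cases
    unfolding highway_step_def crossing_def turn_def by auto
  have "image_mset fst P' = image_mset fst P + image_mset fst (P' - P)"
    using sub by (metis image_mset_union subset_mset.add_diff_inverse subset_mset.less_imp_le)
  moreover have "e \<in># image_mset fst (P' - P)" using ef by force
  then have "0 < count (image_mset fst (P' - P)) e" by simp
  ultimately have "count (image_mset fst P) e < count (image_mset fst P') e" by simp
  then have "count M e < count M' e" using flow e by (simp add: highway_flow_def)
  then show ?thesis using ef' by blast
qed

text \<open>The heart of the finiteness proof. If \<open>a\<close> does not change at turns and is nonnegative, then along a
  highway walk \<open>l\<close> and \<open>r\<close> are constant at turns and can only decrease at crossings. Indeed, at
  a crossing \<open>l(f1) = r(f2) = r(e1) = l(e1) - a(e1)\<close>.\<close>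

lemma sides_decrease:
  assumes lr: "side_values a l r" and a: "balanced_increment a" and step: "highway_step (e, f)"
  shows "l f \<le> l e" "r f \<le> r e" "crossing (e, f) \<Longrightarrow> r f = r e - a f"
proof -
  have cr: "l f = l e - a e \<and> r f = r e - a f \<and> 0 \<le> a e \<and> 0 \<le> a f" if c: "crossing (e, f)"
  proof -
    obtain v where v: "v \<in> iverts" "e = highway_in N v" "f = highway_out N v" using c by (auto simp: crossing_def)
    then show ?thesis using lr a unfolding side_values_def balanced_increment_def by fastforce
  qed
  have tu: "l f = l e \<and> r f = r e" if t: "turn (e, f)"
  proof -
    consider v where "v \<in> iverts" "e = highway_in N v" "f = underway_out N v"
      | v where "v \<in> iverts" "e = underway_in N v" "f = highway_out N v" | "e = f"
      using t by (auto simp: turn_def)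
    then show ?thesis
      using lr a unfolding side_values_def balanced_increment_def by cases fastforce+
  qed
  show "l f \<le> l e" "r f \<le> r e" using cr tu step by (auto simp: highway_step_def)
  show "crossing (e, f) \<Longrightarrow> r f = r e - a f" using cr by blast
qed

text \<open>A path from the boundary to the boundary starts and ends with \<open>l = r = 0\<close>, so \<open>l = r = 0\<close> all along it.
  Hence it cannot use an edge more often than a homologous path whose passages it contains.\<close>

theorem finite_homologous_highway_paths:
  assumes uv: "u \<in> bverts" "v \<in> bverts"
  shows "finite {q. highway_path N u q v \<and> homologous_paths S N q p}" (is "finite ?Q")
proof (rule ccontr)
  assume "infinite ?Q"
  then have "\<exists>q\<in>?Q. \<exists>q'\<in>?Q. mset (path_passages q) \<subset># mset (path_passages q')"
    using highway_path_flow[OF _ uv]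
    by (intro walks_with_more_passages[OF _ finite_edges]) (auto simp: path_passages_def)
  then obtain q q' where q: "highway_path N u q v" "homologous_paths S N q p"
    and q': "highway_path N u q' v" "homologous_paths S N q' p"
    and sub: "mset (path_passages q) \<subset># mset (path_passages q')" by blast
  note fl = highway_path_flow(1,2)[OF q(1) uv] and fl' = highway_path_flow(1,2,4)[OF q'(1) uv]
  let ?a = "\<lambda>e. int (count (mset q') e) - int (count (mset q) e)"
  have null: "null_homologous ?a"
    unfolding null_homologous_diff[OF fl(2) fl'(2)] by (rule homologous_paths_diff[OF q'(2) q(2)])
  obtain l r where lr: "side_values ?a l r"
    using edge_sides[OF null[unfolded null_homologous_def]] by blast
  note inc = flow_increment[OF fl(1) fl'(1) sub homologous_flows_crossings[OF fl(1) fl'(1) null]]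
  note dec = sides_decrease[OF lr inc]
  obtain e f where ef: "(e, f) \<in># mset (path_passages q')" "count (mset q) e < count (mset q') e"
    using extra_passage[OF fl(1) fl'(1) sub] by blast
  have e: "e \<in> set q'" using ef(2) by (metis count_mset_0_iff not_less_zero)
  then have ne: "q' \<noteq> []" by auto
  have hd: "l (hd q') = 0" "r (hd q') = 0" "l (last q') = 0" "r (last q') = 0"
  proof -
    have "hd q' \<in> edges N" "last q' \<in> edges N" using ne fl'(2) by auto
    then show "l (hd q') = 0" "r (hd q') = 0" "l (last q') = 0" "r (last q') = 0"
      using lr fl'(3)[OF ne] uv unfolding side_values_def by auto
  qed
  have step: "highway_step (x, y)" if "(x, y) \<in> set (path_passages q')" for x y
    using fl'(1) that by (auto simp: highway_flow_def)
  have "l e = l (hd q')" by (rule constant_along_passages[OF _ _ e]) (use dec(1) step hd in auto)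
  moreover have "r e = r (hd q')" by (rule constant_along_passages[OF _ _ e]) (use dec(2) step hd in auto)
  moreover have "?a e = l e - r e" using lr unfolding side_values_def by blast
  ultimately show False using hd ef(2) by simp
qed

text \<open>Along a closed highway walk \<open>l\<close> and \<open>r\<close> are constant as well, so a crossing gives \<open>a = 0\<close>.
  Without crossings, both \<open>a\<close> and the multiplicity \<open>m\<close> of the edges in the walk are constant along the walk,
  hence proportional. Then a positive multiple of the class of the walk vanishes, and so does the
  class because the homology group is torsion-free.\<close>

theorem finite_homologous_highway_closed_walks:
  assumes c: "c \<noteq> \<one>\<^bsub>homology_group 1 S\<^esub>"
  shows "finite {q. highway_closed_walk N q \<and> H1_class S (walk_chain N q) = c}" (is "finite ?Q")
proof (rule ccontr)
  assume "infinite ?Q"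
  then have "\<exists>q\<in>?Q. \<exists>q'\<in>?Q. mset (cyclic_passages q) \<subset># mset (cyclic_passages q')"
    using highway_closed_walk_flow
    by (intro walks_with_more_passages[OF _ finite_edges]) (auto simp: cyclic_passages_def)
  then obtain q q' where q: "highway_closed_walk N q" "H1_class S (walk_chain N q) = c"
    and q': "highway_closed_walk N q'" "H1_class S (walk_chain N q') = c"
    and sub: "mset (cyclic_passages q) \<subset># mset (cyclic_passages q')" by blast
  note fl = highway_closed_walk_flow(1,2)[OF q(1)] and fl' = highway_closed_walk_flow(1,2,4)[OF q'(1)]
  define a where "a = (\<lambda>e. int (count (mset q') e) - int (count (mset q) e))"
  have null: "null_homologous a"
    unfolding a_def null_homologous_diff[OF fl(2) fl'(2)]
    by (simp only: H1_class_eq_iff[symmetric] q(2) q'(2))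
  obtain l r where lr: "side_values a l r"
    using edge_sides[OF null[unfolded null_homologous_def]] by blast
  note size = homologous_flows_crossings[OF fl(1) fl'(1) null[unfolded a_def]]
  note inc = flow_increment[OF fl(1) fl'(1) sub size, folded a_def]
  note dec = sides_decrease[OF lr inc]
  obtain e f where ef: "(e, f) \<in># mset (cyclic_passages q')" "count (mset q) e < count (mset q') e"
    using extra_passage[OF fl(1) fl'(1) sub] by blast
  have e: "e \<in> set q'" using ef(2) by (metis count_mset_0_iff not_less_zero)
  have ae: "0 < a e" using ef(2) by (simp add: a_def)
  let ?es = "q' @ [hd q']"
  have pas: "path_passages ?es = cyclic_passages q'" by (rule cyclic_passages_unroll[symmetric, OF fl'(3)])
  have step: "highway_step (x, y)" if "(x, y) \<in> set (path_passages ?es)" for x y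
    using fl'(1) that unfolding pas by (auto simp: highway_flow_def)
  have const: "h x = h (hd q')" if "\<And>x y. (x, y) \<in> set (path_passages ?es) \<Longrightarrow> h y \<le> h x" "x \<in> set q'"
    for h :: "'e \<Rightarrow> int" and x
    using constant_along_passages[of ?es h x] that fl'(3) by (auto simp: hd_append)
  have l: "l x = l (hd q')" and r: "r x = r (hd q')" if "x \<in> set q'" for x
    using const[of l x] const[of r x] dec(1,2) step that by blast+
  have a_const: "a x = a e" if "x \<in> set q'" for x
    using l[OF that] r[OF that] l[OF e] r[OF e] lr by (simp add: side_values_def)
  show False
  proof (cases "\<exists>x y. (x, y) \<in> set (cyclic_passages q') \<and> crossing (x, y)")
    case True
    then obtain x y where xy: "(x, y) \<in> set (cyclic_passages q')" "crossing (x, y)" by blast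
    have mem: "x \<in> set q'" "y \<in> set q'"
      using xy(1) unfolding cyclic_passages_def by (auto dest: set_zip_leftD set_zip_rightD)
    have "r y = r x - a y" by (rule dec(3)[OF _ xy(2)]) (use xy(2) in \<open>simp add: highway_step_def\<close>)
    then have "a y = 0" using r[OF mem(1)] r[OF mem(2)] by simp
    then show False using a_const[OF mem(2)] ae by simp
  next
    case False
    define m where "m = (\<lambda>e. int (count (mset q') e))"
    have m_turn: "m y = m x" if xy: "(x, y) \<in> set (path_passages ?es)" for x y
    proof -
      have "\<not> crossing (x, y)" using False xy unfolding pas by blast
      then have t: "turn (x, y)" using step[OF xy] by (simp add: highway_step_def)
      have zero: "count (mset (cyclic_passages q')) (highway_in N v, highway_out N v) = 0" if "v \<in> iverts" for v
        using False that by (auto simp: crossing_def count_mset_0_iff)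
      show ?thesis using t flow_counts[OF fl'(1)] zero unfolding turn_def m_def by auto
    qed
    have m_const: "m x = m e" if "x \<in> set q'" for x
      using const[of m x] const[of m e] m_turn that e by fastforce
    have me: "0 < m e" using e by (simp add: m_def count_greater_zero_iff)
    have sub': "mset q \<subseteq># mset q'"
      using image_mset_subseteq_mono[of "mset (cyclic_passages q)" "mset (cyclic_passages q')" fst] sub
      unfolding mset_fst_cyclic_passages by (simp add: subset_mset.less_imp_le)
    have proportional: "m e * a x = a e * m x" for x
    proof (cases "x \<in> set q'")
      case True
      then show ?thesis using a_const m_const by simp
    next
      case False
      then have "x \<notin> set q" using set_mset_mono[OF sub'] by auto
      then have "count (mset q) x = 0" "count (mset q') x = 0" using False by (simp_all only: count_mset_0_iff not_False_eq_True)
      then show ?thesis unfolding a_def m_def by presburger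
    qed
    have "frag_cmul (a e) (walk_chain N q') = (\<Sum>x\<in>edges N. frag_cmul (a e * m x) (frag_of (edge_simplex N x)))"
      unfolding walk_chain_count[OF finite_edges fl'(2)] m_def by (simp add: frag_cmul_sum o_def)
    also have "\<dots> = frag_cmul (m e) (\<Sum>x\<in>edges N. frag_cmul (a x) (frag_of (edge_simplex N x)))"
      unfolding proportional[symmetric] by (simp add: frag_cmul_sum o_def)
    finally have multiple: "frag_cmul (a e) (walk_chain N q') =
        frag_cmul (m e) (\<Sum>x\<in>edges N. frag_cmul (a x) (frag_of (edge_simplex N x)))" .
    have rel: "singular_relboundary 1 S {} (frag_cmul (a e) (walk_chain N q'))"
      unfolding multiple by (rule singular_relboundary_cmul[OF null[unfolded null_homologous_def]])
    have cw: "closed_walk N q'" using q'(1) by (simp add: highway_closed_walk_def)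
    have "singular_chain 1 S (walk_chain N q')" by (rule singular_chain_walk_chain[OF fl'(2)])
    then have "singular_relboundary 1 S {} (walk_chain N q')"
      by (rule H1_torsion_free[OF ae _ closed_boundary[OF cw] rel])
    then have "H1_class S (walk_chain N q') = \<one>\<^bsub>homology_group 1 S\<^esub>" unfolding H1_class_eq_one_iff .
    then show False using c q'(2) by blast
  qed
qed

end

section \<open>The measurements\<close>

lemma formal_sum_homogeneous:
  assumes Q: "finite Q" and d: "\<And>q q'. q \<in> Q \<Longrightarrow> q' \<in> Q \<Longrightarrow> monomial_degree (wt q) = monomial_degree (wt q')"
  shows "\<exists>M. has_formal_sum Q c wt M \<and> is_homogeneous_polynomial M"
proof -
  define P where "P = (\<Sum>q\<in>Q. Poly_Mapping.single (wt q) (c q))"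
  have P: "Poly_Mapping.lookup P m = (\<Sum>q | q \<in> Q \<and> wt q = m. c q)" for m
    unfolding P_def lookup_sum lookup_single when_def by (simp add: sum.inter_filter[OF Q])
  have "has_formal_sum Q c wt (Poly_Mapping.lookup P)" using Q P by (simp add: has_formal_sum_def)
  moreover have "homogeneous P"
  proof -
    have supp: "\<exists>q\<in>Q. wt q = m" if "m \<in> Poly_Mapping.keys P" for m
    proof (rule ccontr)
      assume "\<not> ?thesis"
      then have "{q. q \<in> Q \<and> wt q = m} = {}" by auto
      then show False using that P[of m] by (simp only: in_keys_iff sum.empty) 
    qed
    show ?thesis
    proof (cases "Q = {}")
      case True
      then show ?thesis by (simp add: homogeneous_def P_def)
    next
      case False
      then obtain q0 where "q0 \<in> Q" by blast
      then show ?thesis unfolding homogeneous_def using supp d by metis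
    qed
  qed
  ultimately show ?thesis unfolding is_homogeneous_polynomial_def by blast
qed

theorem theorem2p4:
  fixes S :: "'a topology" and A :: "'a chart set" and N :: "('a, 'e) network"
  assumes "compact_connected_oriented_surface S A"
    and "simple_crossing_network S A N"
  shows "(\<forall>u \<in> boundary_verts S A N. \<forall>v \<in> boundary_verts S A N. \<forall>p. walk N u p v \<longrightarrow>
            (\<exists>M. has_boundary_measurement S N u p v M \<and> is_homogeneous_polynomial M)) \<and>
         (\<forall>p \<in> cycles N. cycle_class S N p \<noteq> \<one>\<^bsub>homology_group 1 S\<^esub> \<longrightarrow>
            (\<exists>M. has_cycle_measurement S N p M \<and> is_homogeneous_polynomial M))"
proof -
  interpret crossing_network S A N
    by unfold_locales (use assms in \<open>simp_all add: simple_crossing_network_def\<close>)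
  have "\<exists>M. has_boundary_measurement S N u p v M \<and> is_homogeneous_polynomial M"
    if uv: "u \<in> bverts" "v \<in> bverts" for u v p
    unfolding has_boundary_measurement_def
  proof (rule formal_sum_homogeneous[OF finite_homologous_highway_paths[OF uv]])
    fix q q' assume "q \<in> {q. highway_path N u q v \<and> homologous_paths S N q p}"
      "q' \<in> {q. highway_path N u q v \<and> homologous_paths S N q p}"
    then have q: "highway_path N u q v" "homologous_paths S N q p"
      and q': "highway_path N u q' v" "homologous_paths S N q' p" by blast+
    note fl = highway_path_flow(1,2)[OF q(1) uv] and fl' = highway_path_flow(1,2)[OF q'(1) uv]
    have "null_homologous (\<lambda>e. int (count (mset q) e) - int (count (mset q') e))"
      unfolding null_homologous_diff[OF fl'(2) fl(2)] by (rule homologous_paths_diff[OF q(2) q'(2)])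
    from homologous_flows_crossings[OF fl'(1) fl(1) this]
    show "monomial_degree (path_weight N q) = monomial_degree (path_weight N q')"
      by (simp add: path_weight_def monomial_degree_passages_weight)
  qed
  moreover have "\<exists>M. has_cycle_measurement S N p M \<and> is_homogeneous_polynomial M"
    if p: "cycle_class S N p \<noteq> \<one>\<^bsub>homology_group 1 S\<^esub>" for p
    unfolding has_cycle_measurement_def
  proof (rule formal_sum_homogeneous)
    let ?L = "{q. highway_closed_walk N q \<and> H1_class S (walk_chain N q) = cycle_class S N p}"
    have *: "{q \<in> highway_cycles N. cycle_class S N q = cycle_class S N p} = cycle_of ` ?L"
    proof (intro equalityI subsetI)
      fix q assume "q \<in> {q \<in> highway_cycles N. cycle_class S N q = cycle_class S N p}"
      then obtain es where es: "highway_closed_walk N es" "q = cycle_of es" "cycle_class S N q = cycle_class S N p"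
        unfolding highway_cycles_def by blast
      have "H1_class S (walk_chain N es) = cycle_class S N p"
        using es(3) unfolding es(2) cycle_class_cycle_of .
      then show "q \<in> cycle_of ` ?L" using es(1,2) by blast
    next
      fix q assume "q \<in> cycle_of ` ?L"
      then obtain es where es: "q = cycle_of es" "highway_closed_walk N es" "H1_class S (walk_chain N es) = cycle_class S N p"
        by blast
      then have "cycle_class S N q = cycle_class S N p" by (simp only: cycle_class_cycle_of)
      then show "q \<in> {q \<in> highway_cycles N. cycle_class S N q = cycle_class S N p}"
        using es(1,2) unfolding highway_cycles_def by blast
    qed
    show "finite {q \<in> highway_cycles N. cycle_class S N q = cycle_class S N p}"
      unfolding * using finite_homologous_highway_closed_walks[OF p] by (rule finite_imageI)
    fix q q' assume "q \<in> {q \<in> highway_cycles N. cycle_class S N q = cycle_class S N p}"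
      "q' \<in> {q \<in> highway_cycles N. cycle_class S N q = cycle_class S N p}"
    then obtain es es' where es: "q = cycle_of es" "highway_closed_walk N es" "H1_class S (walk_chain N es) = cycle_class S N p"
      and es': "q' = cycle_of es'" "highway_closed_walk N es'" "H1_class S (walk_chain N es') = cycle_class S N p"
      unfolding * by blast
    note fl = highway_closed_walk_flow(1,2)[OF es(2)] and fl' = highway_closed_walk_flow(1,2)[OF es'(2)]
    have "null_homologous (\<lambda>e. int (count (mset es) e) - int (count (mset es') e))"
      unfolding null_homologous_diff[OF fl'(2) fl(2)]
      by (simp only: H1_class_eq_iff[symmetric] es(3) es'(3))
    from homologous_flows_crossings[OF fl'(1) fl(1) this]
    show "monomial_degree (cycle_weight N q) = monomial_degree (cycle_weight N q')"
      unfolding es(1) es'(1) cycle_weight_cycle_of closed_walk_weight_def monomial_degree_passages_weight .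
  qed
  ultimately show ?thesis by blast
qed

end
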